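(* For a general member $\eta\in D^+$, the Kuga–Satake variety $A^+(\eta)$ is isogenous to a product of abelian varieties $(A_1(\eta)\times A_2(\eta))^4$, where $A_1(\eta)$ and $A_2(\eta)$ are $8$-dimensional simple abelian varieties with $\operatorname{End}_{\mathbb{Q}}(A_i(\eta))=\mathbf{F}$ ($i=1,2$).
   Context: $T$ is the lattice $\mathbb{Z}^8$ with basis $\varepsilon_1,\dots,\varepsilon_8$ and Gram matrix $A=U(2)\oplus U(2)\oplus(-2I_4)$, $U(2)=\begin{pmatrix}0&2\\2&0\end{pmatrix}$; $V_k=T\otimes k$ for $k=\mathbb{Q},\mathbb{R}$; $Q(x)={}^txAx$ is the quadratic form on $T$ and $V_k$. $C^+(V_k,Q)$ and $C^+(T,Q)$ are the even Clifford algebras over $k$ and over $\mathbb{Z}$ (even part of the tensor algebra modulo the relations $x\otimes x=Q(x)$). $C^+(V_{\mathbb{R}},Q)$ is a real vector space of dimension $128$ containing $C^+(T,Q)$ as a lattice. $D^+=\{\eta=[\eta_1,\dots,\eta_8]\in\mathbb{P}^7(\mathbb{C}):{}^t\eta A\eta=0,\ {}^t\bar\eta A\eta>0,\ \operatorname{Im}(\eta_3/\eta_1)>0\}$. For $\eta\in D^+$ choose a representative vector $\underline\eta=m_1(\eta)+\sqrt{-1}\,m_2(\eta)$ with $m_1(\eta),m_2(\eta)\in\mathbb{R}^8=V_{\mathbb{R}}$, normalized so that $(m_1(\eta)m_2(\eta))^2=-1$ in $C^+(V_{\mathbb{R}},Q)$ (unique up to a complex unit). Then $m(\eta)=m_1(\eta)m_2(\eta)\in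 C^+(V_{\mathbb{R}},Q)$ depends only on $\eta$, and left multiplication by $m(\eta)$ is a complex structure on $C^+(V_{\mathbb{R}},Q)$. $A^+(\eta)$ is the complex torus $C^+(V_{\mathbb{R}},Q)/C^+(T,Q)$ with this complex structure. It is an abelian variety with Riemann form $E(x,y)=\operatorname{tr}(\alpha x^{\iota}y)$, where $e_1=\tfrac12(\varepsilon_1+\varepsilon_2)$, $e_2=\tfrac12(\varepsilon_3+\varepsilon_4)$, $e_3=\tfrac12(\varepsilon_1-\varepsilon_2)$, $e_4=\tfrac12(\varepsilon_3-\varepsilon_4)$, $e_i=\varepsilon_i$ for $i\ge5$, $\alpha=4e_2e_1$, and $\iota$ is the anti-involution reversing the order of products of the $e_i$. $\mathbf{F}=\mathbb{Q}\oplus\mathbb{Q}i\oplus\mathbb{Q}j\oplus\mathbb{Q}ij$ is the rational quaternion algebra with $i^2=j^2=-1$, $ij=-ji$. $\operatorname{End}_{\mathbb{Q}}(B)=\operatorname{End}(B)\otimes\mathbb{Q}$. "General" means: for $\eta$ outside a countable union of proper closed analytic subsets of $D^+$. *)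

theory Defs
  imports
    "HOL-Analysis.Analysis"
    "HOL-Library.Poly_Mapping"
    "HOL-Algebra.QuotRing"
begin

section \<open>The quadratic form\<close>

text \<open>
  The index type \<open>8\<close> has the elements \<open>1, \<dots>, 7, 8 = 0\<close>, so \<open>x $ 1, \<dots>, x $ 8\<close> are the
  eight coordinates with respect to \<open>\<epsilon>\<^sub>1, \<dots>, \<epsilon>\<^sub>8\<close>.
\<close>

definition gram :: "'a::comm_ring_1 ^ 8 ^ 8" where
  "gram = (\<chi> i j.
     if (i, j) \<in> {(1, 2), (2, 1), (3, 4), (4, 3)} then 2
     else if i = j \<and> i \<in> {5, 6, 7, 8} then - 2
     else 0)"

definition gram_bilin :: "'a::comm_ring_1 ^ 8 \<Rightarrow> 'a ^ 8 \<Rightarrow> 'a" where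
  "gram_bilin x y = (\<Sum>i\<in>UNIV. x $ i * (gram *v y) $ i)"

definition Q :: "'a::comm_ring_1 ^ 8 \<Rightarrow> 'a" where
  "Q x = gram_bilin x x"


section \<open>Clifford algebras\<close>

text \<open>
  The tensor algebra of the free module with basis \<open>\<epsilon>\<^sub>1, \<dots>, \<epsilon>\<^sub>8\<close> over a commutative ring is the
  monoid algebra of the free monoid of words in \<open>1, \<dots>, 8\<close>: the word \<open>[i, j, \<dots>, k]\<close> stands for
  \<open>\<epsilon>\<^sub>i \<otimes> \<epsilon>\<^sub>j \<otimes> \<dots> \<otimes> \<epsilon>\<^sub>k\<close>. The multiplication of \<^type>\<open>poly_mapping\<close> is written over an additive
  index monoid, so concatenation of words is denoted by \<open>+\<close>.
\<close>

datatype 'i ncword = NCWord (letters: "'i list")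

instantiation ncword :: (type) monoid_add
begin

definition zero_ncword :: "'a ncword" where
  "0 = NCWord []"

definition plus_ncword :: "'a ncword \<Rightarrow> 'a ncword \<Rightarrow> 'a ncword" where
  "v + w = NCWord (letters v @ letters w)"

instance
  by standard (simp_all add: zero_ncword_def plus_ncword_def)

end

type_synonym 'a tensor_alg = "8 ncword \<Rightarrow>\<^sub>0 'a"

definition tscalar :: "'a::comm_ring_1 \<Rightarrow> 'a tensor_alg" where
  "tscalar c = Poly_Mapping.single 0 c"

definition tvec :: "'a::comm_ring_1 ^ 8 \<Rightarrow> 'a tensor_alg" where
  "tvec x = (\<Sum>i\<in>UNIV. Poly_Mapping.single (NCWord [i]) (x $ i))"

definition teven :: "'a::comm_ring_1 tensor_alg set" where
  "teven = {p. \<forall>w\<in>Poly_Mapping.keys p. even (length (letters w))}"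

text \<open>The two-sided ideal generated by the elements \<open>x \<otimes> x - Q x\<close>.\<close>

inductive_set cliff_ideal :: "'a::comm_ring_1 tensor_alg set" where
  zero: "0 \<in> cliff_ideal"
| generator: "a * (tvec x * tvec x - tscalar (Q x)) * b \<in> cliff_ideal"
| add: "p \<in> cliff_ideal \<Longrightarrow> q \<in> cliff_ideal \<Longrightarrow> p + q \<in> cliff_ideal"

lemma cliff_ideal_mult:
  assumes "p \<in> cliff_ideal"
  shows "c * p * d \<in> cliff_ideal"
  using assms
proof induction
  case zero
  show ?case by (simp add: cliff_ideal.zero)
next
  case (generator a x b)
  show ?case
    using cliff_ideal.generator[of "c * a" x "b * d"] by (simp only: mult.assoc)
next
  case (add p q)
  then show ?case by (simp only: distrib_left distrib_right cliff_ideal.add)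
qed

lemma cliff_ideal_mult_left: "p \<in> cliff_ideal \<Longrightarrow> c * p \<in> cliff_ideal"
  using cliff_ideal_mult[of p c 1] by simp

lemma cliff_ideal_mult_right: "p \<in> cliff_ideal \<Longrightarrow> p * d \<in> cliff_ideal"
  using cliff_ideal_mult[of p 1 d] by simp

lemma cliff_ideal_uminus: "p \<in> cliff_ideal \<Longrightarrow> - p \<in> cliff_ideal"
  using cliff_ideal_mult_left[of p "- 1"] by simp

lemma cliff_ideal_diff: "p \<in> cliff_ideal \<Longrightarrow> q \<in> cliff_ideal \<Longrightarrow> p - q \<in> cliff_ideal"
  using cliff_ideal.add[OF _ cliff_ideal_uminus] by fastforce

definition cliff_rel :: "'a::comm_ring_1 tensor_alg \<Rightarrow> 'a tensor_alg \<Rightarrow> bool" where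
  "cliff_rel p q \<longleftrightarrow> p - q \<in> cliff_ideal"

lemma equivp_cliff_rel: "equivp cliff_rel"
proof (rule equivpI)
  show "reflp cliff_rel"
    by (simp add: reflp_def cliff_rel_def cliff_ideal.zero)
  show "symp cliff_rel"
    unfolding symp_def cliff_rel_def using cliff_ideal_uminus by fastforce
  show "transp cliff_rel"
    unfolding transp_def cliff_rel_def using cliff_ideal.add by fastforce
qed

quotient_type (overloaded) 'a cliff = "'a::comm_ring_1 tensor_alg" / cliff_rel
  by (rule equivp_cliff_rel)

instantiation cliff :: (comm_ring_1) "{ring, monoid_mult}"
begin

lift_definition zero_cliff :: "'a cliff" is 0 .

lift_definition one_cliff :: "'a cliff" is 1 .

lift_definition plus_cliff :: "'a cliff \<Rightarrow> 'a cliff \<Rightarrow> 'a cliff" is "(+)"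
  unfolding cliff_rel_def by (metis add_diff_add cliff_ideal.add)

lift_definition uminus_cliff :: "'a cliff \<Rightarrow> 'a cliff" is uminus
  unfolding cliff_rel_def by (metis minus_diff_minus cliff_ideal_uminus)

lift_definition minus_cliff :: "'a cliff \<Rightarrow> 'a cliff \<Rightarrow> 'a cliff" is "(-)"
proof (unfold cliff_rel_def)
  fix p p' q q' :: "'a tensor_alg"
  assume "p - p' \<in> cliff_ideal" "q - q' \<in> cliff_ideal"
  then have "(p - p') - (q - q') \<in> cliff_ideal" by (rule cliff_ideal_diff)
  then show "p - q - (p' - q') \<in> cliff_ideal" by (simp add: algebra_simps)
qed

lift_definition times_cliff :: "'a cliff \<Rightarrow> 'a cliff \<Rightarrow> 'a cliff" is "(*)"
proof (unfold cliff_rel_def)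
  fix p p' q q' :: "'a tensor_alg"
  assume "p - p' \<in> cliff_ideal" "q - q' \<in> cliff_ideal"
  then have "(p - p') * q + p' * (q - q') \<in> cliff_ideal"
    by (intro cliff_ideal.add cliff_ideal_mult_left cliff_ideal_mult_right)
  then show "p * q - p' * q' \<in> cliff_ideal" by (simp add: algebra_simps)
qed

instance
  by standard (transfer; simp add: cliff_rel_def algebra_simps cliff_ideal.zero)+

end

lift_definition cscalar :: "'a::comm_ring_1 \<Rightarrow> 'a cliff" is tscalar .

lift_definition cvec :: "'a::comm_ring_1 ^ 8 \<Rightarrow> 'a cliff" is tvec .

definition ceven :: "'a::comm_ring_1 cliff set" where
  "ceven = abs_cliff ` teven"

lemma cvec_square: "cvec x * cvec x = cscalar (Q x)"
  by transfer (use cliff_ideal.generator[of 1 _ 1] in \<open>simp add: cliff_rel_def\<close>)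

lemma cscalar_add: "cscalar (a + b) = cscalar a + cscalar b"
  by transfer (simp add: tscalar_def single_add cliff_rel_def cliff_ideal.zero)

lemma cscalar_mult: "cscalar (a * b) = cscalar a * cscalar b"
  by transfer (simp add: tscalar_def mult_single cliff_rel_def cliff_ideal.zero)

lemma cscalar_1: "cscalar 1 = 1"
  by transfer (simp add: tscalar_def cliff_rel_def cliff_ideal.zero)

instantiation cliff :: ("{comm_ring_1, real_algebra_1}") real_vector
begin

definition scaleR_cliff :: "real \<Rightarrow> 'a cliff \<Rightarrow> 'a cliff" where
  "scaleR_cliff r x = cscalar (of_real r) * x"

instance
  by standard
    (simp_all add: scaleR_cliff_def cscalar_add cscalar_mult cscalar_1 algebra_simps)

end

text \<open>The base change \<open>C(T, Q) \<rightarrow> C(V\<^sub>\<real>, Q)\<close>.\<close>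

definition tensor_base_change :: "int tensor_alg \<Rightarrow> real tensor_alg" where
  "tensor_base_change = Poly_Mapping.map of_int"

lemma lookup_tensor_base_change:
  "Poly_Mapping.lookup (tensor_base_change p) w = of_int (Poly_Mapping.lookup p w)"
  unfolding tensor_base_change_def by transfer (simp add: when_def)

lemma tensor_base_change_add:
  "tensor_base_change (p + q) = tensor_base_change p + tensor_base_change q"
  by (rule poly_mapping_eqI) (simp add: lookup_tensor_base_change lookup_add)

lemma tensor_base_change_0: "tensor_base_change 0 = 0"
  by (rule poly_mapping_eqI) (simp add: lookup_tensor_base_change)

lemma tensor_base_change_diff:
  "tensor_base_change (p - q) = tensor_base_change p - tensor_base_change q"
  by (rule poly_mapping_eqI) (simp add: lookup_tensor_base_change lookup_minus)

lemma tensor_base_change_sum: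
  "tensor_base_change (sum f A) = (\<Sum>x\<in>A. tensor_base_change (f x))"
  by (induction A rule: infinite_finite_induct)
    (simp_all add: tensor_base_change_0 tensor_base_change_add)

lemma tensor_base_change_single:
  "tensor_base_change (Poly_Mapping.single w c) = Poly_Mapping.single w (of_int c)"
  by (rule poly_mapping_eqI) (simp add: lookup_tensor_base_change lookup_single when_def)

lemma tensor_base_change_mult:
  "tensor_base_change (p * q) = tensor_base_change p * tensor_base_change q"
proof -
  have decomp: "p = (\<Sum>w\<in>Poly_Mapping.keys p.
      Poly_Mapping.single w (Poly_Mapping.lookup p w))" for p :: "int tensor_alg"
    by (rule poly_mapping_eqI)
      (simp add: lookup_sum lookup_single when_def in_keys_iff)
  have "tensor_base_change
      ((\<Sum>v\<in>A. Poly_Mapping.single v (f v)) * (\<Sum>w\<in>B. Poly_Mapping.single w (g w))) =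
    tensor_base_change (\<Sum>v\<in>A. Poly_Mapping.single v (f v)) *
    tensor_base_change (\<Sum>w\<in>B. Poly_Mapping.single w (g w))"
    for A B :: "8 ncword set" and f g
    by (simp add: sum_product tensor_base_change_sum tensor_base_change_single mult_single)
  from this[of "Poly_Mapping.lookup p" "Poly_Mapping.keys p"
      "Poly_Mapping.lookup q" "Poly_Mapping.keys q"]
  show ?thesis unfolding decomp[symmetric] .
qed

lemma Q_of_int: "Q (\<chi> i. (of_int (x $ i) :: real)) = of_int (Q x)"
proof -
  have "gram $ i $ j = (of_int (gram $ i $ j) :: real)" for i j :: 8
    by (auto simp: gram_def)
  then show ?thesis
    by (simp add: Q_def gram_bilin_def matrix_vector_mult_def)
qed

lemma tensor_base_change_tvec: "tensor_base_change (tvec x) = tvec (\<chi> i. of_int (x $ i))"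
  by (simp add: tvec_def tensor_base_change_sum tensor_base_change_single)

lemma tensor_base_change_ideal:
  "p \<in> cliff_ideal \<Longrightarrow> tensor_base_change p \<in> cliff_ideal"
proof (induction rule: cliff_ideal.induct)
  case zero
  show ?case by (simp add: tensor_base_change_0 cliff_ideal.zero)
next
  case (generator a x b)
  have "tensor_base_change (tscalar (Q x)) = tscalar (Q (\<chi> i. of_int (x $ i)))"
    by (simp add: tscalar_def tensor_base_change_single Q_of_int)
  then show ?case
    by (simp add: tensor_base_change_mult tensor_base_change_diff tensor_base_change_tvec
        cliff_ideal.generator)
next
  case (add p q)
  then show ?case by (simp add: tensor_base_change_add cliff_ideal.add)
qed

lift_definition cliff_base_change :: "int cliff \<Rightarrow> real cliff" is tensor_base_change
  unfolding cliff_rel_def by (metis tensor_base_change_diff tensor_base_change_ideal)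


section \<open>Complex tori and abelian varieties\<close>

text \<open>
  The torus \<open>V / \<Lambda>\<close> is given by the real vector space \<open>V\<close> (a subspace of some type), the
  lattice \<open>\<Lambda>\<close> and the complex structure \<open>J\<close> on \<open>V\<close>.
\<close>

record 'a torus =
  tspace :: "'a set"
  tlattice :: "'a set"
  tcplx :: "'a \<Rightarrow> 'a"

definition full_lattice :: "'a::real_vector set \<Rightarrow> 'a set \<Rightarrow> bool" where
  "full_lattice V L \<longleftrightarrow>
     (\<exists>B. finite B \<and> independent B \<and> span B = V \<and>
          L = range (\<lambda>c :: 'a \<Rightarrow> int. \<Sum>b\<in>B. of_int (c b) *\<^sub>R b))"

definition real_linear_on ::
    "'a::real_vector set \<Rightarrow> 'b::real_vector set \<Rightarrow> ('a \<Rightarrow> 'b) \<Rightarrow> bool" where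
  "real_linear_on V W f \<longleftrightarrow>
     f \<in> V \<rightarrow> W \<and>
     (\<forall>x\<in>V. \<forall>y\<in>V. f (x + y) = f x + f y) \<and>
     (\<forall>r. \<forall>x\<in>V. f (r *\<^sub>R x) = r *\<^sub>R f x)"

definition complex_torus :: "'a::real_vector torus \<Rightarrow> bool" where
  "complex_torus S \<longleftrightarrow>
     subspace (tspace S) \<and>
     full_lattice (tspace S) (tlattice S) \<and>
     real_linear_on (tspace S) (tspace S) (tcplx S) \<and>
     (\<forall>x\<in>tspace S. tcplx S (tcplx S x) = - x)"

definition torus_dim :: "'a::real_vector torus \<Rightarrow> nat" where
  "torus_dim S = dim (tspace S) div 2"

definition riemann_form :: "'a::real_vector torus \<Rightarrow> ('a \<Rightarrow> 'a \<Rightarrow> real) \<Rightarrow> bool" where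
  "riemann_form S E \<longleftrightarrow>
     (\<forall>x\<in>tspace S. real_linear_on (tspace S) UNIV (E x)) \<and>
     (\<forall>y\<in>tspace S. real_linear_on (tspace S) UNIV (\<lambda>x. E x y)) \<and>
     (\<forall>x\<in>tspace S. E x x = 0) \<and>
     (\<forall>x\<in>tlattice S. \<forall>y\<in>tlattice S. E x y \<in> \<int>) \<and>
     (\<forall>x\<in>tspace S. \<forall>y\<in>tspace S. E (tcplx S x) (tcplx S y) = E x y) \<and>
     (\<forall>x\<in>tspace S. x \<noteq> 0 \<longrightarrow> E x (tcplx S x) > 0)"

definition abelian_variety :: "'a::real_vector torus \<Rightarrow> bool" where
  "abelian_variety S \<longleftrightarrow> complex_torus S \<and> (\<exists>E. riemann_form S E)"

text \<open>
  A homomorphism of complex tori \<open>V / \<Lambda> \<rightarrow> V' / \<Lambda>'\<close> is represented by the complex linear map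
  \<open>V \<rightarrow> V'\<close> with \<open>\<Lambda> \<rightarrow> \<Lambda>'\<close> which induces it. This linear map is unique; it is made
  extensional so that it is also unique as a function on the type.
\<close>

definition complex_linear ::
    "'a::real_vector torus \<Rightarrow> 'b::real_vector torus \<Rightarrow> ('a \<Rightarrow> 'b) \<Rightarrow> bool" where
  "complex_linear S S' f \<longleftrightarrow>
     f \<in> extensional (tspace S) \<and>
     real_linear_on (tspace S) (tspace S') f \<and>
     (\<forall>x\<in>tspace S. f (tcplx S x) = tcplx S' (f x))"

definition torus_hom ::
    "'a::real_vector torus \<Rightarrow> 'b::real_vector torus \<Rightarrow> ('a \<Rightarrow> 'b) set" where
  "torus_hom S S' = {f. complex_linear S S' f \<and> f ` tlattice S \<subseteq> tlattice S'}"

definition torus_point :: "'a::real_vector torus \<Rightarrow> 'a \<Rightarrow> 'a set" where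
  "torus_point S x = {y \<in> tspace S. y - x \<in> tlattice S}"

text \<open>Surjective with finite kernel, as a map of the quotient groups.\<close>

definition isogeny ::
    "'a::real_vector torus \<Rightarrow> 'b::real_vector torus \<Rightarrow> ('a \<Rightarrow> 'b) \<Rightarrow> bool" where
  "isogeny S S' f \<longleftrightarrow>
     f \<in> torus_hom S S' \<and>
     (\<lambda>x. torus_point S' (f x)) ` tspace S = torus_point S' ` tspace S' \<and>
     finite (torus_point S ` {x \<in> tspace S. torus_point S' (f x) = torus_point S' 0})"

definition isogenous :: "'a::real_vector torus \<Rightarrow> 'b::real_vector torus \<Rightarrow> bool" where
  "isogenous S S' \<longleftrightarrow> complex_torus S \<and> complex_torus S' \<and> (\<exists>f. isogeny S S' f)"

text \<open>
  The subtori of \<open>V / \<Lambda>\<close> are the images of the subspaces \<open>W\<close> stable under \<open>J\<close> in which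
  \<open>W \<inter> \<Lambda>\<close> is a full lattice; a subtorus of an abelian variety is an abelian subvariety.
\<close>

definition simple_abelian_variety :: "'a::real_vector torus \<Rightarrow> bool" where
  "simple_abelian_variety S \<longleftrightarrow>
     abelian_variety S \<and> tspace S \<noteq> {0} \<and>
     (\<forall>W \<subseteq> tspace S.
        complex_torus (S\<lparr>tspace := W, tlattice := W \<inter> tlattice S\<rparr>) \<longrightarrow>
        W = {0} \<or> W = tspace S)"

definition torus_prod ::
    "'a::real_vector torus \<Rightarrow> 'b::real_vector torus \<Rightarrow> ('a \<times> 'b) torus" where
  "torus_prod S S' =
     \<lparr>tspace = tspace S \<times> tspace S',
      tlattice = tlattice S \<times> tlattice S',
      tcplx = map_prod (tcplx S) (tcplx S')\<rparr>"

definition torus_power :: "'a::real_vector torus \<Rightarrow> ('a ^ 'n) torus" where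
  "torus_power S =
     \<lparr>tspace = {v. \<forall>i. v $ i \<in> tspace S},
      tlattice = {v. \<forall>i. v $ i \<in> tlattice S},
      tcplx = (\<lambda>v. \<chi> i. tcplx S (v $ i))\<rparr>"

text \<open>
  \<open>End(B)\<close> is torsion-free and acts faithfully on \<open>V\<close>, so \<open>End(B) \<otimes> \<rat>\<close> is the set of all
  \<open>g / n\<close> with \<open>g \<in> End(B)\<close> (the image of \<open>g \<otimes> 1 / n\<close>) in the ring of complex linear
  endomorphisms of \<open>V\<close>.
\<close>

definition End_Q :: "'a::real_vector torus \<Rightarrow> ('a \<Rightarrow> 'a) ring" where
  "End_Q S =
     \<lparr>carrier = {\<lambda>x\<in>tspace S. (1 / real n) *\<^sub>R g x | g n. g \<in> torus_hom S S \<and> n > 0},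
      mult = compose (tspace S),
      one = (\<lambda>x\<in>tspace S. x),
      zero = (\<lambda>x\<in>tspace S. 0),
      add = (\<lambda>f g. \<lambda>x\<in>tspace S. f x + g x)\<rparr>"


section \<open>The rational quaternion algebra\<close>

text \<open>\<open>Quat a b c d\<close> is \<open>a + b i + c j + d ij\<close>, where \<open>i\<^sup>2 = j\<^sup>2 = -1\<close> and \<open>ij = - ji\<close>.\<close>

datatype rat_quat = Quat rat rat rat rat

fun quat_add :: "rat_quat \<Rightarrow> rat_quat \<Rightarrow> rat_quat" where
  "quat_add (Quat a b c d) (Quat a' b' c' d') = Quat (a + a') (b + b') (c + c') (d + d')"

fun quat_mult :: "rat_quat \<Rightarrow> rat_quat \<Rightarrow> rat_quat" where
  "quat_mult (Quat a b c d) (Quat a' b' c' d') =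
     Quat (a * a' - b * b' - c * c' - d * d')
          (a * b' + b * a' + c * d' - d * c')
          (a * c' - b * d' + c * a' + d * b')
          (a * d' + b * c' - c * b' + d * a')"

definition quat_ring :: "rat_quat ring" where
  "quat_ring =
     \<lparr>carrier = UNIV, mult = quat_mult, one = Quat 1 0 0 0,
      zero = Quat 0 0 0 0, add = quat_add\<rparr>"

lemma quat_relations:
  defines "i \<equiv> Quat 0 1 0 0" and "j \<equiv> Quat 0 0 1 0"
  shows "quat_mult i i = Quat (-1) 0 0 0" "quat_mult j j = Quat (-1) 0 0 0"
    "quat_mult i j = Quat 0 0 0 1" "quat_mult j i = Quat 0 0 0 (-1)"
  by (simp_all add: i_def j_def)

lemma ring_quat_ring: "ring quat_ring"
proof (rule ringI)
  show "abelian_group quat_ring"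
  proof (rule abelian_groupI)
    fix x assume "x \<in> carrier quat_ring"
    obtain a b c d where "x = Quat a b c d" by (cases x)
    then have "quat_add (Quat (- a) (- b) (- c) (- d)) x = Quat 0 0 0 0" by simp
    then show "\<exists>y\<in>carrier quat_ring. y \<oplus>\<^bsub>quat_ring\<^esub> x = \<zero>\<^bsub>quat_ring\<^esub>"
      by (auto simp: quat_ring_def)
  next
    fix x y assume "x \<in> carrier quat_ring" "y \<in> carrier quat_ring"
    show "x \<oplus>\<^bsub>quat_ring\<^esub> y = y \<oplus>\<^bsub>quat_ring\<^esub> x"
      by (cases x; cases y) (simp add: quat_ring_def)
  next
    fix x y z
    show "x \<oplus>\<^bsub>quat_ring\<^esub> y \<oplus>\<^bsub>quat_ring\<^esub> z = x \<oplus>\<^bsub>quat_ring\<^esub> (y \<oplus>\<^bsub>quat_ring\<^esub> z)"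
      by (cases x; cases y; cases z) (simp add: quat_ring_def)
  next
    fix x
    show "\<zero>\<^bsub>quat_ring\<^esub> \<oplus>\<^bsub>quat_ring\<^esub> x = x"
      by (cases x) (simp add: quat_ring_def)
  qed (simp_all add: quat_ring_def)
  show "Group.monoid quat_ring"
  proof (rule monoidI)
    fix x y z
    show "x \<otimes>\<^bsub>quat_ring\<^esub> y \<otimes>\<^bsub>quat_ring\<^esub> z = x \<otimes>\<^bsub>quat_ring\<^esub> (y \<otimes>\<^bsub>quat_ring\<^esub> z)"
      by (cases x; cases y; cases z) (simp add: quat_ring_def algebra_simps)
  next
    fix x
    show "\<one>\<^bsub>quat_ring\<^esub> \<otimes>\<^bsub>quat_ring\<^esub> x = x"
      by (cases x) (simp add: quat_ring_def)
    show "x \<otimes>\<^bsub>quat_ring\<^esub> \<one>\<^bsub>quat_ring\<^esub> = x"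
      by (cases x) (simp add: quat_ring_def)
  qed (simp_all add: quat_ring_def)
next
  fix x y z
  show "(x \<oplus>\<^bsub>quat_ring\<^esub> y) \<otimes>\<^bsub>quat_ring\<^esub> z =
      x \<otimes>\<^bsub>quat_ring\<^esub> z \<oplus>\<^bsub>quat_ring\<^esub> y \<otimes>\<^bsub>quat_ring\<^esub> z"
    by (cases x; cases y; cases z) (simp add: quat_ring_def algebra_simps)
  show "z \<otimes>\<^bsub>quat_ring\<^esub> (x \<oplus>\<^bsub>quat_ring\<^esub> y) =
      z \<otimes>\<^bsub>quat_ring\<^esub> x \<oplus>\<^bsub>quat_ring\<^esub> z \<otimes>\<^bsub>quat_ring\<^esub> y"
    by (cases x; cases y; cases z) (simp add: quat_ring_def algebra_simps)
qed


section \<open>Projective space and general points\<close>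

definition proportional :: "complex ^ 8 \<Rightarrow> complex ^ 8 \<Rightarrow> bool" where
  "proportional v w \<longleftrightarrow> v \<noteq> 0 \<and> (\<exists>c. c \<noteq> 0 \<and> w = c *s v)"

quotient_type proj7 = "complex ^ 8" / partial: proportional
proof (rule part_equivpI)
  have "proportional 1 1"
    unfolding proportional_def by (intro conjI exI[of _ 1]) simp_all
  then show "\<exists>v. proportional v v" ..
  show "symp proportional"
  proof (rule sympI)
    fix v w assume "proportional v w"
    then obtain c where c: "v \<noteq> 0" "c \<noteq> 0" "w = c *s v"
      unfolding proportional_def by blast
    then have "v = inverse c *s w" by (simp add: vector_smult_assoc)
    with c show "proportional w v"
      unfolding proportional_def by (metis inverse_nonzero_iff_nonzero vector_smult_rzero)
  qed
  show "transp proportional"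
  proof (rule transpI)
    fix u v w assume "proportional u v" "proportional v w"
    then show "proportional u w"
      unfolding proportional_def by (metis mult_eq_0_iff vector_smult_assoc)
  qed
qed

text \<open>
  The topology and the holomorphic functions of \<open>\<P>\<^sup>7(\<complex>)\<close> are those induced by the projection
  from the nonzero vectors. The value of \<^const>\<open>abs_proj7\<close> at \<open>0\<close> is irrelevant.
\<close>

definition proj_open :: "proj7 set \<Rightarrow> bool" where
  "proj_open U \<longleftrightarrow> open {v. v \<noteq> 0 \<and> abs_proj7 v \<in> U}"

definition proj_holomorphic_on :: "(proj7 \<Rightarrow> complex) \<Rightarrow> proj7 set \<Rightarrow> bool" where
  "proj_holomorphic_on f U \<longleftrightarrow>
     (\<forall>v. v \<noteq> 0 \<and> abs_proj7 v \<in> U \<longrightarrow>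
        (\<exists>L. ((\<lambda>w. f (abs_proj7 w)) has_derivative L) (at v) \<and> (\<forall>c w. L (c *s w) = c * L w)))"

text \<open>
  Closed analytic subsets of a locally closed complex submanifold \<open>D\<close> of \<open>\<P>\<^sup>7(\<complex>)\<close>: locally
  around every point of \<open>D\<close>, the common zeros in \<open>D\<close> of finitely many holomorphic functions.
\<close>

definition analytic_subset :: "proj7 set \<Rightarrow> proj7 set \<Rightarrow> bool" where
  "analytic_subset D Z \<longleftrightarrow>
     Z \<subseteq> D \<and>
     (\<forall>p\<in>D. \<exists>U F. proj_open U \<and> p \<in> U \<and> finite F \<and> (\<forall>f\<in>F. proj_holomorphic_on f U) \<and>
        Z \<inter> U = {q \<in> D \<inter> U. \<forall>f\<in>F. f q = 0})"

definition for_general :: "proj7 set \<Rightarrow> (proj7 \<Rightarrow> bool) \<Rightarrow> bool" where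
  "for_general D P \<longleftrightarrow>
     (\<exists>\<Z>. countable \<Z> \<and> (\<forall>Z\<in>\<Z>. analytic_subset D Z \<and> Z \<noteq> D) \<and> (\<forall>p\<in>D - \<Union>\<Z>. P p))"


section \<open>The Kuga--Satake varieties\<close>

definition cnj_vec :: "complex ^ 'n \<Rightarrow> complex ^ 'n" where
  "cnj_vec v = (\<chi> i. cnj (v $ i))"

text \<open>
  \<open>\<^sup>t\<eta>\<bar> A \<eta>\<close> is a real number, as \<open>A\<close> is real and symmetric. Division by zero gives zero, hence
  the last condition includes \<open>\<eta>\<^sub>1 \<noteq> 0\<close>.
\<close>

definition D_plus :: "proj7 set" where
  "D_plus = {abs_proj7 v | v.
     v \<noteq> 0 \<and> gram_bilin v v = 0 \<and> Re (gram_bilin (cnj_vec v) v) > 0 \<and> Im (v $ 3 / v $ 1) > 0}"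

definition Re_vec :: "complex ^ 'n \<Rightarrow> real ^ 'n" where
  "Re_vec v = (\<chi> i. Re (v $ i))"

definition Im_vec :: "complex ^ 'n \<Rightarrow> real ^ 'n" where
  "Im_vec v = (\<chi> i. Im (v $ i))"

text \<open>
  The normalized representatives of \<open>\<eta> \<in> D\<^sup>+\<close> differ by complex units and all give the same
  value of \<open>m\<^sub>1(\<eta>) m\<^sub>2(\<eta>)\<close>.
\<close>

definition ks_m :: "proj7 \<Rightarrow> real cliff" where
  "ks_m \<eta> = (THE m. \<exists>v. v \<noteq> 0 \<and> abs_proj7 v = \<eta> \<and>
      m = cvec (Re_vec v) * cvec (Im_vec v) \<and> m * m = - 1)"

definition kuga_satake :: "proj7 \<Rightarrow> real cliff torus" where
  "kuga_satake \<eta> =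
     \<lparr>tspace = ceven,
      tlattice = cliff_base_change ` ceven,
      tcplx = (\<lambda>x. ks_m \<eta> * x)\<rparr>"

end

theory Submission
  imports Defs
begin

text \<open>
  Over \<open>\<rat>\<close> the form splits as two hyperbolic planes and \<open>- 2 N\<close>, where \<open>N\<close> is the norm form of \<open>F\<close>. Hence
  each half-spin module is \<open>F\<^sup>4\<close>, and \<open>C\<^sup>+\<close> is the sum of two copies of the algebra of \<open>F\<close>-linear
  endomorphisms of \<open>F\<^sup>4\<close>. Applying an even Clifford element to the four standard vectors of both
  half-spin modules identifies \<open>C\<^sup>+\<close> with \<open>(F\<^sup>4 \<oplus> F\<^sup>4)\<^sup>4\<close>, compatibly with left multiplication by
  \<open>m(\<eta>)\<close>; this is the isogeny. A rational endomorphism \<open>g\<close> of a half-spin module commutes with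
  \<open>m(\<eta>)\<close> only on the analytic locus \<open>\<eta> g \<eta> = 0\<close>. There are countably many \<open>g\<close>, and if the locus is all
  of \<open>D\<^sup>+\<close>, then \<open>g\<close> commutes with \<open>C\<^sup>+\<close>, so it is a right multiplication by a quaternion. Since \<open>F\<close>
  is a division algebra, the orthogonal projection to an abelian subvariety is \<open>0\<close> or \<open>1\<close>.
\<close>

text \<open>The dimension of C^+ is not presupposed. Normal ordering bounds it by 128 from above.
  For the lower bound, monomials in an orthogonal basis stay independent modulo every proper
  two-sided ideal; applied to the kernel of the spinor action, this gives the dimension and
  faithfulness together, and evaluation at the generators becomes bijective by the count 4 * (16 +
  16) = 128. Its surjectivity supplies enough even elements to compute the commutant by hand. The
  delicate point for the polarization is a sign: the component \<open>D_plus\<close> is singled out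
  by the first and third coordinates, whereas positivity depends on the orientation of a plane
  projected to the span of e_1 and e_2. A path of determinants without zeros compares the two. The
  half-spin modules differ only by an exchange of two operators, so the theory is developed once, in
  a locale, and interpreted twice.\<close>

lemma exhaust_8:
  fixes x :: 8
  shows "x = 1 \<or> x = 2 \<or> x = 3 \<or> x = 4 \<or> x = 5 \<or> x = 6 \<or> x = 7 \<or> x = 8"
proof (induct x)
  case (of_int z)
  then have "z = 0 \<or> z = 1 \<or> z = 2 \<or> z = 3 \<or> z = 4 \<or> z = 5 \<or> z = 6 \<or> z = 7" by fastforce
  then show ?case by auto
qed

lemma UNIV_8: "UNIV = {1, 2, 3, 4, 5, 6, 7, 8 :: 8}"
  using exhaust_8 by auto

lemma sum_8: "sum f (UNIV :: 8 set) = f 1 + f 2 + f 3 + f 4 + f 5 + f 6 + f 7 + f 8"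
  unfolding UNIV_8 by (simp add: ac_simps)

lemma forall_8: "(\<forall>i::8. P i) \<longleftrightarrow> P 1 \<and> P 2 \<and> P 3 \<and> P 4 \<and> P 5 \<and> P 6 \<and> P 7 \<and> P 8"
  by (metis exhaust_8)

section \<open>The quadratic form in coordinates\<close>

lemma gram_bilin_expand:
  "gram_bilin x y = 2 * (x $ 1 * y $ 2 + x $ 2 * y $ 1 + x $ 3 * y $ 4 + x $ 4 * y $ 3
     - x $ 5 * y $ 5 - x $ 6 * y $ 6 - x $ 7 * y $ 7 - x $ 8 * y $ 8)"
  unfolding gram_bilin_def gram_def matrix_vector_mult_def
  by (simp add: sum_8 algebra_simps)

lemma Q_expand:
  "Q x = 4 * (x $ 1 * x $ 2 + x $ 3 * x $ 4)
     - 2 * (x $ 5 * x $ 5 + x $ 6 * x $ 6 + x $ 7 * x $ 7 + x $ 8 * x $ 8)"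
  unfolding Q_def gram_bilin_expand by (simp add: algebra_simps)

lemma gram_bilin_commute: "gram_bilin x y = gram_bilin y x"
  by (simp add: gram_bilin_expand algebra_simps)

lemma gram_bilin_add_left: "gram_bilin (x + y) z = gram_bilin x z + gram_bilin y z"
  by (simp add: gram_bilin_expand algebra_simps)

lemma gram_bilin_add_right: "gram_bilin z (x + y) = gram_bilin z x + gram_bilin z y"
  by (simp add: gram_bilin_expand algebra_simps)

lemma gram_bilin_scale_left: "gram_bilin (r *\<^sub>R x) y = r * gram_bilin x y" for r :: real
  by (simp add: gram_bilin_expand algebra_simps)

lemma gram_bilin_scale_right: "gram_bilin x (r *\<^sub>R y) = r * gram_bilin x y" for r :: real
  by (simp add: gram_bilin_expand algebra_simps)

lemma gram_bilin_minus_left: "gram_bilin (- x) y = - gram_bilin x y"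
  by (simp add: gram_bilin_expand algebra_simps)

lemma gram_bilin_minus_right: "gram_bilin x (- y) = - gram_bilin x y"
  by (simp add: gram_bilin_expand algebra_simps)

lemmas gram_bilin_simps = gram_bilin_add_left gram_bilin_add_right gram_bilin_scale_left
  gram_bilin_scale_right gram_bilin_minus_left gram_bilin_minus_right

lemma Q_add: "Q (x + y) = Q x + 2 * gram_bilin x y + Q y"
  unfolding Q_def gram_bilin_add_left gram_bilin_add_right gram_bilin_commute[of y x] by simp

lemma Q_scale: "Q (r *\<^sub>R x) = r\<^sup>2 * Q x" for r :: real
  by (simp add: Q_def gram_bilin_simps power2_eq_square)

section \<open>Scalars and the anticommutation relation\<close>

lemma cscalar_central: "cscalar r * x = x * cscalar r"
proof (transfer, unfold cliff_rel_def)
  fix r :: 'a and p :: "'a tensor_alg"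
  have decomp: "p = (\<Sum>w\<in>Poly_Mapping.keys p.
      Poly_Mapping.single w (Poly_Mapping.lookup p w))"
    by (rule poly_mapping_eqI) (simp add: lookup_sum lookup_single when_def in_keys_iff)
  have "tscalar r * p = p * tscalar r"
    by (subst (1 2) decomp)
      (simp add: tscalar_def sum_distrib_left sum_distrib_right mult_single mult.commute)
  then show "tscalar r * p - p * tscalar r \<in> cliff_ideal" by (simp add: cliff_ideal.zero)
qed

lemma cliff_scaleR_eq: "r *\<^sub>R x = cscalar r * x" for x :: "real cliff"
  by (simp add: scaleR_cliff_def)

lemma cliff_mult_scaleR_left: "(r *\<^sub>R x) * y = r *\<^sub>R (x * y)" for x y :: "real cliff"
  by (simp add: cliff_scaleR_eq mult.assoc)

lemma cliff_mult_scaleR_right: "x * (r *\<^sub>R y) = r *\<^sub>R (x * y)" for x y :: "real cliff"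
  by (simp add: cliff_scaleR_eq mult.assoc[symmetric]) (simp add: cscalar_central)

lemma cvec_add: "cvec (x + y) = cvec x + cvec y"
  by transfer
    (simp add: tvec_def single_add sum.distrib cliff_rel_def cliff_ideal.zero)

lemma tvec_axis: "tvec (axis i 1) = Poly_Mapping.single (NCWord [i]) 1"
proof -
  have "tvec (axis i (1::'a)) =
      (\<Sum>j\<in>UNIV. if j = i then Poly_Mapping.single (NCWord [i]) 1 else 0)"
    unfolding tvec_def by (rule sum.cong) (auto simp: axis_def)
  then show ?thesis by simp
qed

lemma cvec_scale: "cvec (r *\<^sub>R x) = r *\<^sub>R cvec x" for x :: "real ^ 8"
  by (simp add: cliff_scaleR_eq cvec.abs_eq cscalar.abs_eq times_cliff.abs_eq tvec_def tscalar_def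
      sum_distrib_left mult_single zero_ncword_def plus_ncword_def)

lemma cvec_anticommutator:
  "cvec x * cvec y + cvec y * cvec x = (2 * gram_bilin x y) *\<^sub>R 1" for x y :: "real ^ 8"
proof -
  have "cvec (x + y) * cvec (x + y) = cscalar (Q (x + y))" by (rule cvec_square)
  then have "cscalar (Q x) + (cvec x * cvec y + cvec y * cvec x) + cscalar (Q y) =
      cscalar (Q x) + cscalar (2 * gram_bilin x y) + cscalar (Q y)"
    by (simp add: cvec_add Q_add cscalar_add distrib_left distrib_right cvec_square ac_simps)
  then show ?thesis by (simp add: cliff_scaleR_eq)
qed

lemma cvec_square': "cvec x * cvec x = Q x *\<^sub>R 1" for x :: "real ^ 8"
  by (simp add: cvec_square cliff_scaleR_eq)

subsection \<open>Monomials\<close>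

definition cmon :: "8 list \<Rightarrow> 'a::comm_ring_1 cliff" where
  "cmon w = prod_list (map (\<lambda>i. cvec (axis i 1)) w)"

lemma cmon_Nil: "cmon [] = 1"
  and cmon_Cons: "cmon (i # w) = cvec (axis i 1) * cmon w"
  by (simp_all add: cmon_def)

lemma cmon_eq: "cmon w = abs_cliff (Poly_Mapping.single (NCWord w) 1)"
proof (induction w)
  case Nil
  show ?case
    by (simp add: cmon_def one_cliff_def flip: zero_ncword_def)
next
  case (Cons i w)
  then show ?case
    by (simp add: cmon_Cons cvec.abs_eq times_cliff.abs_eq tvec_axis mult_single plus_ncword_def)
qed

lemma tensor_alg_decomp:
  "p = (\<Sum>w\<in>Poly_Mapping.keys p. Poly_Mapping.single w (Poly_Mapping.lookup p w))"
  by (rule poly_mapping_eqI) (simp add: lookup_sum lookup_single when_def in_keys_iff)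

lemma abs_cliff_sum: "abs_cliff (sum f A) = (\<Sum>x\<in>A. abs_cliff (f x))"
  by (induction A rule: infinite_finite_induct)
    (simp_all add: plus_cliff.abs_eq[symmetric] zero_cliff_def)

lemma abs_cliff_single:
  "abs_cliff (Poly_Mapping.single w c) = cscalar c * cmon (letters w)"
  by (cases w) (simp add: cmon_eq cscalar.abs_eq times_cliff.abs_eq tscalar_def mult_single)

lemma abs_cliff_expand:
  "abs_cliff p =
    (\<Sum>w\<in>Poly_Mapping.keys p. cscalar (Poly_Mapping.lookup p w) * cmon (letters w))"
  by (subst tensor_alg_decomp) (simp only: abs_cliff_sum abs_cliff_single)

lemma teven_add: "p \<in> teven \<Longrightarrow> q \<in> teven \<Longrightarrow> p + q \<in> teven"
  using keys_add[of p q] by (auto simp: teven_def)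

lemma ceven_0: "0 \<in> ceven"
  unfolding ceven_def zero_cliff_def by (rule imageI) (simp add: teven_def)

lemma ceven_add: "x \<in> ceven \<Longrightarrow> y \<in> ceven \<Longrightarrow> x + y \<in> ceven"
  unfolding ceven_def by (auto simp: plus_cliff.abs_eq intro!: teven_add imageI)

lemma ceven_monomial: "even (length w) \<Longrightarrow> cscalar c * cmon w \<in> ceven"
  unfolding ceven_def using abs_cliff_single[of "NCWord w" c]
  by (intro image_eqI[of _ _ "Poly_Mapping.single (NCWord w) c"]) (auto simp: teven_def)

subsection \<open>Linear combinations with coefficients in a subring\<close>

text \<open>With all reals or only the integers as \<open>K\<close>, a single normal ordering
  argument yields both the real span of the ordered monomials and the lattice generated by
  them.\<close>

inductive_set gspan :: "real set \<Rightarrow> 'a::real_vector set \<Rightarrow> 'a set" for K B where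
  zero: "0 \<in> gspan K B"
| step: "k \<in> K \<Longrightarrow> b \<in> B \<Longrightarrow> x \<in> gspan K B \<Longrightarrow> k *\<^sub>R b + x \<in> gspan K B"

lemma gspan_add: "x \<in> gspan K B \<Longrightarrow> y \<in> gspan K B \<Longrightarrow> x + y \<in> gspan K B"
  by (induction rule: gspan.induct) (auto simp: add.assoc intro: gspan.step)

lemma gspan_base: "1 \<in> K \<Longrightarrow> b \<in> B \<Longrightarrow> b \<in> gspan K B"
  using gspan.step[OF _ _ gspan.zero, of 1 K b B] by simp

lemma gspan_scale:
  assumes "\<And>k l. k \<in> K \<Longrightarrow> l \<in> K \<Longrightarrow> k * l \<in> K" "k \<in> K" "x \<in> gspan K B"
  shows "k *\<^sub>R x \<in> gspan K B"
  using assms(3)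
  by induction (auto simp: scaleR_add_right intro: gspan.intros assms(1,2))

lemma gspan_mono: "B \<subseteq> C \<Longrightarrow> x \<in> gspan K B \<Longrightarrow> x \<in> gspan K C"
  by (erule gspan.induct) (auto intro: gspan.intros)

lemma gspan_UNIV: "gspan UNIV B = span B"
proof (intro equalityI subsetI)
  show "x \<in> span B" if "x \<in> gspan UNIV B" for x
    using that by induction (auto intro: span_zero span_add span_scale span_base)
  show "x \<in> gspan UNIV B" if "x \<in> span B" for x
    using that by (induction rule: span_induct_alt) (auto intro: gspan.intros)
qed

lemma gspan_Ints:
  assumes "finite B"
  shows "gspan \<int> B = range (\<lambda>c :: 'a::real_vector \<Rightarrow> int. \<Sum>b\<in>B. of_int (c b) *\<^sub>R b)"
proof (intro equalityI subsetI)
  fix x assume "x \<in> gspan \<int> B"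
  then show "x \<in> range (\<lambda>c. \<Sum>b\<in>B. of_int (c b) *\<^sub>R b)"
  proof induction
    case zero
    show ?case by (rule image_eqI[of _ _ "\<lambda>_. 0"]) auto
  next
    case (step k b x)
    then obtain c n where c: "x = (\<Sum>b\<in>B. of_int (c b) *\<^sub>R b)" and n: "k = of_int n"
      by (auto elim: Ints_cases)
    have "k *\<^sub>R b + x = (\<Sum>d\<in>B. (if d = b then k *\<^sub>R b else 0)) + x"
      using assms step(2) by simp
    also have "\<dots> = (\<Sum>d\<in>B. of_int (if d = b then n + c d else c d) *\<^sub>R d)"
      unfolding c sum.distrib[symmetric]
      by (rule sum.cong) (auto simp: n scaleR_add_left)
    finally have "k *\<^sub>R b + x = (\<Sum>d\<in>B. of_int (if d = b then n + c d else c d) *\<^sub>R d)" .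
    then show ?case by (intro image_eqI) auto
  qed
next
  fix x assume "x \<in> range (\<lambda>c :: 'a \<Rightarrow> int. \<Sum>b\<in>B. of_int (c b) *\<^sub>R b)"
  then obtain c :: "'a \<Rightarrow> int" where x: "x = (\<Sum>b\<in>B. of_int (c b) *\<^sub>R b)" by auto
  have "(\<Sum>b\<in>C. of_int (c b) *\<^sub>R b) \<in> gspan \<int> B" if "C \<subseteq> B" for C
    using finite_subset[OF that assms] that
    by (induction C) (auto intro: gspan.intros)
  then show "x \<in> gspan \<int> B" by (simp add: x)
qed

lemma gspan_sum: "(\<And>i. i \<in> I \<Longrightarrow> f i \<in> gspan K B) \<Longrightarrow> sum f I \<in> gspan K B"
  by (induction I rule: infinite_finite_induct) (auto intro: gspan.zero gspan_add)

lemma gspan_map: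
  assumes "\<And>x y. f (x + y) = f x + f y" "\<And>k x. f (k *\<^sub>R x) = k *\<^sub>R f x"
    and "\<And>k l. k \<in> K \<Longrightarrow> l \<in> K \<Longrightarrow> k * l \<in> K"
    and "\<And>b. b \<in> B \<Longrightarrow> f b \<in> gspan K C" and "x \<in> gspan K B"
  shows "f x \<in> gspan K C"
  using assms(5)
proof induction
  case zero
  have "f 0 = 0" using assms(2)[of 0 0] by simp
  then show ?case by (simp add: gspan.zero)
next
  case (step k b x)
  then show ?case using assms by (simp add: gspan_add gspan_scale)
qed

subsection \<open>Normal ordering\<close>

text \<open>The flag is \<open>True\<close> for products of an even number of the vectors.\<close>

fun mons :: "bool \<Rightarrow> (real ^ 8) list \<Rightarrow> real cliff set" where
  "mons p [] = (if p then {1} else {})"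
| "mons p (g # gs) = mons p gs \<union> (*) (cvec g) ` mons (\<not> p) gs"

text \<open>Moving \<open>g\<close> to its place exchanges it with each earlier vector
  \<open>h\<close> at the cost of the scalar \<open>2 * gram_bilin g h\<close>, and meeting itself
  it leaves \<open>Q g\<close>. Only these numbers have to lie in the subring \<open>K\<close>, so
  the argument also works over the integers.\<close>

lemma mult_mons:
  fixes K :: "real set"
  assumes ring: "1 \<in> K" "\<And>k l. k \<in> K \<Longrightarrow> l \<in> K \<Longrightarrow> k * l \<in> K" "\<And>k. k \<in> K \<Longrightarrow> - k \<in> K"
    and bil: "\<And>x y. x \<in> set gs \<Longrightarrow> y \<in> set gs \<Longrightarrow> 2 * gram_bilin x y \<in> K"
    and sq: "\<And>x. x \<in> set gs \<Longrightarrow> Q x \<in> K"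
  shows "g \<in> set gs \<Longrightarrow> x \<in> gspan K (mons p gs) \<Longrightarrow> cvec g * x \<in> gspan K (mons (\<not> p) gs)"
  using bil sq
proof (induction gs arbitrary: p g x)
  case Nil
  then show ?case by simp
next
  case (Cons h hs)
  have IH: "cvec g * x \<in> gspan K (mons (\<not> p) hs)"
    if "g \<in> set hs" "x \<in> gspan K (mons p hs)" for g p x
    using Cons.IH[of g x p] that Cons.prems by simp
  have lift: "cvec h * x \<in> gspan K (mons (\<not> p) (h # hs))" if "x \<in> gspan K (mons p hs)" for x p
    using _ _ ring(2) _ that
    by (rule gspan_map)
      (auto simp: distrib_left cliff_mult_scaleR_right intro!: gspan_base ring)
  have base: "cvec g * b \<in> gspan K (mons (\<not> p) (h # hs))" if b: "b \<in> mons p (h # hs)" for b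
  proof -
    consider (1) "b \<in> mons p hs" | (2) b' where "b' \<in> mons (\<not> p) hs" "b = cvec h * b'"
      using b by auto
    then show ?thesis
    proof cases
      case 1
      then show ?thesis
      proof (cases "g = h")
        case True
        then show ?thesis using 1 by (auto intro!: lift gspan_base ring)
      next
        case False
        then have "cvec g * b \<in> gspan K (mons (\<not> p) hs)"
          using Cons.prems(1) 1 by (intro IH gspan_base ring) auto
        then show ?thesis by (rule gspan_mono[rotated]) simp
      qed
    next
      case 2
      note b' = gspan_base[OF ring(1) 2(1)]
      show ?thesis
      proof (cases "g = h")
        case True
        have "cvec g * b = Q h *\<^sub>R b'"
          by (simp add: True 2 cvec_square' cliff_mult_scaleR_left flip: mult.assoc)
        also have "\<dots> \<in> gspan K (mons (\<not> p) hs)"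
          by (rule gspan_scale[OF ring(2) _ b']) (simp_all add: Cons.prems)
        finally show ?thesis by (rule gspan_mono[rotated]) simp
      next
        case False
        then have g: "g \<in> set hs" using Cons.prems by simp
        have "cvec g * b = (2 * gram_bilin g h) *\<^sub>R b' + (- 1) *\<^sub>R (cvec h * (cvec g * b'))"
        proof -
          have "cvec g * cvec h = (2 * gram_bilin g h) *\<^sub>R 1 - cvec h * cvec g"
            using cvec_anticommutator[of g h] by (simp add: algebra_simps)
          then show ?thesis
            by (simp add: 2 left_diff_distrib cliff_mult_scaleR_left flip: mult.assoc)
        qed
        also have "\<dots> \<in> gspan K (mons (\<not> p) (h # hs))"
        proof (rule gspan_add)
          have "(2 * gram_bilin g h) *\<^sub>R b' \<in> gspan K (mons (\<not> p) hs)"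
            by (rule gspan_scale[OF ring(2) _ b']) (use g Cons.prems in simp_all)
          then show "(2 * gram_bilin g h) *\<^sub>R b' \<in> gspan K (mons (\<not> p) (h # hs))"
            by (rule gspan_mono[rotated]) simp
          have "cvec h * (cvec g * b') \<in> gspan K (mons (\<not> p) (h # hs))"
            using lift[OF IH[OF g b']] by simp
          then show "(- 1) *\<^sub>R (cvec h * (cvec g * b')) \<in> gspan K (mons (\<not> p) (h # hs))"
            by (intro gspan_scale ring)
        qed
        finally show ?thesis .
      qed
    qed
  qed
  show ?case
    using _ _ ring(2) base Cons.prems(2)
    by (rule gspan_map) (auto simp: distrib_left cliff_mult_scaleR_right)
qed

lemma finite_mons: "finite (mons p gs)"
  by (induction p gs rule: mons.induct) auto

text \<open>Counts the subsets of given parity, 2^(n-1) of them for n > 0. As \<open>mons\<close> is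
  a set, coincidences make this only an upper bound until independence is known.\<close>

fun mons_card :: "bool \<Rightarrow> nat \<Rightarrow> nat" where
  "mons_card p 0 = (if p then 1 else 0)"
| "mons_card p (Suc n) = mons_card p n + mons_card (\<not> p) n"

lemma mons_card_8: "mons_card True 8 = 128"
  by (simp add: eval_nat_numeral)

lemma card_mons_le: "card (mons p gs) \<le> mons_card p (length gs)"
proof (induction gs arbitrary: p)
  case (Cons g gs)
  have "card (mons p (g # gs)) \<le> card (mons p gs) + card ((*) (cvec g) ` mons (\<not> p) gs)"
    by (simp add: card_Un_le)
  also have "\<dots> \<le> card (mons p gs) + card (mons (\<not> p) gs)"
    by (simp add: card_image_le finite_mons)
  also have "\<dots> \<le> mons_card p (length (g # gs))"
    using Cons.IH[of p] Cons.IH[of "\<not> p"] by simp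
  finally show ?case .
qed simp

lemma linear_cvec: "linear (cvec :: real ^ 8 \<Rightarrow> real cliff)"
  by (rule linearI) (simp_all add: cvec_add cvec_scale)

lemma mult_mons_span:
  assumes "v \<in> span (set gs)" "x \<in> span (mons p gs)"
  shows "cvec v * x \<in> span (mons (\<not> p) gs)"
  using assms(1)
proof (induction rule: span_induct_alt)
  case base
  show ?case
    using linear_0[OF linear_cvec] by (simp add: span_zero)
next
  case (step c g y)
  have "cvec g * x \<in> span (mons (\<not> p) gs)"
    using mult_mons[of UNIV gs g x p] step(1) assms(2) by (simp add: gspan_UNIV)
  with step(2) show ?case
    by (simp add: cvec_add cvec_scale distrib_right cliff_mult_scaleR_left span_add span_scale)
qed

lemma one_in_mons: "1 \<in> mons True gs"
  by (induction gs) auto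

lemma cmon_in_span_mons:
  assumes "span (set gs) = UNIV"
  shows "cmon w \<in> span (mons (even (length w)) gs)"
proof (induction w)
  case Nil
  show ?case by (simp add: cmon_Nil span_base one_in_mons)
next
  case (Cons i w)
  then show ?case
    using mult_mons_span[of "axis i 1" gs "cmon w" "even (length w)"] assms
    by (simp add: cmon_Cons)
qed

lemma mult_cmon_span:
  fixes v :: "real ^ 8"
  assumes "x \<in> span (cmon ` {w. even (length w) = p})"
  shows "cvec v * x \<in> span (cmon ` {w. even (length w) \<noteq> p})"
  using assms
proof (induction rule: span_induct_alt)
  case base
  show ?case by (simp add: span_zero)
next
  case (step c y z)
  then obtain w where w: "y = cmon w" "even (length w) = p" by auto
  have v: "cvec v = (\<Sum>i\<in>UNIV. (v $ i) *\<^sub>R cvec (axis i 1))"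
  proof -
    have "v = (\<Sum>i\<in>UNIV. (v $ i) *\<^sub>R axis i 1)"
      by (simp add: basis_expansion flip: scalar_mult_eq_scaleR)
    then show ?thesis
      by (metis (no_types, lifting) linear_cvec linear_sum cvec_scale sum.cong)
  qed
  have "cvec v * y = (\<Sum>i\<in>UNIV. (v $ i) *\<^sub>R cmon (i # w))"
    by (simp add: v w cmon_Cons sum_distrib_right cliff_mult_scaleR_left)
  also have "\<dots> \<in> span (cmon ` {w. even (length w) \<noteq> p})"
    using w(2) by (intro span_sum span_scale span_base imageI) auto
  finally show ?case using step(2)
    by (simp add: distrib_left cliff_mult_scaleR_right span_add span_scale)
qed

lemma mons_subset_span_cmon: "mons p gs \<subseteq> span (cmon ` {w. even (length w) = p})"
proof (induction gs arbitrary: p)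
  case Nil
  have "1 \<in> span (cmon ` {w. even (length w) = True})"
    by (rule span_base) (auto intro!: image_eqI[of _ _ "[]"] simp: cmon_Nil)
  then show ?case by (cases p) auto
next
  case (Cons g gs)
  have "cvec g * b \<in> span (cmon ` {w. even (length w) = p})" if "b \<in> mons (\<not> p) gs" for b
    using mult_cmon_span[of b "\<not> p" g] Cons.IH[of "\<not> p"] that by auto
  with Cons.IH[of p] show ?case by auto
qed

lemma subspace_ceven: "subspace (ceven :: real cliff set)"
proof (rule subspaceI)
  fix c and x :: "real cliff"
  assume "x \<in> ceven"
  then obtain p where p: "p \<in> teven" "x = abs_cliff p" by (auto simp: ceven_def)
  have "c *\<^sub>R x = abs_cliff (tscalar c * p)"
    by (simp add: p cliff_scaleR_eq cscalar.abs_eq times_cliff.abs_eq)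
  moreover have "tscalar c * p \<in> teven"
    using p(1) keys_mult[of "tscalar c" p]
    by (fastforce simp: teven_def tscalar_def split: if_splits)
  ultimately show "c *\<^sub>R x \<in> ceven" by (auto simp: ceven_def)
qed (simp_all add: ceven_0 ceven_add)

lemma ceven_eq_span_cmon: "(ceven :: real cliff set) = span (cmon ` {w. even (length w) = True})"
proof (intro equalityI subsetI)
  fix x :: "real cliff" assume "x \<in> ceven"
  then obtain p where p: "p \<in> teven" "x = abs_cliff p" by (auto simp: ceven_def)
  show "x \<in> span (cmon ` {w. even (length w) = True})"
    unfolding p(2) abs_cliff_expand cliff_scaleR_eq[symmetric]
    using p(1) by (intro span_sum span_scale span_base imageI) (auto simp: teven_def)
next
  have "cmon ` {w. even (length w) = True} \<subseteq> (ceven :: real cliff set)"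
    using ceven_monomial[of _ 1] by (auto simp: cscalar_1)
  then show "x \<in> ceven" if "x \<in> span (cmon ` {w. even (length w) = True})" for x :: "real cliff"
    using span_minimal[OF _ subspace_ceven] that by blast
qed

text \<open>Normal ordering gives one inclusion, re-expansion of the vectors in the standard basis
  the other. Two lists are used: \<open>std_gens\<close> generates the lattice,
  \<open>orth_gens\<close> is accessible to the independence proof.\<close>

lemma ceven_eq_span_mons:
  assumes "span (set gs) = UNIV"
  shows "ceven = span (mons True gs)"
proof (rule equalityI)
  have "cmon w \<in> span (mons True gs)" if "even (length w)" for w
    using cmon_in_span_mons[OF assms, of w] that by simp
  then show "ceven \<subseteq> span (mons True gs)"
    unfolding ceven_eq_span_cmon by (intro span_minimal) auto
  show "span (mons True gs) \<subseteq> ceven"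
    unfolding ceven_eq_span_cmon by (intro span_minimal mons_subset_span_cmon) simp
qed

definition std_gens :: "(real ^ 8) list" where
  "std_gens = map (\<lambda>i. axis i 1) [1, 2, 3, 4, 5, 6, 7, 8]"

lemma set_std_gens: "set std_gens = range (\<lambda>i. axis i 1)"
  unfolding UNIV_8 by (simp add: std_gens_def)

lemma span_std_gens: "span (set std_gens) = UNIV"
proof -
  have "set std_gens = Basis"
    by (auto simp: set_std_gens Basis_vec_def)
  then show ?thesis by simp
qed

lemma axis_nth_in_Ints: "axis i (1::real) $ j \<in> \<int>"
  by (simp add: axis_def)

lemma cmon_in_gspan_std:
  "cmon w \<in> gspan \<int> (mons (even (length w)) std_gens)"
proof (induction w)
  case Nil
  show ?case by (simp add: cmon_Nil gspan_base one_in_mons)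
next
  case (Cons i w)
  have "cvec (axis i 1) * cmon w \<in> gspan \<int> (mons (\<not> even (length w)) std_gens)"
  proof (rule mult_mons[OF _ _ _ _ _ _ Cons])
    show "axis i 1 \<in> set std_gens" by (simp add: set_std_gens)
  qed (auto simp: set_std_gens gram_bilin_expand Q_expand
      intro!: axis_nth_in_Ints Ints_add Ints_diff Ints_mult)
  then show ?case by (simp add: cmon_Cons)
qed

lemma cliff_base_change_abs: "cliff_base_change (abs_cliff p) = abs_cliff (tensor_base_change p)"
  by (rule cliff_base_change.abs_eq)

lemma mons_std_cmon: "b \<in> mons p std_gens \<Longrightarrow> \<exists>w. even (length w) = p \<and> b = cmon w"
proof -
  have "b \<in> mons p (map (\<lambda>i. axis i 1) l) \<Longrightarrow> \<exists>w. even (length w) = p \<and> b = cmon w" for l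
  proof (induction l arbitrary: b p)
    case Nil
    then show ?case by (auto simp: cmon_Nil intro!: exI[of _ "[]"] split: if_splits)
  next
    case (Cons i l)
    from Cons.prems consider "b \<in> mons p (map (\<lambda>i. axis i 1) l)"
      | b' where "b' \<in> mons (\<not> p) (map (\<lambda>i. axis i 1) l)" "b = cvec (axis i 1) * b'" by auto
    then show ?case
    proof cases
      case 2
      obtain w where "even (length w) = (\<not> p)" "b' = cmon w" using Cons.IH[OF 2(1)] by blast
      with 2(2) show ?thesis by (intro exI[of _ "i # w"]) (auto simp: cmon_Cons)
    qed (rule Cons.IH)
  qed
  then show "b \<in> mons p std_gens \<Longrightarrow> \<exists>w. even (length w) = p \<and> b = cmon w"
    unfolding std_gens_def by blast
qed

text \<open>The form takes integral values on the standard basis, so normal ordering stays integral.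
  The image under base change thereby acquires the explicit generators that
  \<open>full_lattice\<close> asks for.\<close>

lemma lattice_eq_gspan: "cliff_base_change ` ceven = gspan \<int> (mons True std_gens)"
proof (intro equalityI subsetI)
  fix x assume "x \<in> cliff_base_change ` ceven"
  then obtain p where p: "p \<in> teven" "x = abs_cliff (tensor_base_change p)"
    by (auto simp: ceven_def cliff_base_change_abs)
  have even: "even (length (letters w))" if "w \<in> Poly_Mapping.keys (tensor_base_change p)" for w
    using that p(1) by (simp add: teven_def in_keys_iff lookup_tensor_base_change)
  show "x \<in> gspan \<int> (mons True std_gens)"
    unfolding p(2) abs_cliff_expand cliff_scaleR_eq[symmetric] lookup_tensor_base_change
  proof (rule gspan_sum)
    fix w assume "w \<in> Poly_Mapping.keys (tensor_base_change p)"
    then show "real_of_int (poly_mapping.lookup p w) *\<^sub>R cmon (letters w)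
        \<in> gspan \<int> (mons True std_gens)"
      using cmon_in_gspan_std[of "letters w"] even[of w] by (intro gspan_scale) auto
  qed
next
  fix x assume "x \<in> gspan \<int> (mons True std_gens)"
  then show "x \<in> cliff_base_change ` ceven"
  proof induction
    case zero
    have "cliff_base_change 0 = 0"
      by (simp add: zero_cliff_def cliff_base_change_abs tensor_base_change_0)
    then show ?case using ceven_0 by (metis image_eqI)
  next
    case (step k b x)
    obtain n where n: "k = of_int n" using step(1) by (auto elim: Ints_cases)
    obtain w where w: "even (length w)" "b = cmon w" using mons_std_cmon[OF step(2)] by auto
    obtain p where p: "p \<in> teven" "x = abs_cliff (tensor_base_change p)"
      using step(4) by (auto simp: ceven_def cliff_base_change_abs)
    let ?q = "Poly_Mapping.single (NCWord w) n + p"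
    have "?q \<in> teven" using p(1) w(1) by (intro teven_add) (auto simp: teven_def)
    moreover have "k *\<^sub>R b + x =
        abs_cliff (Poly_Mapping.single (NCWord w) (of_int n) + tensor_base_change p)"
      by (simp add: p w n abs_cliff_single cliff_scaleR_eq flip: plus_cliff.abs_eq)
    then have "k *\<^sub>R b + x = cliff_base_change (abs_cliff ?q)"
      by (simp add: cliff_base_change_abs tensor_base_change_add tensor_base_change_single)
    ultimately show ?case by (auto simp: ceven_def)
  qed
qed

subsection \<open>Independence of monomials in orthogonal vectors\<close>

text \<open>Linear independence in the quotient by \<open>N\<close>, stated without forming the
  quotient.\<close>

definition indep_mod :: "'a::real_vector set \<Rightarrow> 'a set \<Rightarrow> bool" where
  "indep_mod N X \<longleftrightarrow> (\<forall>c. (\<Sum>b\<in>X. c b *\<^sub>R b) \<in> N \<longrightarrow> (\<forall>b\<in>X. c b = 0))"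

text \<open>Each factor of a monomial contributes one sign, so only the parity matters.\<close>

lemma mons_anticommute:
  assumes "\<forall>h\<in>set gs. gram_bilin g h = 0" "x \<in> span (mons p gs)"
  shows "cvec g * x = (if p then 1 else - 1) *\<^sub>R (x * cvec g)"
proof -
  have "cvec g * b = (if p then 1 else - 1) *\<^sub>R (b * cvec g)" if "b \<in> mons p gs" for b
    using that assms(1)
  proof (induction gs arbitrary: p b)
    case Nil
    then show ?case by (simp split: if_splits)
  next
    case (Cons h gs)
    then consider "b \<in> mons p gs" | b' where "b' \<in> mons (\<not> p) gs" "b = cvec h * b'" by auto
    then show ?case
    proof cases
      case 1
      then show ?thesis using Cons.IH Cons.prems by simp
    next
      case 2
      have gh: "cvec g * cvec h = - (cvec h * cvec g)"
        using cvec_anticommutator[of g h] Cons.prems(2)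
        by (simp add: eq_neg_iff_add_eq_0)
      have "cvec g * b = - (cvec h * (cvec g * b'))"
        by (simp add: 2 gh flip: mult.assoc)
      also have "cvec g * b' = (if \<not> p then 1 else - 1) *\<^sub>R (b' * cvec g)"
        using Cons.IH[OF 2(1)] Cons.prems(2) by simp
      finally show ?thesis by (cases p) (simp_all add: 2 mult.assoc)
    qed
  qed
  with assms(2) show ?thesis
  proof (induction rule: span_induct_alt)
    case (step c b y)
    then show ?case
      by (simp add: distrib_left distrib_right cliff_mult_scaleR_left cliff_mult_scaleR_right
          scaleR_add_right)
  qed simp
qed

text \<open>For \<open>g\<close> orthogonal to the later vectors, the map z -> g z g multiplies x by
  s Q(g) and g y by - s Q(g), where s is the sign of the parity. This separates the two parts of a
  relation x + g y modulo \<open>N\<close>. Since \<open>N\<close> may be any proper two-sided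
  ideal, the kernel of a representation is allowed.\<close>

lemma mons_indep_mod:
  fixes N :: "real cliff set"
  assumes N: "subspace N" "\<And>a x. x \<in> N \<Longrightarrow> a * x \<in> N" "\<And>a x. x \<in> N \<Longrightarrow> x * a \<in> N" "1 \<notin> N"
    and "sorted_wrt (\<lambda>x y. gram_bilin x y = 0) gs" "\<forall>g\<in>set gs. Q g \<noteq> 0"
  shows "card (mons p gs) = mons_card p (length gs) \<and> indep_mod N (mons p gs)"
  using assms(5,6)
proof (induction gs arbitrary: p)
  case Nil
  have "c = 0" if "c *\<^sub>R 1 \<in> N" for c
    using subspace_scale[OF N(1) that, of "inverse c"] N(4) by (cases "c = 0") auto
  then show ?case by (auto simp: indep_mod_def)
next
  case (Cons g gs)
  note IH = Cons.IH[THEN conjunct1] Cons.IH[THEN conjunct2]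
  have orth: "\<forall>h\<in>set gs. gram_bilin g h = 0" and g: "Q g \<noteq> 0" using Cons.prems by auto
  have gg: "cvec g * (cvec g * z) = Q g *\<^sub>R z" "(z * cvec g) * cvec g = Q g *\<^sub>R z" for z
    by (simp_all add: cvec_square' cliff_mult_scaleR_left cliff_mult_scaleR_right mult.assoc
        flip: mult.assoc[of "cvec g" "cvec g"])
  have scale: "z \<in> N" if "r *\<^sub>R z \<in> N" "r \<noteq> 0" for r z
    using subspace_scale[OF N(1) that(1), of "inverse r"] that(2) by simp
  have split: "x \<in> N \<and> y \<in> N"
    if x: "x \<in> span (mons p gs)" and y: "y \<in> span (mons (\<not> p) gs)" and xy: "x + cvec g * y \<in> N"
    for x y
  proof -
    define s :: real where "s = (if p then 1 else - 1)"
    have gx: "cvec g * x = s *\<^sub>R (x * cvec g)" and gy: "cvec g * y = (- s) *\<^sub>R (y * cvec g)"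
      using mons_anticommute[OF orth x] mons_anticommute[OF orth y] by (simp_all add: s_def)
    have "cvec g * x * cvec g = (s * Q g) *\<^sub>R x"
      by (simp add: gx gg cliff_mult_scaleR_left)
    moreover have "cvec g * (cvec g * y) * cvec g = - (s * Q g) *\<^sub>R (cvec g * y)"
    proof -
      have "cvec g * (cvec g * y) * cvec g = cvec g * ((- s) *\<^sub>R (y * cvec g)) * cvec g"
        by (simp only: gy)
      also have "\<dots> = (- s) *\<^sub>R (cvec g * (y * cvec g * cvec g))"
        by (simp only: cliff_mult_scaleR_left cliff_mult_scaleR_right mult.assoc)
      finally show ?thesis by (simp add: gg cliff_mult_scaleR_right)
    qed
    ultimately have "cvec g * (x + cvec g * y) * cvec g = (s * Q g) *\<^sub>R (x - cvec g * y)"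
      by (simp add: distrib_left distrib_right scaleR_diff_right)
    moreover have "cvec g * (x + cvec g * y) * cvec g \<in> N" using N(2,3) xy by blast
    ultimately have d: "x - cvec g * y \<in> N"
      using scale[of "s * Q g"] g by (simp add: s_def split: if_splits)
    have "2 *\<^sub>R x \<in> N"
      using subspace_add[OF N(1) xy d] by (simp add: scaleR_2)
    then have x': "x \<in> N" by (rule scale) simp
    then have "cvec g * y \<in> N" using subspace_diff[OF N(1) xy] by force
    then have "Q g *\<^sub>R y \<in> N" using N(2)[of "cvec g * y" "cvec g"] by (simp add: gg)
    then show ?thesis using x' scale g by blast
  qed
  have inj: "inj_on ((*) (cvec g)) (mons (\<not> p) gs)"
  proof (rule inj_onI)
    fix a b assume "cvec g * a = cvec g * b"
    then have "Q g *\<^sub>R a = Q g *\<^sub>R b" by (metis gg(1))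
    then show "a = b" using g by simp
  qed
  \<comment> \<open>A common element would be a relation with one term from each set, and
    \<open>split\<close> would put that term into \<open>N\<close>.\<close>
  have disj: "mons p gs \<inter> (*) (cvec g) ` mons (\<not> p) gs = {}"
  proof (rule ccontr)
    assume "\<not> ?thesis"
    then obtain a b where ab: "a \<in> mons p gs" "b \<in> mons (\<not> p) gs" "a = cvec g * b" by auto
    then have "a + cvec g * (- b) = 0" by (metis add.right_inverse mult_minus_right)
    then have "a \<in> N"
      using split[of a "- b"] ab subspace_0[OF N(1)] by (simp add: span_base span_neg)
    then have "(\<Sum>x\<in>mons p gs. (if x = a then 1 else 0) *\<^sub>R x) \<in> N"
      using ab(1) finite_mons[of p gs]
      by (subst sum.cong[OF refl, of _ _ "\<lambda>x. if x = a then a else 0"]) auto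
    then have "(if a = a then 1 else 0) = (0::real)"
      using IH(2)[of p] Cons.prems ab(1) unfolding indep_mod_def by fastforce
    then show False by simp
  qed
  have "card (mons p (g # gs)) = mons_card p (length (g # gs))"
    using IH(1) Cons.prems disj inj by (simp add: card_Un_disjoint finite_mons card_image)
  moreover have "indep_mod N (mons p (g # gs))"
    unfolding indep_mod_def
  proof (intro allI impI)
    fix c assume c: "(\<Sum>b\<in>mons p (g # gs). c b *\<^sub>R b) \<in> N"
    let ?x = "\<Sum>b\<in>mons p gs. c b *\<^sub>R b"
    let ?y = "\<Sum>b\<in>mons (\<not> p) gs. c (cvec g * b) *\<^sub>R b"
    have "(\<Sum>b\<in>mons p (g # gs). c b *\<^sub>R b) = ?x + cvec g * ?y"
      using disj inj
      by (simp add: sum.union_disjoint finite_mons sum.reindex sum_distrib_left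
          cliff_mult_scaleR_right)
    then have "?x \<in> N \<and> ?y \<in> N"
      using c by (intro split span_sum span_scale span_base) auto
    then show "\<forall>b\<in>mons p (g # gs). c b = 0"
      using IH(2)[of p] IH(2)[of "\<not> p"] Cons.prems unfolding indep_mod_def by auto
  qed
  ultimately show ?case ..
qed

text \<open>The orthogonal basis e_1, ..., e_8, with the first four vectors doubled to make them
  integral.\<close>

definition orth_gens :: "(real ^ 8) list" where
  "orth_gens = [axis 1 1 + axis 2 1, axis 3 1 + axis 4 1, axis 1 1 - axis 2 1, axis 3 1 - axis 4 1,
     axis 5 1, axis 6 1, axis 7 1, axis 8 1]"

lemma orth_gens_orthogonal:
  "sorted_wrt (\<lambda>x y. gram_bilin x y = 0) orth_gens" "\<forall>g\<in>set orth_gens. Q g \<noteq> 0"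
  by (simp_all add: orth_gens_def gram_bilin_expand Q_expand axis_def)

lemma span_orth_gens: "span (set orth_gens) = UNIV"
proof -
  have in_span: "x \<in> span (set orth_gens)" if "x \<in> set orth_gens" for x
    using that by (rule span_base)
  have half: "axis i 1 \<in> span (set orth_gens)" "axis j 1 \<in> span (set orth_gens)"
    if "axis i 1 + axis j 1 \<in> set orth_gens" "axis i 1 - axis j 1 \<in> set orth_gens" for i j
  proof -
    have eq: "(1 / 2) *\<^sub>R ((a + b) + (a - b)) = a" "(1 / 2) *\<^sub>R ((a + b) - (a - b)) = b"
      for a b :: "real ^ 8" by (simp_all add: vec_eq_iff)
    have "(1 / 2) *\<^sub>R ((axis i 1 + axis j 1) + (axis i 1 - axis j 1)) \<in> span (set orth_gens)"
      "(1 / 2) *\<^sub>R ((axis i 1 + axis j 1) - (axis i 1 - axis j 1)) \<in> span (set orth_gens)"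
      by (intro span_scale span_add span_diff span_base that)+
    then show "axis i 1 \<in> span (set orth_gens)" "axis j 1 \<in> span (set orth_gens)"
      by (simp_all only: eq)
  qed
  have "set std_gens \<subseteq> span (set orth_gens)"
    using half[of 1 2] half[of 3 4] in_span by (auto simp: std_gens_def orth_gens_def)
  then show ?thesis
    using span_std_gens span_minimal[OF _ subspace_span] by blast
qed

section \<open>Spinor modules\<close>

definition zlat :: "'a::euclidean_space set" where
  "zlat = {x. \<forall>b\<in>Basis. x \<bullet> b \<in> \<int>}"

text \<open>
  The isometry which is \<open>1\<close> on \<open>e\<^sub>1, e\<^sub>2\<close> and \<open>- 1\<close> on \<open>e\<^sub>3, \<dots>, e\<^sub>8\<close>. On spinors with a suitable inner
  product the adjoint of a vector \<open>x\<close> is \<open>theta x\<close>.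
\<close>

definition theta :: "real ^ 8 \<Rightarrow> real ^ 8" where
  "theta x = (\<chi> i. if i = 1 then x $ 2 else if i = 2 then x $ 1
     else if i = 3 then x $ 4 else if i = 4 then x $ 3 else - x $ i)"

definition quaternion :: "real \<Rightarrow> real \<Rightarrow> real \<Rightarrow> real \<Rightarrow> real ^ 4" where
  "quaternion a b c d = (\<chi> i. if i = 1 then a else if i = 2 then b else if i = 3 then c else d)"

lemma quaternion_nth [simp]:
  "quaternion a b c d $ 1 = a" "quaternion a b c d $ 2 = b"
  "quaternion a b c d $ 3 = c" "quaternion a b c d $ 4 = d"
  by (simp_all add: quaternion_def)

text \<open>Hamilton's product in the coordinates of 1, i, j, ij.\<close>

definition qm :: "real ^ 4 \<Rightarrow> real ^ 4 \<Rightarrow> real ^ 4" where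
  "qm p q = quaternion
     (p $ 1 * q $ 1 - p $ 2 * q $ 2 - p $ 3 * q $ 3 - p $ 4 * q $ 4)
     (p $ 1 * q $ 2 + p $ 2 * q $ 1 + p $ 3 * q $ 4 - p $ 4 * q $ 3)
     (p $ 1 * q $ 3 - p $ 2 * q $ 4 + p $ 3 * q $ 1 + p $ 4 * q $ 2)
     (p $ 1 * q $ 4 + p $ 2 * q $ 3 - p $ 3 * q $ 2 + p $ 4 * q $ 1)"

text \<open>
  A vector \<open>x\<close> acts by \<open>P x\<close> from the even to the odd half-spin module and by \<open>M x\<close> back; both modules
  are modelled on the same type. Quaternions act on the right, so \<open>R\<close> is anti-multiplicative. The
  basis vectors \<open>d k\<close> read off the coordinates of \<open>q\<close> from \<open>R q (v 1)\<close>.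
\<close>

locale spin_rep =
  fixes P M :: "real ^ 8 \<Rightarrow> 'a::euclidean_space \<Rightarrow> 'a"
    and R :: "real ^ 4 \<Rightarrow> 'a \<Rightarrow> 'a"
    and v :: "4 \<Rightarrow> 'a"
    and d :: "4 \<Rightarrow> 'a"
  assumes dim16: "DIM('a) = 16"
    and bilP: "bilinear P" and bilM: "bilinear M" and bilR: "bilinear R"
    and MP: "M x (P x s) = Q x *\<^sub>R s" and PM: "P x (M x s) = Q x *\<^sub>R s"
    and adj: "P x s \<bullet> t = s \<bullet> M (theta x) t"
    and P_zlat: "s \<in> zlat \<Longrightarrow> P (axis i 1) s \<in> zlat"
    and M_zlat: "s \<in> zlat \<Longrightarrow> M (axis i 1) s \<in> zlat"
    and PR: "P x (R q s) = R q (P x s)" and MR: "M x (R q s) = R q (M x s)"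
    and R_mult: "R p (R q s) = R (qm q p) s"
    and R_one: "R (axis 1 1) s = s"
    and R_zlat: "(\<And>i. q $ i \<in> \<int>) \<Longrightarrow> s \<in> zlat \<Longrightarrow> R q s \<in> zlat"
    and v_zlat: "v k \<in> zlat" and d_Basis: "d k \<in> Basis"
    and R_coord: "R q (v 1) \<bullet> d k = q $ k"
    and generated: "\<exists>q. s = (\<Sum>k\<in>UNIV. R (q k) (v k))"
begin

lemma linear_P: "linear (P x)" and linear_M: "linear (M x)" and linear_R: "linear (R q)"
  using bilP bilM bilR by (auto simp: bilinear_def)

lemma linear_P': "linear (\<lambda>x. P x s)" and linear_M': "linear (\<lambda>x. M x s)"
  and linear_R': "linear (\<lambda>q. R q s)"
  using bilP bilM bilR by (auto simp: bilinear_def)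

lemmas lin = linear_add[OF linear_P] linear_add[OF linear_M] linear_add[OF linear_R]
  linear_add[OF linear_P'] linear_add[OF linear_M'] linear_add[OF linear_R']
  linear_scale[OF linear_P] linear_scale[OF linear_M] linear_scale[OF linear_R]
  linear_scale[OF linear_P'] linear_scale[OF linear_M'] linear_scale[OF linear_R']
  linear_0[OF linear_P] linear_0[OF linear_M] linear_0[OF linear_R]
  linear_0[OF linear_P'] linear_0[OF linear_M'] linear_0[OF linear_R']
  linear_neg[OF linear_P] linear_neg[OF linear_M] linear_neg[OF linear_R]
  linear_neg[OF linear_P'] linear_neg[OF linear_M'] linear_neg[OF linear_R']
  linear_diff[OF linear_P] linear_diff[OF linear_M] linear_diff[OF linear_R]
  linear_diff[OF linear_P'] linear_diff[OF linear_M'] linear_diff[OF linear_R']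

section \<open>The Clifford action on spinors\<close>

definition gam :: "real ^ 8 \<Rightarrow> 'a \<times> 'a \<Rightarrow> 'a \<times> 'a" where
  "gam x z = (M x (snd z), P x (fst z))"

lemma linear_gam: "linear (gam x)"
  by (rule linearI) (simp_all add: gam_def lin)

lemma linear_gam': "linear (\<lambda>x. gam x z)"
  by (rule linearI) (simp_all add: gam_def lin)

definition wact :: "8 list \<Rightarrow> 'a \<times> 'a \<Rightarrow> 'a \<times> 'a" where
  "wact w = foldr (\<lambda>i. gam (axis i 1)) w"

lemma wact_Nil: "wact [] z = z"
  and wact_Cons: "wact (i # w) z = gam (axis i 1) (wact w z)"
  and wact_append: "wact (w @ w') z = wact w (wact w' z)"
  by (simp_all add: wact_def)

lemma linear_wact: "linear (wact w)"
proof (induction w)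
  case Nil
  show ?case by (rule linearI) (simp_all add: wact_Nil)
next
  case (Cons i w)
  have "wact (i # w) = gam (axis i 1) \<circ> wact w" by (auto simp: wact_Cons)
  then show ?case using linear_compose[OF Cons linear_gam] by metis
qed

definition trep :: "real tensor_alg \<Rightarrow> 'a \<times> 'a \<Rightarrow> 'a \<times> 'a" where
  "trep p z = (\<Sum>w\<in>Poly_Mapping.keys p. Poly_Mapping.lookup p w *\<^sub>R wact (letters w) z)"

lemma trep_superset:
  "finite A \<Longrightarrow> Poly_Mapping.keys p \<subseteq> A \<Longrightarrow>
    trep p z = (\<Sum>w\<in>A. Poly_Mapping.lookup p w *\<^sub>R wact (letters w) z)"
  unfolding trep_def by (rule sum.mono_neutral_left) (auto simp: in_keys_iff)

lemma trep_add: "trep (p + q) z = trep p z + trep q z"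
proof -
  let ?A = "Poly_Mapping.keys p \<union> Poly_Mapping.keys q"
  have "trep (p + q) z = (\<Sum>w\<in>?A. Poly_Mapping.lookup (p + q) w *\<^sub>R wact (letters w) z)"
    by (rule trep_superset) (auto dest: subsetD[OF keys_add])
  also have "\<dots> = (\<Sum>w\<in>?A. Poly_Mapping.lookup p w *\<^sub>R wact (letters w) z)
      + (\<Sum>w\<in>?A. Poly_Mapping.lookup q w *\<^sub>R wact (letters w) z)"
    by (simp add: lookup_add scaleR_add_left sum.distrib)
  also have "\<dots> = trep p z + trep q z"
    by (simp add: trep_superset[of ?A])
  finally show ?thesis .
qed

lemma trep_0: "trep 0 z = 0"
  by (simp add: trep_def)

lemma trep_sum: "trep (sum f A) z = (\<Sum>x\<in>A. trep (f x) z)"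
  by (induction A rule: infinite_finite_induct) (simp_all add: trep_0 trep_add)

lemma trep_single: "trep (Poly_Mapping.single w c) z = c *\<^sub>R wact (letters w) z"
  by (simp add: trep_def)

lemma linear_trep: "linear (trep p)"
  unfolding trep_def
  by (rule linearI)
    (simp_all add: linear_add[OF linear_wact] linear_scale[OF linear_wact] scaleR_add_right
      sum.distrib scaleR_sum_right mult.commute)

lemma trep_mult: "trep (p * q) z = trep p (trep q z)"
proof -
  have "trep ((\<Sum>v\<in>A. Poly_Mapping.single v (f v)) * (\<Sum>w\<in>B. Poly_Mapping.single w (g w))) z =
    trep (\<Sum>v\<in>A. Poly_Mapping.single v (f v)) (trep (\<Sum>w\<in>B. Poly_Mapping.single w (g w)) z)"
    for A B :: "8 ncword set" and f g
    by (simp add: sum_product trep_sum trep_single mult_single plus_ncword_def wact_append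
        linear_sum[OF linear_wact] linear_scale[OF linear_wact] scaleR_sum_right)
  from this[of "Poly_Mapping.lookup p" "Poly_Mapping.keys p"
      "Poly_Mapping.lookup q" "Poly_Mapping.keys q"]
  show ?thesis unfolding tensor_alg_decomp[symmetric] .
qed

lemma trep_tvec: "trep (tvec x) z = gam x z"
proof -
  have "gam x z = gam (\<Sum>i\<in>UNIV. (x $ i) *\<^sub>R axis i 1) z"
    by (simp add: basis_expansion flip: scalar_mult_eq_scaleR)
  also have "\<dots> = (\<Sum>i\<in>UNIV. (x $ i) *\<^sub>R gam (axis i 1) z)"
    by (simp add: linear_sum[OF linear_gam'] linear_scale[OF linear_gam'])
  finally show ?thesis
    by (simp add: tvec_def trep_sum trep_single wact_Cons wact_Nil)
qed

lemma trep_tscalar: "trep (tscalar c) z = c *\<^sub>R z"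
  by (simp add: tscalar_def trep_single zero_ncword_def wact_Nil)

lemma gam_square: "gam x (gam x z) = Q x *\<^sub>R z"
  by (cases z) (simp add: gam_def MP PM)

lemma trep_diff: "trep (p - q) z = trep p z - trep q z"
  using trep_add[of "p - q" q z] by simp

text \<open>The generators x x - Q(x) act as zero by \<open>gam_square\<close>, so the action
  descends to the Clifford algebra.\<close>

lemma trep_ideal: "p \<in> cliff_ideal \<Longrightarrow> trep p z = 0"
proof (induction rule: cliff_ideal.induct)
  case (generator a x b)
  show ?case
    by (simp add: trep_mult trep_diff trep_tvec trep_tscalar gam_square linear_0[OF linear_trep])
qed (simp_all add: trep_0 trep_add)

text \<open>Uses chosen representatives; \<open>crep_abs\<close> removes the choice.\<close>

definition crep :: "real cliff \<Rightarrow> 'a \<times> 'a \<Rightarrow> 'a \<times> 'a" where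
  "crep x = trep (rep_cliff x)"

lemma crep_abs: "crep (abs_cliff p) = trep p"
proof
  fix z
  have "cliff_rel (rep_cliff (abs_cliff p)) p"
    by (simp add: Quotient3_abs_rep[OF Quotient3_cliff] flip: cliff.abs_eq_iff)
  then have "trep (rep_cliff (abs_cliff p) - p) z = 0"
    unfolding cliff_rel_def by (rule trep_ideal)
  then show "crep (abs_cliff p) z = trep p z" by (simp add: crep_def trep_diff)
qed

lemma crep_add: "crep (x + y) z = crep x z + crep y z"
  by (induction x; induction y) (simp add: plus_cliff.abs_eq crep_abs trep_add)

lemma crep_mult: "crep (x * y) z = crep x (crep y z)"
  by (induction x; induction y) (simp add: times_cliff.abs_eq crep_abs trep_mult)

lemma crep_cvec: "crep (cvec x) z = gam x z"
  by (simp add: cvec.abs_eq crep_abs trep_tvec)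

lemma crep_cscalar: "crep (cscalar c) z = c *\<^sub>R z"
  by (simp add: cscalar.abs_eq crep_abs trep_tscalar)

lemma crep_1: "crep 1 z = z"
  using crep_cscalar[of 1 z] by (simp add: cscalar_1)

lemma crep_scale: "crep (c *\<^sub>R x) z = c *\<^sub>R crep x z"
  by (simp add: cliff_scaleR_eq crep_mult crep_cscalar)

lemma linear_crep: "linear (crep x)"
  unfolding crep_def by (rule linear_trep)

lemma linear_crep': "linear (\<lambda>x. crep x z)"
  by (rule linearI) (simp_all add: crep_add crep_scale)

lemma crep_cmon: "crep (cmon w) z = wact w z"
  by (induction w) (simp_all add: cmon_Nil cmon_Cons crep_1 crep_mult crep_cvec wact_Nil wact_Cons)

lemma ceven_induct [consumes 1, case_names zero step]:
  fixes x :: "real cliff"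
  assumes "x \<in> ceven" "Pr 0"
    and "\<And>c w x. even (length w) \<Longrightarrow> Pr x \<Longrightarrow> Pr (c *\<^sub>R cmon w + x)"
  shows "Pr x"
proof -
  have "x \<in> span (cmon ` {w. even (length w) = True})" using assms(1) ceven_eq_span_cmon by auto
  then show ?thesis
  proof (induction rule: span_induct_alt)
    case (step c b y)
    then show ?case using assms(3) by auto
  qed (rule assms(2))
qed

lemma wact_parity:
  "(even (length w) \<longrightarrow> snd (wact w (s, 0)) = 0 \<and> fst (wact w (0, t)) = 0) \<and>
   (odd (length w) \<longrightarrow> fst (wact w (s, 0)) = 0 \<and> snd (wact w (0, t)) = 0)"
  by (induction w) (auto simp: wact_Nil wact_Cons gam_def lin)

lemma crep_even:
  assumes "x \<in> ceven"
  shows "snd (crep x (s, 0)) = 0" "fst (crep x (0, t)) = 0"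
  using assms
  by (induction rule: ceven_induct)
    (simp_all add: linear_0[OF linear_crep'] crep_add crep_scale crep_cmon wact_parity)

definition rp :: "real cliff \<Rightarrow> 'a \<Rightarrow> 'a" where
  "rp x s = fst (crep x (s, 0))"

definition rm :: "real cliff \<Rightarrow> 'a \<Rightarrow> 'a" where
  "rm x t = snd (crep x (0, t))"

lemma crep_even_pair: "x \<in> ceven \<Longrightarrow> crep x (s, t) = (rp x s, rm x t)"
  using linear_add[OF linear_crep, of x "(s, 0)" "(0, t)"] crep_even(1)[of x s] crep_even(2)[of x t]
  by (simp add: rp_def rm_def prod_eq_iff)

lemma wact_R: "wact w (R q s, R q t) = map_prod (R q) (R q) (wact w (s, t))"
  by (induction w) (simp_all add: wact_Nil wact_Cons gam_def PR MR)

lemma crep_R: "x \<in> ceven \<Longrightarrow> crep x (R q s, R q t) = map_prod (R q) (R q) (crep x (s, t))"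
  by (induction rule: ceven_induct)
    (simp_all add: linear_0[OF linear_crep'] crep_add crep_scale crep_cmon wact_R lin
      map_prod_def split_beta prod_eq_iff)

lemma linear_rp: "linear (rp x)" and linear_rm: "linear (rm x)"
  unfolding rp_def rm_def
  by (rule linearI;
      simp add: linear_add[OF linear_crep, symmetric] linear_scale[OF linear_crep, symmetric]
      flip: fst_add snd_add fst_scaleR snd_scaleR)+

lemma rp_R: "x \<in> ceven \<Longrightarrow> rp x (R q s) = R q (rp x s)"
  and rm_R: "x \<in> ceven \<Longrightarrow> rm x (R q s) = R q (rm x s)"
  using crep_R[of x q s 0] crep_R[of x q 0 s] by (simp_all add: rp_def rm_def lin)

text \<open>Evaluation at a diagonal pair records the effect of an even element on
  \<open>v k\<close> in both half-spin modules at once. Even elements commute with \<open>R\<close>,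
  so these values determine their whole action.\<close>

definition Phi :: "real cliff \<Rightarrow> ('a \<times> 'a) ^ 4" where
  "Phi x = (\<chi> k. crep x (v k, v k))"

lemma linear_Phi: "linear Phi"
  by (rule linearI) (simp_all add: Phi_def crep_add crep_scale vec_eq_iff)

definition crep_kernel :: "real cliff set" where
  "crep_kernel = {x. \<forall>z. crep x z = 0}"

lemma v1_nonzero: "v 1 \<noteq> 0"
  using R_coord[of "axis 1 1" 1] by (auto simp: lin R_one)

text \<open>The kernel of the action is a proper ideal because the module is nonzero. Independence
  modulo this kernel contains both the dimension 128 and, through \<open>crep_faithful\<close>,
  faithfulness.\<close>

lemma mons_orth_gens:
  "card (mons True orth_gens) = 128" "indep_mod crep_kernel (mons True orth_gens)"
proof -
  have "1 \<notin> crep_kernel"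
    using v1_nonzero by (auto simp: crep_kernel_def crep_1 zero_prod_def intro!: exI[of _ "v 1"])
  moreover have "subspace crep_kernel"
    by (rule subspaceI)
      (auto simp: crep_kernel_def linear_0[OF linear_crep'] crep_add crep_scale)
  moreover have "a * x \<in> crep_kernel" "x * a \<in> crep_kernel" if "x \<in> crep_kernel" for a x
    using that unfolding crep_kernel_def by (simp_all only: mem_Collect_eq crep_mult)
      (simp_all add: linear_0[OF linear_crep])
  ultimately have "card (mons True orth_gens) = mons_card True (length orth_gens) \<and>
      indep_mod crep_kernel (mons True orth_gens)"
    using mons_indep_mod[OF _ _ _ _ orth_gens_orthogonal] by blast
  moreover have "length orth_gens = 8" by (simp add: orth_gens_def)
  ultimately show "card (mons True orth_gens) = 128"
    "indep_mod crep_kernel (mons True orth_gens)" by (simp_all add: mons_card_8)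
qed

lemma crep_faithful:
  assumes "x \<in> ceven" "x \<in> crep_kernel"
  shows "x = 0"
proof -
  have "x \<in> span (mons True orth_gens)"
    using assms(1) ceven_eq_span_mons[OF span_orth_gens] by simp
  then obtain c where c: "x = (\<Sum>b\<in>mons True orth_gens. c b *\<^sub>R b)"
    by (auto simp: span_finite[OF finite_mons])
  then have "\<forall>b\<in>mons True orth_gens. c b = 0"
    using mons_orth_gens(2) assms(2) unfolding indep_mod_def by blast
  then show ?thesis by (simp add: c)
qed

lemma independent_mons_orth: "independent (mons True orth_gens)"
proof -
  have "0 \<in> crep_kernel" by (simp add: crep_kernel_def linear_0[OF linear_crep'])
  then show ?thesis
    using mons_orth_gens(2)
    unfolding indep_mod_def by (auto simp: dependent_finite[OF finite_mons])
qed

lemma inj_on_Phi: "inj_on Phi ceven"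
proof -
  have "x = 0" if x: "x \<in> ceven" "Phi x = 0" for x
  proof (rule crep_faithful[OF x(1)])
    have "crep x (v k, v k) = 0" for k
      using x(2) by (simp add: Phi_def vec_eq_iff)
    then have v0: "rp x (v k) = 0" "rm x (v k) = 0" for k
      by (simp_all add: crep_even_pair[OF x(1)] zero_prod_def)
    have "rp x s = 0" "rm x s = 0" for s
    proof -
      obtain q where q: "s = (\<Sum>k\<in>UNIV. R (q k) (v k))" using generated by blast
      show "rp x s = 0" "rm x s = 0"
        by (simp_all add: q linear_sum[OF linear_rp] linear_sum[OF linear_rm]
            rp_R[OF x(1)] rm_R[OF x(1)] v0 lin)
    qed
    then show "x \<in> crep_kernel"
      by (simp add: crep_kernel_def split_paired_all crep_even_pair[OF x(1)] zero_prod_def)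
  qed
  then show ?thesis
    by (intro inj_onI)
      (metis linear_diff[OF linear_Phi] subspace_diff[OF subspace_ceven] eq_iff_diff_eq_0)
qed

text \<open>An injective linear map from a space of dimension 128 to one of dimension 4 * (16 +
  16).\<close>

lemma surj_Phi: "Phi ` ceven = UNIV"
proof -
  have cs: "ceven = span (mons True orth_gens)"
    by (rule ceven_eq_span_mons[OF span_orth_gens])
  have inj: "inj_on Phi (span (mons True orth_gens))" using inj_on_Phi cs by simp
  have ind: "independent (Phi ` mons True orth_gens)"
    by (rule linear_independent_injective_image[OF linear_Phi independent_mons_orth inj])
  have "card (Phi ` mons True orth_gens) = 128"
    using mons_orth_gens(1) inj_on_subset[OF inj span_superset] by (simp add: card_image)
  moreover have "DIM(('a \<times> 'a) ^ 4) = 128" by (simp add: dim16)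
  ultimately have "span (Phi ` mons True orth_gens) = UNIV"
    using ind by (metis dim_eq_card_independent dim_eq_full)
  then show ?thesis unfolding cs linear_span_image[OF linear_Phi] .
qed

text \<open>Surjectivity of \<open>Phi\<close> provides matrix units. The even element that fixes
  \<open>v 1\<close> and kills the other \<open>v k\<close> forces \<open>g (v 1)\<close> into the
  quaternionic line of \<open>v 1\<close>; even elements carrying \<open>v 1\<close> to an arbitrary
  vector then spread multiplication by that quaternion over the module.\<close>

lemma commutant:
  assumes g: "linear g" and comm: "\<And>x y s. g (M x (P y s)) = M x (P y (g s))"
  shows "\<exists>q. \<forall>s. g s = R q s"
proof -
  have w: "even (length w) \<Longrightarrow> g (fst (wact w (s, 0))) = fst (wact w (g s, 0))" for w s
    by (induction w rule: induct_list012) (simp_all add: wact_Nil wact_Cons gam_def comm)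
  have gc: "g (rp x s) = rp x (g s)" if "x \<in> ceven" for x s
    using that
    by (induction rule: ceven_induct)
      (simp_all add: rp_def linear_0[OF linear_crep'] crep_add crep_scale crep_cmon w
        linear_0[OF g] linear_add[OF g] linear_scale[OF g])
  have *: "\<exists>x\<in>ceven. rp x (v 1) = s \<and> (\<forall>k. k \<noteq> 1 \<longrightarrow> rp x (v k) = 0)" for s
  proof -
    obtain x where x: "x \<in> ceven" "Phi x = axis 1 (s, 0)"
      using surj_Phi by (metis UNIV_I imageE)
    then have "crep x (v k, v k) = (if k = 1 then (s, 0) else 0)" for k
      by (simp add: Phi_def vec_eq_iff axis_def)
    then have "(rp x (v k), rm x (v k)) = (if k = 1 then (s, 0) else (0, 0))" for k
      by (simp add: crep_even_pair[OF x(1)] zero_prod_def)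
    then have "rp x (v k) = (if k = 1 then s else 0)" for k
      by (metis prod.inject)
    then show ?thesis using x(1) by (auto intro!: bexI[of _ x])
  qed
  obtain q where q: "g (v 1) = (\<Sum>k\<in>UNIV. R (q k) (v k))" using generated by blast
  obtain x where x: "x \<in> ceven" "rp x (v 1) = v 1" "\<And>k. k \<noteq> 1 \<Longrightarrow> rp x (v k) = 0"
    using *[of "v 1"] by blast
  have "g (v 1) = rp x (g (v 1))" using gc[OF x(1), of "v 1"] x(2) by simp
  also have "\<dots> = (\<Sum>k\<in>UNIV. R (q k) (rp x (v k)))"
    by (simp add: q linear_sum[OF linear_rp] rp_R[OF x(1)])
  also have "\<dots> = (\<Sum>k\<in>(UNIV :: 4 set). if k = 1 then R (q 1) (v 1) else 0)"
    by (rule sum.cong) (auto simp: x lin)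
  finally have q1: "g (v 1) = R (q 1) (v 1)" by simp
  have "g s = R (q 1) s" for s
  proof -
    obtain y where y: "y \<in> ceven" "rp y (v 1) = s" using * by blast
    then show ?thesis using gc[OF y(1), of "v 1"] by (simp add: q1 rp_R)
  qed
  then show ?thesis by blast
qed

end

section \<open>Period points\<close>

lemma proportional_refl_iff: "proportional v v \<longleftrightarrow> v \<noteq> 0"
  unfolding proportional_def by (auto intro!: exI[of _ 1])

lemma abs_proj7_eq_iff:
  assumes "v \<noteq> 0" "w \<noteq> 0"
  shows "abs_proj7 v = abs_proj7 w \<longleftrightarrow> (\<exists>c. c \<noteq> 0 \<and> w = c *s v)"
  using Quotient3_rel[OF Quotient3_proj7, of v w] assms
  by (simp add: proportional_refl_iff) (simp add: proportional_def)

lemma rep_proj7_nonzero: "rep_proj7 p \<noteq> 0"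
  using Quotient3_rep_reflp[OF Quotient3_proj7, of p] by (simp add: proportional_refl_iff)

lemma abs_rep_proj7: "abs_proj7 (rep_proj7 p) = p"
  by (rule Quotient3_abs_rep[OF Quotient3_proj7])

lemma rep_abs_proj7:
  assumes "v \<noteq> 0"
  obtains c where "c \<noteq> 0" "rep_proj7 (abs_proj7 v) = c *s v"
  using abs_proj7_eq_iff[OF assms rep_proj7_nonzero, of "abs_proj7 v"] abs_rep_proj7 by metis

definition cvec_of :: "real ^ 8 \<Rightarrow> real ^ 8 \<Rightarrow> complex ^ 8" where
  "cvec_of x y = (\<chi> i. Complex (x $ i) (y $ i))"

lemma Re_cvec_of: "Re_vec (cvec_of x y) = x" and Im_cvec_of: "Im_vec (cvec_of x y) = y"
  by (simp_all add: Re_vec_def Im_vec_def cvec_of_def vec_eq_iff)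

lemma cvec_of_Re_Im: "cvec_of (Re_vec v) (Im_vec v) = v"
  by (simp add: Re_vec_def Im_vec_def cvec_of_def vec_eq_iff complex_eq_iff)

lemma Re_vec_scale: "Re_vec (c *s v) = Re c *\<^sub>R Re_vec v - Im c *\<^sub>R Im_vec v"
  and Im_vec_scale: "Im_vec (c *s v) = Im c *\<^sub>R Re_vec v + Re c *\<^sub>R Im_vec v"
  by (simp_all add: Re_vec_def Im_vec_def vec_eq_iff)

lemma gram_bilin_complex:
  "gram_bilin v v = Complex (Q (Re_vec v) - Q (Im_vec v)) (2 * gram_bilin (Re_vec v) (Im_vec v))"
  by (simp add: complex_eq_iff gram_bilin_expand Q_expand Re_vec_def Im_vec_def algebra_simps)

lemma gram_bilin_hermitian:
  "Re (gram_bilin (cnj_vec v) v) = Q (Re_vec v) + Q (Im_vec v)"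
  by (simp add: gram_bilin_expand Q_expand Re_vec_def Im_vec_def cnj_vec_def algebra_simps)

text \<open>
  For \<open>t = 0\<close> the sign of this determinant is the sign of \<open>Im (\<eta>\<^sub>3 / \<eta>\<^sub>1)\<close>; for \<open>t = 1\<close> it compares the
  orientation of the projection of a plane to \<open>\<langle>e\<^sub>1, e\<^sub>2\<rangle>\<close> with that of \<open>(e\<^sub>1, e\<^sub>2)\<close>.
\<close>

definition orient :: "real \<Rightarrow> real ^ 8 \<Rightarrow> real ^ 8 \<Rightarrow> real" where
  "orient t x y =
     (x $ 1 + t * x $ 2) * (y $ 3 + t * y $ 4) - (y $ 1 + t * y $ 2) * (x $ 3 + t * x $ 4)"

text \<open>If the determinant vanishes, some nonzero combination z of x and y satisfies z_1 = - t
  z_2 and z_3 = - t z_4. For t \<ge> 0 the form is at most 0 on such a z, although it is positive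
  definite on the plane of x and y.\<close>

lemma orient_nonzero:
  assumes "Q x = Q y" "Q x > 0" "gram_bilin x y = 0" "t \<ge> 0"
  shows "orient t x y \<noteq> 0"
proof
  assume 0: "orient t x y = 0"
  let ?p = "x $ 1 + t * x $ 2" and ?q = "y $ 1 + t * y $ 2"
  let ?r = "x $ 3 + t * x $ 4" and ?s = "y $ 3 + t * y $ 4"
  \<comment> \<open>A kernel vector is read off from whichever equation is nontrivial; if both are
    trivial, any vector will do.\<close>
  have "\<exists>a b. a * ?p + b * ?q = 0 \<and> a * ?r + b * ?s = 0 \<and> (a \<noteq> 0 \<or> b \<noteq> 0)"
  proof (cases "?p = 0 \<and> ?q = 0")
    case True
    show ?thesis
    proof (cases "?r = 0 \<and> ?s = 0")
      case True
      with \<open>?p = 0 \<and> ?q = 0\<close> show ?thesis by (intro exI[of _ 1] exI[of _ 0]) simp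
    next
      case False
      then have "- ?s * ?p + ?r * ?q = 0 \<and> - ?s * ?r + ?r * ?s = 0 \<and> (- ?s \<noteq> 0 \<or> ?r \<noteq> 0)"
        using \<open>?p = 0 \<and> ?q = 0\<close> by (auto simp: algebra_simps)
      then show ?thesis by blast
    qed
  next
    case False
    then show ?thesis using 0
      by (intro exI[of _ "- ?q"] exI[of _ ?p]) (auto simp: orient_def algebra_simps)
  qed
  then obtain a b where ab: "a * ?p + b * ?q = 0" "a * ?r + b * ?s = 0" "a \<noteq> 0 \<or> b \<noteq> 0"
    by blast
  define z where "z = a *\<^sub>R x + b *\<^sub>R y"
  have "Q z = (a\<^sup>2 + b\<^sup>2) * Q x"
    using assms(1,3) by (simp add: z_def Q_add Q_scale gram_bilin_simps algebra_simps)
  moreover have "a\<^sup>2 + b\<^sup>2 > 0" using ab(3) by (simp add: sum_power2_gt_zero_iff)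
  ultimately have "Q z > 0" using assms(2) by simp
  moreover have "z $ 1 = - t * z $ 2" "z $ 3 = - t * z $ 4"
    using ab(1,2) by (simp_all add: z_def algebra_simps)
  then have "Q z = - (4 * (t * ((z $ 2)\<^sup>2 + (z $ 4)\<^sup>2)) +
      2 * ((z $ 5)\<^sup>2 + (z $ 6)\<^sup>2 + (z $ 7)\<^sup>2 + (z $ 8)\<^sup>2))"
    by (simp add: Q_expand power2_eq_square algebra_simps)
  moreover have "0 \<le> 4 * (t * ((z $ 2)\<^sup>2 + (z $ 4)\<^sup>2)) +
      2 * ((z $ 5)\<^sup>2 + (z $ 6)\<^sup>2 + (z $ 7)\<^sup>2 + (z $ 8)\<^sup>2)"
    using assms(4) by (intro add_nonneg_nonneg mult_nonneg_nonneg) auto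
  ultimately show False by linarith
qed

text \<open>The determinant is a polynomial in t without zeros on [0, 1], so it keeps its sign. The
  value at 0 defines the component \<open>D_plus\<close>, the value at 1 decides the positivity of
  the Riemann form.\<close>

lemma orient_sign:
  assumes "Q x = Q y" "Q x > 0" "gram_bilin x y = 0"
  shows "orient 0 x y > 0 \<longleftrightarrow> orient 1 x y > 0"
proof -
  have cont: "continuous_on {0..1} (\<lambda>t. orient t x y)"
    unfolding orient_def by (intro continuous_intros)
  have nz: "orient t x y \<noteq> 0" if "0 \<le> t" for t using orient_nonzero[OF assms that] .
  show ?thesis
    using IVT'[OF _ _ _ cont, of 0] IVT2'[OF _ _ _ cont, of 0] nz
    by (metis less_eq_real_def linorder_not_less zero_le_one)
qed

definition period_cone :: "(complex ^ 8) set" where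
  "period_cone = {v. v \<noteq> 0 \<and> gram_bilin v v = 0 \<and> Re (gram_bilin (cnj_vec v) v) > 0 \<and>
     Im (v $ 3 / v $ 1) > 0}"

text \<open>When \<open>v $ 1 = 0\<close> both sides are false: the quotient is 0 by convention, and
  the determinant vanishes too.\<close>

lemma Im_quotient_pos_iff: "Im (v $ 3 / v $ 1) > 0 \<longleftrightarrow> orient 0 (Re_vec v) (Im_vec v) > 0"
proof (cases "v $ 1 = 0")
  case False
  then have "(Re (v $ 1))\<^sup>2 + (Im (v $ 1))\<^sup>2 > 0"
    by (simp add: sum_power2_gt_zero_iff complex_eq_iff)
  then show ?thesis
    by (simp add: Im_divide orient_def Re_vec_def Im_vec_def zero_less_divide_iff algebra_simps)
qed (simp add: orient_def Re_vec_def Im_vec_def)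

lemma period_cone_iff:
  "v \<in> period_cone \<longleftrightarrow> Q (Re_vec v) = Q (Im_vec v) \<and> gram_bilin (Re_vec v) (Im_vec v) = 0 \<and>
     Q (Re_vec v) > 0 \<and> orient 1 (Re_vec v) (Im_vec v) > 0"
proof -
  have "v \<noteq> 0" if "Q (Re_vec v) > 0"
    using that by (auto simp: Re_vec_def Q_expand)
  then show ?thesis
    unfolding period_cone_def gram_bilin_complex gram_bilin_hermitian Im_quotient_pos_iff
    using orient_sign[of "Re_vec v" "Im_vec v"] by (auto simp: complex_eq_iff)
qed

lemma Q_rotate:
  assumes "Q x = Q y" "gram_bilin x y = 0"
  shows "Q (a *\<^sub>R x - b *\<^sub>R y) = (a\<^sup>2 + b\<^sup>2) * Q x" "Q (b *\<^sub>R x + a *\<^sub>R y) = (a\<^sup>2 + b\<^sup>2) * Q x"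
    "gram_bilin (a *\<^sub>R x - b *\<^sub>R y) (b *\<^sub>R x + a *\<^sub>R y) = 0"
proof -
  have "a *\<^sub>R x - b *\<^sub>R y = a *\<^sub>R x + (- b) *\<^sub>R y" by simp
  then show "Q (a *\<^sub>R x - b *\<^sub>R y) = (a\<^sup>2 + b\<^sup>2) * Q x"
    "Q (b *\<^sub>R x + a *\<^sub>R y) = (a\<^sup>2 + b\<^sup>2) * Q x"
    "gram_bilin (a *\<^sub>R x - b *\<^sub>R y) (b *\<^sub>R x + a *\<^sub>R y) = 0"
    using assms gram_bilin_commute[of y x]
    by (simp_all only: Q_add Q_scale gram_bilin_simps)
      (simp_all add: Q_def algebra_simps)
qed

lemma orient_rotate:
  "orient t (a *\<^sub>R x - b *\<^sub>R y) (b *\<^sub>R x + a *\<^sub>R y) = (a\<^sup>2 + b\<^sup>2) * orient t x y"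
  by (simp add: orient_def power2_eq_square algebra_simps)

lemma period_cone_scale:
  assumes "c \<noteq> 0" "v \<in> period_cone"
  shows "c *s v \<in> period_cone"
proof -
  have "(Re c)\<^sup>2 + (Im c)\<^sup>2 > 0" using assms(1) by (simp add: sum_power2_gt_zero_iff complex_eq_iff)
  then show ?thesis
    using assms(2) unfolding period_cone_iff Re_vec_scale Im_vec_scale orient_rotate
    by (auto simp: Q_rotate)
qed

lemma D_plus_eq: "D_plus = abs_proj7 ` period_cone"
  unfolding D_plus_def period_cone_def by auto

lemma period_cone_nonzero: "v \<in> period_cone \<Longrightarrow> v \<noteq> 0"
  by (simp add: period_cone_def)

lemma D_plus_iff: "p \<in> D_plus \<longleftrightarrow> rep_proj7 p \<in> period_cone"
proof
  assume "p \<in> D_plus"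
  then obtain v where v: "v \<in> period_cone" "p = abs_proj7 v" by (auto simp: D_plus_eq)
  then show "rep_proj7 p \<in> period_cone"
    using rep_abs_proj7[OF period_cone_nonzero[OF v(1)]] period_cone_scale by metis
next
  assume "rep_proj7 p \<in> period_cone"
  then show "p \<in> D_plus" unfolding D_plus_eq by (metis abs_rep_proj7 image_eqI)
qed

text \<open>
  Rotating the representative makes the projections of \<open>m\<^sub>1\<close> and \<open>m\<^sub>2\<close> to \<open>\<langle>e\<^sub>1, e\<^sub>2\<rangle>\<close> orthogonal, and
  therefore also those to the negative definite complement.
\<close>

definition normal_pair :: "real ^ 8 \<Rightarrow> real ^ 8 \<Rightarrow> bool" where
  "normal_pair x y \<longleftrightarrow> Q x = 1 \<and> Q y = 1 \<and> gram_bilin x y = 0 \<and> orient 1 x y > 0 \<and>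
     (x $ 1 + x $ 2) * (y $ 1 + y $ 2) + (x $ 3 + x $ 4) * (y $ 3 + y $ 4) = 0"

lemma exists_rotation: "\<exists>u. cmod u = 1 \<and> Im (u\<^sup>2 * z) = 0"
proof (cases "z = 0")
  case True
  then show ?thesis by (intro exI[of _ 1]) simp
next
  case False
  \<comment> \<open>A square root is taken because \<open>z\<close> gets multiplied by the square of
    \<open>u\<close>.\<close>
  let ?u = "csqrt (cnj z / cmod z)"
  have "cmod ?u = 1" using False by (simp add: norm_csqrt norm_divide)
  moreover have "?u\<^sup>2 * z = cmod z"
    using False complex_norm_square[of z] by (simp add: power2_csqrt field_simps power2_eq_square[of "of_real _"])
  ultimately show ?thesis by (metis Im_complex_of_real)
qed

lemma D_plus_normal_pair:
  assumes "p \<in> D_plus"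
  obtains x y where "normal_pair x y" "p = abs_proj7 (cvec_of x y)"
proof -
  let ?v = "rep_proj7 p"
  let ?x = "Re_vec ?v" and ?y = "Im_vec ?v"
  have v: "Q ?x = Q ?y" "gram_bilin ?x ?y = 0" "Q ?x > 0" "orient 1 ?x ?y > 0"
    using assms by (simp_all add: D_plus_iff period_cone_iff)
  \<comment> \<open>Its imaginary part is twice the bilinear form of the projections of the real and
    imaginary parts of the representative to the plane of e_1 and e_2.\<close>
  let ?z = "(?v $ 1 + ?v $ 2)\<^sup>2 + (?v $ 3 + ?v $ 4)\<^sup>2"
  obtain u where u: "cmod u = 1" "Im (u\<^sup>2 * ?z) = 0" using exists_rotation by blast
  \<comment> \<open>The positive factor normalizes \<open>Q\<close> to 1 on both parts, and the
    phase \<open>u\<close> makes their projections orthogonal.\<close>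
  define c where "c = complex_of_real (1 / sqrt (Q ?x)) * u"
  have "cmod c = 1 / sqrt (Q ?x)" using u(1) v(3) by (simp add: c_def norm_mult norm_divide)
  then have c: "((Re c)\<^sup>2 + (Im c)\<^sup>2) * Q ?x = 1"
    using v(3) by (simp add: cmod_def[symmetric] power_divide flip: cmod_power2)
  then have c0: "c \<noteq> 0" "(Re c)\<^sup>2 + (Im c)\<^sup>2 > 0"
    by (auto simp: sum_power2_gt_zero_iff complex_eq_iff)
  let ?w = "c *s ?v"
  have "Im ((?w $ 1 + ?w $ 2)\<^sup>2 + (?w $ 3 + ?w $ 4)\<^sup>2) = Im (c\<^sup>2 * ?z)"
    by (rule arg_cong[of _ _ Im]) (simp add: power2_eq_square algebra_simps)
  also have "c\<^sup>2 * ?z = complex_of_real ((1 / sqrt (Q ?x))\<^sup>2) * (u\<^sup>2 * ?z)"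
    by (simp only: c_def power_mult_distrib of_real_power mult.assoc)
  also have "Im \<dots> = 0" using u(2) by (simp only: Im_complex_of_real Re_complex_of_real times_complex.sel)
  finally have "normal_pair (Re_vec ?w) (Im_vec ?w)"
    unfolding normal_pair_def
    using v c c0 unfolding Re_vec_scale Im_vec_scale orient_rotate
    by (simp add: Q_rotate) (simp add: Re_vec_def Im_vec_def power2_eq_square algebra_simps)
  moreover have "p = abs_proj7 (cvec_of (Re_vec ?w) (Im_vec ?w))"
    unfolding cvec_of_Re_Im
    using abs_proj7_eq_iff[of ?v ?w] c0 rep_proj7_nonzero[of p] abs_rep_proj7[of p]
    by (metis vector_mul_eq_0)
  ultimately show ?thesis by (rule that)
qed

text \<open>Multiplying the representative by c multiplies the product by |c|^2. Both products
  square to -1, so |c|^4 = 1. Comparing scalars requires 1 to be nonzero in the Clifford algebra, a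
  fact supplied by the spinor action.\<close>

lemma ks_m_eq:
  assumes one: "(1 :: real cliff) \<noteq> 0"
    and xy: "Q x = 1" "Q y = 1" "gram_bilin x y = 0"
  shows "ks_m (abs_proj7 (cvec_of x y)) = cvec x * cvec y"
    and "(cvec x * cvec y) * (cvec x * cvec y) = - 1"
proof -
  have yx: "cvec y * cvec x = - (cvec x * cvec y)"
    using cvec_anticommutator[of x y] xy(3) by (simp add: eq_neg_iff_add_eq_0 add.commute)
  have "(cvec x * cvec y) * (cvec x * cvec y) = cvec x * (cvec y * cvec x) * cvec y"
    by (simp add: mult.assoc)
  also have "\<dots> = - ((cvec x * cvec x) * (cvec y * cvec y))"
    unfolding yx by (simp add: mult.assoc)
  finally show sq: "(cvec x * cvec y) * (cvec x * cvec y) = - 1"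
    by (simp add: cvec_square' xy)
  let ?v = "cvec_of x y"
  have v0: "?v \<noteq> 0"
  proof
    assume "?v = 0"
    then have "x = 0" using Re_cvec_of[of x y] by (simp add: Re_vec_def vec_eq_iff)
    then show False using xy(1) by (simp add: Q_expand)
  qed
  show "ks_m (abs_proj7 ?v) = cvec x * cvec y"
    unfolding ks_m_def
  proof (rule the_equality)
    show "\<exists>v. v \<noteq> 0 \<and> abs_proj7 v = abs_proj7 ?v \<and>
        cvec x * cvec y = cvec (Re_vec v) * cvec (Im_vec v) \<and>
        (cvec x * cvec y) * (cvec x * cvec y) = - 1"
      using v0 sq by (intro exI[of _ ?v]) (simp add: Re_cvec_of Im_cvec_of)
  next
    fix m assume "\<exists>v. v \<noteq> 0 \<and> abs_proj7 v = abs_proj7 ?v \<and>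
        m = cvec (Re_vec v) * cvec (Im_vec v) \<and> m * m = - 1"
    then obtain w where w: "w \<noteq> 0" "abs_proj7 ?v = abs_proj7 w"
      "m = cvec (Re_vec w) * cvec (Im_vec w)" "m * m = - 1" by metis
    obtain c where c: "w = c *s ?v" using w(2) abs_proj7_eq_iff[OF v0 w(1)] by auto
    let ?a = "Re c" and ?b = "Im c"
    have diff: "cvec (r - s) = cvec r - cvec s" for r s :: "real ^ 8"
      using linear_diff[OF linear_cvec] .
    have m: "m = (?a\<^sup>2 + ?b\<^sup>2) *\<^sub>R (cvec x * cvec y)"
      unfolding w(3) c Re_vec_scale Im_vec_scale Re_cvec_of Im_cvec_of
      by (simp add: diff cvec_add cvec_scale distrib_left left_diff_distrib cliff_mult_scaleR_left
          cliff_mult_scaleR_right yx cvec_square' xy scaleR_add_left power2_eq_square mult.commute)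
        (simp add: algebra_simps)
    then have "m * m = (?a\<^sup>2 + ?b\<^sup>2)\<^sup>2 *\<^sub>R (- 1)"
      by (simp add: cliff_mult_scaleR_left cliff_mult_scaleR_right sq power2_eq_square)
    then have "((?a\<^sup>2 + ?b\<^sup>2)\<^sup>2 - 1) *\<^sub>R (1 :: real cliff) = 0"
      using w(4) by (simp add: scaleR_diff_left)
    then have "(?a\<^sup>2 + ?b\<^sup>2)\<^sup>2 = 1" using one by simp
    then have "?a\<^sup>2 + ?b\<^sup>2 = 1"
      by (smt (verit) power2_eq_1_iff zero_le_power2)
    then show "m = cvec x * cvec y" using m by simp
  qed
qed

section \<open>The Riemann form on a spinor module\<close>

lemma zlat_0: "0 \<in> zlat"
  and zlat_add: "x \<in> zlat \<Longrightarrow> y \<in> zlat \<Longrightarrow> x + y \<in> zlat"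
  by (simp_all add: zlat_def inner_add_left)

lemma zlat_inner: "x \<in> zlat \<Longrightarrow> y \<in> zlat \<Longrightarrow> x \<bullet> y \<in> \<int>"
  by (subst euclidean_inner) (auto simp: zlat_def intro!: Ints_sum Ints_mult)

text \<open>The integral vectors \<open>2 e\<^sub>1\<close> and \<open>2 e\<^sub>2\<close>, so that \<open>f\<^sub>2 f\<^sub>1\<close> is the element \<open>\<alpha>\<close> of the Riemann form.\<close>

definition f1 :: "real ^ 8" where "f1 = axis 1 1 + axis 2 1"
definition f2 :: "real ^ 8" where "f2 = axis 3 1 + axis 4 1"

definition pos_part :: "real ^ 8 \<Rightarrow> real ^ 8" where
  "pos_part x = ((x $ 1 + x $ 2) / 2) *\<^sub>R f1 + ((x $ 3 + x $ 4) / 2) *\<^sub>R f2"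

definition neg_part :: "real ^ 8 \<Rightarrow> real ^ 8" where
  "neg_part x = x - pos_part x"

lemma f_facts: "Q f1 = 4" "Q f2 = 4" "gram_bilin f1 f2 = 0" "theta f1 = f1" "theta f2 = f2"
  by (simp_all add: f1_def f2_def Q_expand gram_bilin_expand axis_def theta_def vec_eq_iff forall_8)

lemma pos_neg: "x = pos_part x + neg_part x"
  by (simp add: neg_part_def)

lemma pos_neg_orth: "gram_bilin (pos_part x) (neg_part y) = 0"
  by (simp add: pos_part_def neg_part_def f1_def f2_def gram_bilin_expand axis_def field_simps)

lemma Q_neg_part_le: "Q (neg_part x) \<le> 0"
proof -
  have "Q (neg_part x) = - (x $ 1 - x $ 2)\<^sup>2 - (x $ 3 - x $ 4)\<^sup>2
      - 2 * ((x $ 5)\<^sup>2 + (x $ 6)\<^sup>2 + (x $ 7)\<^sup>2 + (x $ 8)\<^sup>2)"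
    by (simp add: pos_part_def neg_part_def f1_def f2_def Q_expand axis_def field_simps
        power2_eq_square)
  moreover have "0 \<le> (x $ 1 - x $ 2)\<^sup>2 + (x $ 3 - x $ 4)\<^sup>2
      + 2 * ((x $ 5)\<^sup>2 + (x $ 6)\<^sup>2 + (x $ 7)\<^sup>2 + (x $ 8)\<^sup>2)"
    by simp
  ultimately show ?thesis by linarith
qed

lemma theta_theta: "theta (theta x) = x"
  by (simp add: theta_def vec_eq_iff forall_8)

lemma theta_pos: "theta (pos_part x) = pos_part x" and theta_neg: "theta (neg_part x) = - neg_part x"
  by (simp_all add: theta_def pos_part_def neg_part_def f1_def f2_def vec_eq_iff forall_8 axis_def
      add_divide_distrib)

text \<open>Minus the identity plus twice the orthogonal projection to the plane of f_1 and f_2; in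
  this form \<open>theta\<close> can be moved through Clifford products.\<close>

lemma theta_eq:
  "theta x = - x + (gram_bilin x f1 / 2) *\<^sub>R f1 + (gram_bilin x f2 / 2) *\<^sub>R f2"
  by (simp add: theta_def f1_def f2_def vec_eq_iff forall_8 axis_def gram_bilin_expand field_simps)

lemma normal_pair_parts:
  assumes "normal_pair x y"
  shows "gram_bilin (pos_part x) (pos_part y) = 0" "gram_bilin (neg_part x) (neg_part y) = 0"
    "Q (pos_part x) \<ge> 1" "Q (neg_part x) = 1 - Q (pos_part x)"
    "Q (pos_part y) \<ge> 1" "Q (neg_part y) = 1 - Q (pos_part y)"
proof -
  show ab: "gram_bilin (pos_part x) (pos_part y) = 0"
    using assms by (simp add: normal_pair_def pos_part_def f1_def f2_def gram_bilin_expand axis_def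
        field_simps)
  have "gram_bilin x y = gram_bilin (pos_part x) (pos_part y) + gram_bilin (neg_part x) (neg_part y)"
    by (subst pos_neg[of x], subst pos_neg[of y])
      (simp add: gram_bilin_simps pos_neg_orth gram_bilin_commute[of "neg_part x"])
  then show "gram_bilin (neg_part x) (neg_part y) = 0"
    using assms ab by (simp add: normal_pair_def)
  have Q: "Q z = Q (pos_part z) + Q (neg_part z)" for z :: "real ^ 8"
    by (subst pos_neg[of z]) (simp add: Q_add pos_neg_orth)
  show "Q (neg_part x) = 1 - Q (pos_part x)" "Q (neg_part y) = 1 - Q (pos_part y)"
    using Q[of x] Q[of y] assms by (simp_all add: normal_pair_def)
  then show "Q (pos_part x) \<ge> 1" "Q (pos_part y) \<ge> 1"
    using Q_neg_part_le[of x] Q_neg_part_le[of y] by linarith+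
qed

text \<open>The coefficients of a square root \<open>u + w X\<close> of \<open>\<alpha> + X\<close>, where \<open>X\<^sup>2 = \<alpha> (\<alpha> - 1)\<close>.\<close>

lemma exists_sqrt_coeffs:
  assumes "\<alpha> \<ge> (1::real)"
  shows "\<exists>u w. 2 * u * w = 1 \<and> u * u + w * w * (\<alpha> * (\<alpha> - 1)) = \<alpha> \<and>
    u * u - w * w * (\<alpha> * (\<alpha> - 1)) \<noteq> 0"
proof -
  define r where "r = sqrt \<alpha>"
  have r: "r \<ge> 1" "\<alpha> = r * r" using assms by (simp_all add: r_def)
  \<comment> \<open>Write A = \<alpha> (\<alpha> - 1). The first two conditions force (u^2 - w^2
    A)^2 = \<alpha>; choosing the root \<open>r\<close> and adding u^2 + w^2 A = \<alpha> gives
    u^2.\<close>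
  define u where "u = sqrt ((r * r + r) / 2)"
  have uu: "u * u = (r * r + r) / 2" and u0: "u > 0" using r by (auto simp: u_def intro!: add_pos_pos)
  define w where "w = 1 / (2 * u)"
  have "w * w = 1 / (4 * (u * u))" by (simp add: w_def)
  also have "4 * (u * u) = 2 * r * (r + 1)" unfolding uu by (simp add: algebra_simps)
  finally have w2: "w * w = 1 / (2 * r * (r + 1))" .
  have "w * w * (\<alpha> * (\<alpha> - 1)) = (r * r * (r * r - 1)) / (2 * r * (r + 1))"
    unfolding w2 r(2) by simp
  also have "\<dots> = (r * r - r) / 2"
    using r(1) by (simp add: divide_simps) (simp add: algebra_simps)
  finally have ww: "w * w * (\<alpha> * (\<alpha> - 1)) = (r * r - r) / 2" .
  have "2 * u * w = 1" using u0 by (simp add: w_def)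
  moreover have "u * u + w * w * (\<alpha> * (\<alpha> - 1)) = \<alpha>"
    unfolding ww uu by (simp add: r(2) field_simps)
  moreover have "u * u - w * w * (\<alpha> * (\<alpha> - 1)) = r"
    unfolding ww uu by (simp add: field_simps)
  ultimately show ?thesis using r(1) by (metis not_one_le_zero)
qed

context spin_rep
begin

lemma MP_anti: "M x (P y s) = (2 * gram_bilin x y) *\<^sub>R s - M y (P x s)"
proof -
  have "M (x + y) (P (x + y) s) = Q (x + y) *\<^sub>R s" by (rule MP)
  then show ?thesis by (simp add: lin MP Q_add algebra_simps)
qed

lemma PM_anti: "P x (M y s) = (2 * gram_bilin x y) *\<^sub>R s - P y (M x s)"
proof -
  have "P (x + y) (M (x + y) s) = Q (x + y) *\<^sub>R s" by (rule PM)
  then show ?thesis by (simp add: lin PM Q_add algebra_simps)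
qed

lemma MP_orth: "gram_bilin x y = 0 \<Longrightarrow> M x (P y s) = - M y (P x s)"
  and PM_orth: "gram_bilin x y = 0 \<Longrightarrow> P x (M y s) = - P y (M x s)"
  using MP_anti[of x y s] PM_anti[of x y s] by simp_all

lemma adj_M: "M x s \<bullet> t = s \<bullet> P (theta x) t"
  using adj[of "theta x" t s] by (simp add: theta_theta inner_commute)

text \<open>The operator is \<alpha> = f_2 f_1, so this is the analogue on spinors of the form
  tr(\<alpha> x^\<iota> y); \<open>EE'\<close> is its counterpart on the other half-spin
  module.\<close>

definition EE :: "'a \<Rightarrow> 'a \<Rightarrow> real" where
  "EE s t = s \<bullet> M f2 (P f1 t)"

definition EE' :: "'a \<Rightarrow> 'a \<Rightarrow> real" where
  "EE' s t = s \<bullet> P f2 (M f1 t)"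

text \<open>The adjoint of x is \<open>theta x\<close>, and theta(x) \<alpha> = - \<alpha> x: on the
  positive plane \<open>theta\<close> is 1 and x anticommutes with \<alpha>, on the complement
  \<open>theta\<close> is -1 and x commutes with \<alpha>.\<close>

lemma EE_shift: "EE (M x s) t = - EE' s (P x t)" and EE'_shift: "EE' (P x s) t = - EE s (M x t)"
proof -
  let ?b1 = "gram_bilin x f1" and ?b2 = "gram_bilin x f2"
  have "P (theta x) (M f2 (P f1 t)) = - P f2 (M f1 (P x t))"
  proof -
    have "P f1 (M f2 (P f1 t)) = - 4 *\<^sub>R P f2 t"
      by (simp add: PM_orth[OF f_facts(3)] MP f_facts lin)
    then have "P (theta x) (M f2 (P f1 t)) =
        - P x (M f2 (P f1 t)) - (2 * ?b1) *\<^sub>R P f2 t + (2 * ?b2) *\<^sub>R P f1 t"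
      by (simp add: theta_eq lin PM f_facts)
    also have "P x (M f2 (P f1 t)) =
        (2 * ?b2) *\<^sub>R P f1 t - (2 * ?b1) *\<^sub>R P f2 t + P f2 (M f1 (P x t))"
      by (subst PM_anti, subst MP_anti[of x]) (simp add: lin)
    finally show ?thesis by simp
  qed
  then show "EE (M x s) t = - EE' s (P x t)" by (simp add: EE_def EE'_def adj_M)
  have "M (theta x) (P f2 (M f1 t)) = - M f2 (P f1 (M x t))"
  proof -
    have "M f1 (P f2 (M f1 t)) = - 4 *\<^sub>R M f2 t"
      by (simp add: MP_orth[OF f_facts(3)] PM f_facts lin)
    then have "M (theta x) (P f2 (M f1 t)) =
        - M x (P f2 (M f1 t)) - (2 * ?b1) *\<^sub>R M f2 t + (2 * ?b2) *\<^sub>R M f1 t"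
      by (simp add: theta_eq lin MP f_facts)
    also have "M x (P f2 (M f1 t)) =
        (2 * ?b2) *\<^sub>R M f1 t - (2 * ?b1) *\<^sub>R M f2 t + M f2 (P f1 (M x t))"
      by (subst MP_anti, subst PM_anti[of x]) (simp add: lin)
    finally show ?thesis by simp
  qed
  then show "EE' (P x s) t = - EE s (M x t)" by (simp add: EE_def EE'_def adj)
qed

lemma EE_invariant:
  assumes "Q x = 1" "Q y = 1"
  shows "EE (M x (P y s)) (M x (P y t)) = EE s t"
  by (simp add: EE_shift EE'_shift PM MP assms)

lemma EE_alternating: "EE s s = 0"
proof -
  have "EE s s = P f2 s \<bullet> P f1 s" by (simp add: EE_def adj f_facts)
  also have "\<dots> = s \<bullet> M f1 (P f2 s)" by (subst inner_commute) (simp add: adj f_facts)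
  also have "\<dots> = - EE s s" by (simp add: EE_def MP_orth[OF f_facts(3)])
  finally show ?thesis by simp
qed

lemma P_f_zlat: "s \<in> zlat \<Longrightarrow> P f1 s \<in> zlat" "s \<in> zlat \<Longrightarrow> M f2 s \<in> zlat"
  by (simp_all add: f1_def f2_def lin zlat_add P_zlat M_zlat)

lemma EE_integral: "s \<in> zlat \<Longrightarrow> t \<in> zlat \<Longrightarrow> EE s t \<in> \<int>"
  unfolding EE_def by (intro zlat_inner P_f_zlat)

lemma EE_linear: "linear (EE s)" "linear (\<lambda>s. EE s t)"
  by (rule linearI; simp add: EE_def lin inner_add_right inner_add_left)+

text \<open>
  With \<open>a\<^sub>i\<close>, \<open>b\<^sub>i\<close> the two parts of the vectors and \<open>X\<^sub>i = a\<^sub>i b\<^sub>i\<close>, the product \<open>a\<^sub>2 a\<^sub>1 m\<^sub>1 m\<^sub>2\<close> equals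
  \<open>(\<alpha>\<^sub>1 + X\<^sub>1) (\<alpha>\<^sub>2 + X\<^sub>2)\<close>, where \<open>\<alpha>\<^sub>i = a\<^sub>i\<^sup>2\<close>. The two factors are commuting squares of invertible
  symmetric operators.
\<close>

lemma EE_positive:
  assumes xy: "normal_pair x y" and s: "s \<noteq> 0"
  shows "EE s (M x (P y s)) > 0"
proof -
  define a1 a2 b1 b2 where ab: "a1 = pos_part x" "a2 = pos_part y" "b1 = neg_part x" "b2 = neg_part y"
  define \<alpha>1 \<alpha>2 where al: "\<alpha>1 = Q a1" "\<alpha>2 = Q a2"
  have x: "x = a1 + b1" and y: "y = a2 + b2" using pos_neg by (auto simp: ab)
  note parts = normal_pair_parts[OF xy, folded ab al]
  have th: "theta a1 = a1" "theta a2 = a2" "theta b1 = - b1" "theta b2 = - b2"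
    by (simp_all add: ab theta_pos theta_neg)
  have o: "gram_bilin a1 a2 = 0" "gram_bilin a2 a1 = 0" "gram_bilin b1 b2 = 0" "gram_bilin b2 b1 = 0"
    "gram_bilin a1 b1 = 0" "gram_bilin a1 b2 = 0" "gram_bilin a2 b1 = 0" "gram_bilin a2 b2 = 0"
    "gram_bilin b1 a1 = 0" "gram_bilin b2 a1 = 0" "gram_bilin b1 a2 = 0" "gram_bilin b2 a2 = 0"
    using parts(1,2) pos_neg_orth pos_neg_orth[folded gram_bilin_commute[of "neg_part _"]]
      parts(1,2)[folded gram_bilin_commute[of a2] gram_bilin_commute[of b2]]
    by (auto simp: ab)
  define X1 X2 where X: "X1 = (\<lambda>z. M a1 (P b1 z))" "X2 = (\<lambda>z. M a2 (P b2 z))"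
  have linX: "linear X1" "linear X2"
    by (rule linearI; simp add: X lin)+
  \<comment> \<open>The adjoints of a_i and b_i are a_i and - b_i; the sign cancels against the one
    from exchanging the two anticommuting factors.\<close>
  have selfX: "X1 z \<bullet> t = z \<bullet> X1 t" "X2 z \<bullet> t = z \<bullet> X2 t" for z t
    using MP_orth[OF o(5), of t] MP_orth[OF o(8), of t] by (simp_all add: X adj adj_M th lin)
  have XX: "X1 (X1 z) = (\<alpha>1 * (\<alpha>1 - 1)) *\<^sub>R z" "X2 (X2 z) = (\<alpha>2 * (\<alpha>2 - 1)) *\<^sub>R z" for z
    by (simp_all add: X PM_orth[OF o(9)] PM_orth[OF o(12)] lin MP parts flip: al)
      (simp_all add: algebra_simps)
  have X12: "X1 (X2 z) = X2 (X1 z)" for z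
  proof -
    have "X1 (X2 z) = - M a1 (P a2 (M b1 (P b2 z)))" by (simp add: X PM_orth[OF o(11)] lin)
    also have "\<dots> = - M a2 (P a1 (M b2 (P b1 z)))"
      by (simp add: MP_orth[OF o(1)] MP_orth[OF o(3)] lin)
    also have "\<dots> = X2 (X1 z)" by (simp add: X PM_orth[OF o(6)] lin)
    finally show ?thesis .
  qed
  obtain u1 w1 where 1: "2 * u1 * w1 = 1" "u1 * u1 + w1 * w1 * (\<alpha>1 * (\<alpha>1 - 1)) = \<alpha>1"
    "u1 * u1 - w1 * w1 * (\<alpha>1 * (\<alpha>1 - 1)) \<noteq> 0"
    using exists_sqrt_coeffs[OF parts(3)] by blast
  obtain u2 w2 where 2: "2 * u2 * w2 = 1" "u2 * u2 + w2 * w2 * (\<alpha>2 * (\<alpha>2 - 1)) = \<alpha>2"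
    "u2 * u2 - w2 * w2 * (\<alpha>2 * (\<alpha>2 - 1)) \<noteq> 0"
    using exists_sqrt_coeffs[OF parts(5)] by blast
  define U1 U2 where U: "U1 = (\<lambda>z. u1 *\<^sub>R z + w1 *\<^sub>R X1 z)" "U2 = (\<lambda>z. u2 *\<^sub>R z + w2 *\<^sub>R X2 z)"
  note lX = linear_add[OF linX(1)] linear_add[OF linX(2)] linear_scale[OF linX(1)]
    linear_scale[OF linX(2)]
  have sq: "U (U z) = \<alpha> *\<^sub>R z + X z"
    if "U = (\<lambda>z. u *\<^sub>R z + w *\<^sub>R X z)" "linear X" "\<And>z. X (X z) = (\<alpha> * (\<alpha> - 1)) *\<^sub>R z"
      "2 * u * w = 1" "u * u + w * w * (\<alpha> * (\<alpha> - 1)) = \<alpha>"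
    for U X :: "'a \<Rightarrow> 'a" and u w \<alpha> :: real and z
  proof -
    have "U (U z) = (u * u + w * w * (\<alpha> * (\<alpha> - 1))) *\<^sub>R z + (2 * u * w) *\<^sub>R X z"
      unfolding that(1) linear_add[OF that(2)] linear_scale[OF that(2)] that(3)
      by (simp add: scaleR_add_right scaleR_add_left mult.commute mult.left_commute flip: scaleR_2)
    then show ?thesis using that(4,5) by simp
  qed
  have UU: "U1 (U1 z) = \<alpha>1 *\<^sub>R z + X1 z" "U2 (U2 z) = \<alpha>2 *\<^sub>R z + X2 z" for z
    using sq[OF U(1) linX(1) XX(1) 1(1,2)] sq[OF U(2) linX(2) XX(2) 2(1,2)] by blast+
  have U12: "U1 (U2 z) = U2 (U1 z)" for z
    by (simp add: U lX X12 scaleR_add_right algebra_simps)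
  have selfU: "U1 z \<bullet> t = z \<bullet> U1 t" "U2 z \<bullet> t = z \<bullet> U2 t" for z t
    by (simp_all add: U inner_add_left inner_add_right selfX)
  have inj: "z = 0"
    if "U z = 0" "U = (\<lambda>z. u *\<^sub>R z + w *\<^sub>R X z)" "linear X" "\<And>z. X (X z) = (\<alpha> * (\<alpha> - 1)) *\<^sub>R z"
      "u * u - w * w * (\<alpha> * (\<alpha> - 1)) \<noteq> 0"
    for U X :: "'a \<Rightarrow> 'a" and u w \<alpha> :: real and z
  proof -
    \<comment> \<open>Up to a nonzero scalar, u - w X inverts u + w X.\<close>
    have "u *\<^sub>R U z - w *\<^sub>R X (U z) = (u * u - w * w * (\<alpha> * (\<alpha> - 1))) *\<^sub>R z"
      unfolding that(2) linear_add[OF that(3)] linear_scale[OF that(3)] that(4)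
      by (simp add: algebra_simps)
    then show ?thesis using that(1,5) linear_0[OF that(3)] by simp
  qed
  have "U2 (U1 s) \<noteq> 0"
    using inj[OF _ U(1) linX(1) XX(1) 1(3)] inj[OF _ U(2) linX(2) XX(2) 2(3)] s by blast
  then have "0 < U2 (U1 s) \<bullet> U2 (U1 s)" by simp
  also have "U2 (U1 s) \<bullet> U2 (U1 s) = s \<bullet> U1 (U2 (U2 (U1 s)))"
    by (simp add: selfU)
  also have "U1 (U2 (U2 (U1 s))) = U1 (U1 (U2 (U2 s)))" by (simp add: U12)
  also have "\<dots> = \<alpha>1 *\<^sub>R (\<alpha>2 *\<^sub>R s + X2 s) + X1 (\<alpha>2 *\<^sub>R s + X2 s)" by (simp add: UU)
  \<comment> \<open>a_2 anticommutes with both a_1 and b_1, so it passes through the product a_1 x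
    and comes to stand next to y.\<close>
  also have "\<dots> = M a2 (P a1 (M x (P y s)))"
  proof -
    have "M a2 (P y s) = \<alpha>2 *\<^sub>R s + X2 s" by (simp add: y lin X MP al)
    moreover have "M a2 (P a1 (M x z)) = \<alpha>1 *\<^sub>R M a2 z + X1 (M a2 z)" for z
    proof -
      have "M a2 (P a1 (M b1 z)) = X1 (M a2 z)"
        by (simp add: X MP_orth[OF o(2)] PM_orth[OF o(7)] lin)
      then show ?thesis by (simp add: x lin PM al)
    qed
    ultimately show ?thesis by simp
  qed
  \<comment> \<open>a_1 and a_2 are orthogonal in the plane of f_1 and f_2, so their product has no
    scalar part and is a determinant times f_2 f_1. The sign of this determinant is where the choice
    of the component of the period domain enters.\<close>
  also have "M a2 (P a1 z) = (orient 1 x y / 4) *\<^sub>R M f2 (P f1 z)" for z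
  proof -
    let ?p = "(x $ 1 + x $ 2) / 2" and ?q = "(x $ 3 + x $ 4) / 2"
    let ?r = "(y $ 1 + y $ 2) / 2" and ?u = "(y $ 3 + y $ 4) / 2"
    have "M (r *\<^sub>R f1 + u *\<^sub>R f2) (P (p *\<^sub>R f1 + q *\<^sub>R f2) z) =
        (4 * (r * p + u * q)) *\<^sub>R z + (p * u - q * r) *\<^sub>R M f2 (P f1 z)" for p q r u
      unfolding lin MP f_facts MP_orth[OF f_facts(3)]
      by (simp add: scaleR_add_left scaleR_diff_left scaleR_add_right algebra_simps)
    from this[of ?r ?u ?p ?q] have "M a2 (P a1 z) =
        (4 * (?r * ?p + ?u * ?q)) *\<^sub>R z + (?p * ?u - ?q * ?r) *\<^sub>R M f2 (P f1 z)"
      unfolding ab pos_part_def .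
    moreover have "4 * (?r * ?p + ?u * ?q) = 0"
      using xy unfolding normal_pair_def by (simp add: field_simps)
    moreover have "?p * ?u - ?q * ?r = orient 1 x y / 4" by (simp add: orient_def field_simps)
    ultimately show ?thesis by (simp only: scaleR_zero_left add_0_left)
  qed
  finally have "0 < orient 1 x y / 4 * EE s (M x (P y s))" by (simp add: EE_def)
  moreover have "orient 1 x y > 0" using xy by (simp add: normal_pair_def)
  ultimately show ?thesis by (simp add: zero_less_mult_iff)
qed

end

section \<open>General period points\<close>

definition cdiff :: "(complex ^ 8 \<Rightarrow> complex) \<Rightarrow> complex ^ 8 \<Rightarrow> bool" where
  "cdiff f v \<longleftrightarrow> (\<exists>L. (f has_derivative L) (at v) \<and> (\<forall>c w. L (c *s w) = c * L w))"

lemma cdiff_const: "cdiff (\<lambda>w. c) v"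
  unfolding cdiff_def by (rule exI[of _ "\<lambda>h. 0"]) simp

lemma cdiff_nth: "cdiff (\<lambda>w. w $ i) v"
  unfolding cdiff_def
  by (rule exI[of _ "\<lambda>h. h $ i"])
    (simp add: bounded_linear_imp_has_derivative bounded_linear_vec_nth)

lemma cdiff_add: "cdiff f v \<Longrightarrow> cdiff g v \<Longrightarrow> cdiff (\<lambda>w. f w + g w) v"
  unfolding cdiff_def
proof (elim exE conjE)
  fix L K assume "(f has_derivative L) (at v)" "(g has_derivative K) (at v)"
    "\<forall>c w. L (c *s w) = c * L w" "\<forall>c w. K (c *s w) = c * K w"
  then show "\<exists>L. ((\<lambda>w. f w + g w) has_derivative L) (at v) \<and> (\<forall>c w. L (c *s w) = c * L w)"
    by (intro exI[of _ "\<lambda>h. L h + K h"]) (simp add: has_derivative_add distrib_left)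
qed

lemma cdiff_mult: "cdiff f v \<Longrightarrow> cdiff g v \<Longrightarrow> cdiff (\<lambda>w. f w * g w) v"
  unfolding cdiff_def
proof (elim exE conjE)
  fix L K assume "(f has_derivative L) (at v)" "(g has_derivative K) (at v)"
    "\<forall>c w. L (c *s w) = c * L w" "\<forall>c w. K (c *s w) = c * K w"
  then show "\<exists>L. ((\<lambda>w. f w * g w) has_derivative L) (at v) \<and> (\<forall>c w. L (c *s w) = c * L w)"
    by (intro exI[of _ "\<lambda>h. f v * K h + L h * g v"] conjI has_derivative_mult)
      (simp_all add: algebra_simps)
qed

lemma cdiff_inverse: "cdiff f v \<Longrightarrow> f v \<noteq> 0 \<Longrightarrow> cdiff (\<lambda>w. inverse (f w)) v"
  unfolding cdiff_def
proof (elim exE conjE)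
  fix L assume "f v \<noteq> 0" "(f has_derivative L) (at v)" "\<forall>c w. L (c *s w) = c * L w"
  then show "\<exists>L. ((\<lambda>w. inverse (f w)) has_derivative L) (at v) \<and> (\<forall>c w. L (c *s w) = c * L w)"
    by (intro exI[of _ "\<lambda>h. - (inverse (f v) * L h * inverse (f v))"])
      (simp add: has_derivative_inverse)
qed

lemma cdiff_sum: "(\<And>i. i \<in> I \<Longrightarrow> cdiff (f i) v) \<Longrightarrow> cdiff (\<lambda>w. \<Sum>i\<in>I. f i w) v"
  by (induction I rule: infinite_finite_induct) (auto intro: cdiff_const cdiff_add)

definition quad :: "(8 \<Rightarrow> 8 \<Rightarrow> complex) \<Rightarrow> complex ^ 8 \<Rightarrow> complex" where
  "quad a v = (\<Sum>k\<in>UNIV. \<Sum>l\<in>UNIV. a k l * v $ k * v $ l)"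

lemma quad_scale: "quad a (c *s v) = c\<^sup>2 * quad a v"
  by (simp add: quad_def sum_distrib_left power2_eq_square mult_ac)

lemma cdiff_quad: "cdiff (quad a) v"
  unfolding quad_def by (intro cdiff_sum cdiff_mult cdiff_const cdiff_nth)

text \<open>Dividing by the square of the first coordinate makes the quadrics homogeneous of degree
  0, so the discontinuous choice of representatives drops out. One chart suffices, because the first
  coordinate vanishes nowhere on \<open>D_plus\<close>.\<close>

lemma analytic_subset_quadrics:
  assumes "finite A"
  shows "analytic_subset D_plus {p \<in> D_plus. \<forall>b\<in>A. quad (a b) (rep_proj7 p) = 0}"
proof -
  let ?U = "{p. rep_proj7 p $ 1 \<noteq> 0}"
  let ?f = "\<lambda>b p. quad (a b) (rep_proj7 p) * inverse (rep_proj7 p $ 1 * rep_proj7 p $ 1)"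
  have f: "?f b (abs_proj7 v) = quad (a b) v * inverse (v $ 1 * v $ 1)" if "v \<noteq> 0" for b v
  proof -
    obtain c where c: "c \<noteq> 0" "rep_proj7 (abs_proj7 v) = c *s v" using rep_abs_proj7[OF \<open>v \<noteq> 0\<close>] .
    then show ?thesis by (simp add: quad_scale power2_eq_square field_simps)
  qed
  have U: "abs_proj7 v \<in> ?U \<longleftrightarrow> v $ 1 \<noteq> 0" if "v \<noteq> 0" for v
  proof -
    obtain c where c: "c \<noteq> 0" "rep_proj7 (abs_proj7 v) = c *s v" using rep_abs_proj7[OF \<open>v \<noteq> 0\<close>] .
    then show ?thesis by simp
  qed
  have "{v. v \<noteq> 0 \<and> abs_proj7 v \<in> ?U} = {v. v $ 1 \<noteq> 0}"
    by (rule Collect_cong) (metis U zero_index)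
  moreover have "open {v :: complex ^ 8. v $ 1 \<noteq> 0}"
    by (intro open_Collect_neq continuous_intros)
  ultimately have "proj_open ?U" by (simp add: proj_open_def)
  moreover have "p \<in> ?U" if "p \<in> D_plus" for p
    using that by (auto simp: D_plus_iff period_cone_def)
  moreover have "proj_holomorphic_on (?f b) ?U" for b
    unfolding proj_holomorphic_on_def
  proof (intro allI impI)
    fix v :: "complex ^ 8" assume v: "v \<noteq> 0 \<and> abs_proj7 v \<in> ?U"
    then have v1: "v $ 1 \<noteq> 0" using U by blast
    have "cdiff (\<lambda>w. quad (a b) w * inverse (w $ 1 * w $ 1)) v"
      using v1 by (intro cdiff_mult cdiff_inverse cdiff_nth cdiff_quad) simp
    then obtain L where L: "((\<lambda>w. quad (a b) w * inverse (w $ 1 * w $ 1)) has_derivative L) (at v)"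
      "\<forall>c w. L (c *s w) = c * L w" by (auto simp: cdiff_def)
    have "((\<lambda>w. ?f b (abs_proj7 w)) has_derivative L) (at v)"
      by (rule has_derivative_transform_within_open[OF L(1), of "- {0}"]) (use v f in auto)
    then show "\<exists>L. ((\<lambda>w. ?f b (abs_proj7 w)) has_derivative L) (at v) \<and>
        (\<forall>c w. L (c *s w) = c * L w)" using L(2) by blast
  qed
  moreover have "{p \<in> D_plus. \<forall>b\<in>A. quad (a b) (rep_proj7 p) = 0} \<inter> ?U =
      {q \<in> D_plus \<inter> ?U. \<forall>f\<in>?f ` A. f q = 0}" by auto
  ultimately show ?thesis
    unfolding analytic_subset_def using assms
    by (auto intro!: exI[of _ ?U] exI[of _ "?f ` A"])
qed

section \<open>Countability of lattice homomorphisms\<close>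

lemma countable_zlat: "countable (zlat :: 'a::euclidean_space set)"
proof -
  let ?f = "\<lambda>x :: 'a. \<lambda>b\<in>Basis. x \<bullet> b"
  have "countable (\<int> :: real set)" by (simp add: Ints_def)
  then have "countable (Basis \<rightarrow>\<^sub>E \<int> :: ('a \<Rightarrow> real) set)" by (intro countable_PiE) auto
  moreover have "?f ` zlat \<subseteq> Basis \<rightarrow>\<^sub>E \<int>" by (auto simp: zlat_def)
  moreover have "inj_on ?f zlat"
    by (rule inj_onI) (metis euclidean_eqI restrict_apply')
  ultimately show ?thesis by (meson countable_image_inj_on countable_subset)
qed

lemma Basis_zlat: "Basis \<subseteq> (zlat :: 'a::euclidean_space set)"
  by (auto simp: zlat_def inner_Basis)

text \<open>A linear map is determined by its values on a finite basis, and these lie in a countable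
  lattice.\<close>

lemma countable_lattice_maps:
  "countable {g :: 'a::euclidean_space \<Rightarrow> 'b::euclidean_space. linear g \<and> g ` zlat \<subseteq> zlat}"
    (is "countable ?G")
proof -
  let ?f = "\<lambda>g :: 'a \<Rightarrow> 'b. restrict g Basis"
  have "countable (Basis \<rightarrow>\<^sub>E zlat :: ('a \<Rightarrow> 'b) set)"
    by (intro countable_PiE) (auto intro: countable_zlat)
  moreover have "?f ` ?G \<subseteq> Basis \<rightarrow>\<^sub>E zlat"
    using Basis_zlat by (auto simp: image_subset_iff subset_iff)
  moreover have "inj_on ?f ?G"
  proof (rule inj_onI)
    fix g h assume gh: "g \<in> ?G" "h \<in> ?G" "?f g = ?f h"
    then have "g b = h b" if "b \<in> Basis" for b using that by (metis restrict_apply')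
    then show "g = h" using gh(1,2) linear_eq_stdbasis by blast
  qed
  ultimately show ?thesis by (meson countable_image_inj_on countable_subset)
qed

context spin_rep
begin

text \<open>
  Let \<open>\<eta> = x + i y\<close> be an isotropic vector. The \<open>i\<close>-eigenspace of \<open>m(\<eta>)\<close> is the image of \<open>\<eta>\<close> and the
  kernel of \<open>\<eta>\<close>, so a real endomorphism \<open>g\<close> commuting with \<open>m(\<eta>)\<close> satisfies \<open>\<eta> g \<eta> = 0\<close>; these
  are the real and imaginary parts of this equation, which is holomorphic in \<open>\<eta>\<close>.
\<close>

definition eigen_cond :: "('a \<Rightarrow> 'a) \<Rightarrow> real ^ 8 \<Rightarrow> real ^ 8 \<Rightarrow> bool" where
  "eigen_cond g x y \<longleftrightarrow>
     (\<forall>s. P x (g (M x s)) = P y (g (M y s)) \<and> P x (g (M y s)) = - P y (g (M x s)))"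

lemma commute_imp_eigen_cond:
  assumes xy: "Q x = 1" "Q y = 1" "gram_bilin x y = 0"
    and g: "linear g" "\<And>s. g (M x (P y s)) = M x (P y (g s))"
  shows "eigen_cond g x y"
  unfolding eigen_cond_def
proof (intro allI conjI)
  fix s
  have yx: "gram_bilin y x = 0" using xy(3) by (simp add: gram_bilin_commute)
  \<comment> \<open>Insert y y = 1 on the right and pull the product x y through
    \<open>g\<close>.\<close>
  have "P x (g (M x (P y (M y s)))) = P x (M x (P y (g (M y s))))" by (simp only: g(2))
  then show "P x (g (M x s)) = P y (g (M y s))" by (simp add: PM xy)
  have "M x (P y (M x s)) = - M y s" by (simp add: MP_orth[OF xy(3)] PM xy)
  then have "- P x (g (M y s)) = P x (g (M x (P y (M x s))))"
    by (simp add: lin linear_neg[OF g(1)])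
  also have "\<dots> = P y (g (M x s))" by (simp add: g(2) PM xy)
  finally show "P x (g (M y s)) = - P y (g (M x s))" by (metis minus_minus)
qed

text \<open>\<eta> g \<eta> is homogeneous of degree 2 in \<eta>, so its vanishing does not depend
  on the representative.\<close>

lemma eigen_cond_scale:
  assumes g: "linear g" and e: "eigen_cond g (Re_vec w) (Im_vec w)"
  shows "eigen_cond g (Re_vec (c *s w)) (Im_vec (c *s w))"
proof -
  note lg = linear_add[OF g] linear_diff[OF g] linear_scale[OF g]
  have e': "P (Re_vec w) (g (M (Re_vec w) s)) = P (Im_vec w) (g (M (Im_vec w) s))"
    "P (Re_vec w) (g (M (Im_vec w) s)) = - P (Im_vec w) (g (M (Re_vec w) s))" for s
    using e by (auto simp: eigen_cond_def)
  show ?thesis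
    unfolding eigen_cond_def Re_vec_scale Im_vec_scale
    by (simp add: lin lg e' algebra_simps)
qed

text \<open>The matrix entries of \<eta> g \<eta> are quadratic polynomials in \<eta> with real
  coefficients; their real and imaginary parts are the two equations of
  \<open>eigen_cond\<close>.\<close>

lemma eigen_cond_iff_quad:
  assumes g: "linear g"
  shows "eigen_cond g (Re_vec w) (Im_vec w) \<longleftrightarrow>
    (\<forall>(b, b')\<in>Basis \<times> Basis.
       quad (\<lambda>k l. of_real (P (axis k 1) (g (M (axis l 1) b)) \<bullet> b')) w = 0)"
proof -
  let ?x = "Re_vec w" and ?y = "Im_vec w"
  note lg = linear_add[OF g] linear_diff[OF g] linear_scale[OF g] linear_sum[OF g] linear_neg[OF g]
  define h where "h b b' x y = P x (g (M y b)) \<bullet> b'" for b b' x y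
  have expand: "h b b' x y = (\<Sum>k\<in>UNIV. \<Sum>l\<in>UNIV. h b b' (axis k 1) (axis l 1) * x $ k * y $ l)"
    for b b' x y
  proof -
    have "h b b' x y = h b b' (\<Sum>k\<in>UNIV. (x $ k) *\<^sub>R axis k 1) (\<Sum>l\<in>UNIV. (y $ l) *\<^sub>R axis l 1)"
      by (simp add: basis_expansion flip: scalar_mult_eq_scaleR)
    also have "\<dots> = (\<Sum>k\<in>UNIV. \<Sum>l\<in>UNIV. h b b' (axis k 1) (axis l 1) * x $ k * y $ l)"
      by (simp add: h_def linear_sum[OF linear_P'] linear_sum[OF linear_M'] linear_sum[OF linear_P]
          lin lg inner_sum_left sum_distrib_left mult_ac) (rule sum.swap)
    finally show ?thesis .
  qed
  have quad: "quad (\<lambda>k l. of_real (h b b' (axis k 1) (axis l 1))) w =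
      Complex (h b b' ?x ?x - h b b' ?y ?y) (h b b' ?x ?y + h b b' ?y ?x)" for b b'
    unfolding expand[of b b' ?x ?x] expand[of b b' ?y ?y] expand[of b b' ?x ?y] expand[of b b' ?y ?x]
      quad_def complex_eq_iff
    by (simp add: sum_subtractf[symmetric] sum.distrib[symmetric] Re_vec_def Im_vec_def algebra_simps)
  have "eigen_cond g ?x ?y \<longleftrightarrow> (\<forall>b\<in>Basis. P ?x (g (M ?x b)) = P ?y (g (M ?y b)) \<and>
      P ?x (g (M ?y b)) = - P ?y (g (M ?x b)))"
  proof
    assume b: "\<forall>b\<in>Basis. P ?x (g (M ?x b)) = P ?y (g (M ?y b)) \<and>
      P ?x (g (M ?y b)) = - P ?y (g (M ?x b))"
    have "(\<lambda>s. P ?x (g (M ?x s))) = (\<lambda>s. P ?y (g (M ?y s)))"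
      "(\<lambda>s. P ?x (g (M ?y s))) = (\<lambda>s. - P ?y (g (M ?x s)))"
      by (rule linear_eq_stdbasis; (rule linearI)?; use b in \<open>simp add: lin lg\<close>)+
    then show "eigen_cond g ?x ?y" unfolding eigen_cond_def by metis
  qed (simp add: eigen_cond_def)
  also have "\<dots> \<longleftrightarrow> (\<forall>b\<in>Basis. \<forall>b'\<in>Basis. h b b' ?x ?x = h b b' ?y ?y \<and>
      h b b' ?x ?y = - h b b' ?y ?x)"
    unfolding h_def by (subst (1 2) euclidean_eq_iff) (auto simp: inner_minus_left)
  finally show ?thesis
    unfolding h_def[symmetric] quad by (auto simp: complex_eq_iff eq_neg_iff_add_eq_0)
qed

section \<open>Exceptional loci of endomorphisms\<close>

definition special_locus :: "('a \<Rightarrow> 'a) \<Rightarrow> proj7 set" where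
  "special_locus g =
     {p \<in> D_plus. eigen_cond g (Re_vec (rep_proj7 p)) (Im_vec (rep_proj7 p))}"

lemma analytic_special_locus: "linear g \<Longrightarrow> analytic_subset D_plus (special_locus g)"
  unfolding special_locus_def
  using analytic_subset_quadrics[of "Basis \<times> Basis"
      "\<lambda>(b, b') k l. of_real (P (axis k 1) (g (M (axis l 1) b)) \<bullet> b')"]
  by (simp add: eigen_cond_iff_quad split_def)

lemma special_locus_D_plus:
  assumes g: "linear g" and full: "special_locus g = D_plus" and w: "w \<in> period_cone"
  shows "eigen_cond g (Re_vec w) (Im_vec w)"
proof -
  have w0: "w \<noteq> 0" using w by (rule period_cone_nonzero)
  obtain c where c: "c \<noteq> 0" "rep_proj7 (abs_proj7 w) = c *s w" using rep_abs_proj7[OF w0] .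
  have "abs_proj7 w \<in> special_locus g" using w full by (simp add: D_plus_eq)
  then have "eigen_cond g (Re_vec (c *s w)) (Im_vec (c *s w))"
    by (simp add: special_locus_def c)
  from eigen_cond_scale[OF g this, of "inverse c"] show ?thesis
    using c(1) by (simp add: vector_smult_assoc)
qed

text \<open>If the condition holds on the whole cone, then x g x = Q(x) C for every real vector x,
  with one operator \<open>C\<close>. Cancelling one factor x gives g x = x C and C x = x g, so
  \<open>g\<close> passes through every product x y.\<close>

lemma commutes_if_everywhere:
  assumes g: "linear g" and full: "special_locus g = D_plus"
  shows "g (M x (P y s)) = M x (P y (g s))"
proof -
  note lg = linear_add[OF g] linear_diff[OF g] linear_scale[OF g] linear_neg[OF g] linear_0[OF g]
  define h where "h x y s = P x (g (M y s))" for x y s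
  have h_lin: "h (x + x') y s = h x y s + h x' y s" "h x (y + y') s = h x y s + h x y' s"
    "h (r *\<^sub>R x) y s = r *\<^sub>R h x y s" "h x (r *\<^sub>R y) s = r *\<^sub>R h x y s"
    "h (- x) y s = - h x y s" "h x (- y) s = - h x y s"
    "h (x - x') y s = h x y s - h x' y s" "h x (y - y') s = h x y s - h x y' s" for x x' y y' r s
    by (simp_all add: h_def lin lg)
  have cone: "h x x s = h y y s \<and> h x y s = - h y x s"
    if "Q x = Q y" "gram_bilin x y = 0" "Q x > 0" "orient 1 x y > 0" for x y s
    using special_locus_D_plus[OF g full, of "cvec_of x y"] that
    by (simp add: period_cone_iff Re_cvec_of Im_cvec_of eigen_cond_def h_def)
  \<comment> \<open>The factor compensates Q(f_1) = 4.\<close>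
  define C where "C s = (1 / 4) *\<^sub>R h f1 f1 s" for s
  have o1: "orient 1 (r *\<^sub>R f1 + n) f2 = 4 * r"
    if "n $ 1 + n $ 2 = 0" "n $ 3 + n $ 4 = 0" for r n
    using that by (simp add: orient_def f1_def f2_def axis_def)
  have neg: "h f1 n s = - h n f1 s" "h f2 n s = - h n f2 s" "h n n s = Q n *\<^sub>R C s"
    "h f1 f2 s = - h f2 f1 s" "h f2 f2 s = h f1 f1 s"
    if n: "n $ 1 + n $ 2 = 0" "n $ 3 + n $ 4 = 0" for n s
  proof -
    have fn: "gram_bilin f1 n = 0" "gram_bilin n f2 = 0" "gram_bilin n f1 = 0" "gram_bilin f2 n = 0"
      using n by (simp_all add: f1_def f2_def gram_bilin_expand axis_def)
    \<comment> \<open>Chosen so that Q(r f_1 + n) = Q(f_2). Then r f_1 + n and r f_1 - n both form a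
      pair in the cone with f_2, and comparing the two isolates the terms linear in n.\<close>
    define r where "r = sqrt (1 - Q n / 4)"
    have "neg_part n = n" using n by (simp add: neg_part_def pos_part_def)
    then have Qn: "Q n \<le> 0" using Q_neg_part_le[of n] by simp
    then have r: "r * r = 1 - Q n / 4" "r \<ge> 1" by (simp_all add: r_def)
    have a: "h (r *\<^sub>R f1 + n) (r *\<^sub>R f1 + n) s = h f2 f2 s \<and>
        h (r *\<^sub>R f1 + n) f2 s = - h f2 (r *\<^sub>R f1 + n) s"
      if "n $ 1 + n $ 2 = 0" "n $ 3 + n $ 4 = 0" "gram_bilin f1 n = 0" "gram_bilin n f2 = 0"
        "Q n = 4 - 4 * (r * r)" for n
    proof (rule cone)
      show "Q (r *\<^sub>R f1 + n) = Q f2" "Q (r *\<^sub>R f1 + n) > 0"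
        using that by (simp_all add: Q_add Q_scale gram_bilin_simps f_facts power2_eq_square)
      show "gram_bilin (r *\<^sub>R f1 + n) f2 = 0"
        using that by (simp add: gram_bilin_simps f_facts)
      show "orient 1 (r *\<^sub>R f1 + n) f2 > 0" using o1[OF that(1,2)] r(2) by simp
    qed
    have b: "h f1 f1 s = h f2 f2 s \<and> h f1 f2 s = - h f2 f1 s"
      by (rule cone) (simp_all add: f_facts, simp add: orient_def f1_def f2_def axis_def)
    have plus: "h (r *\<^sub>R f1 + n) (r *\<^sub>R f1 + n) s = h f2 f2 s \<and>
        h (r *\<^sub>R f1 + n) f2 s = - h f2 (r *\<^sub>R f1 + n) s"
      by (rule a) (use n fn r in simp_all)
    have minus: "h (r *\<^sub>R f1 + - n) (r *\<^sub>R f1 + - n) s = h f2 f2 s \<and>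
        h (r *\<^sub>R f1 + - n) f2 s = - h f2 (r *\<^sub>R f1 + - n) s"
    proof (rule a)
      show "Q (- n) = 4 - 4 * (r * r)" using r(1) by (simp add: Q_def gram_bilin_simps)
    qed (use n fn in \<open>simp_all add: gram_bilin_simps\<close>)
    show "h f1 f2 s = - h f2 f1 s" "h f2 f2 s = h f1 f1 s" using b by simp_all
    define B where "B = r *\<^sub>R (h f1 n s + h n f1 s)"
    have p: "(r * r) *\<^sub>R h f1 f1 s + B + h n n s = h f1 f1 s"
      using plus b by (simp add: B_def h_lin scaleR_add_right algebra_simps)
    have m: "(r * r) *\<^sub>R h f1 f1 s - B + h n n s = h f1 f1 s"
      using minus b by (simp add: B_def h_lin scaleR_add_right algebra_simps)
    have "2 *\<^sub>R B = ((r * r) *\<^sub>R h f1 f1 s + B + h n n s) - ((r * r) *\<^sub>R h f1 f1 s - B + h n n s)"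
      by (simp add: scaleR_2)
    also have "\<dots> = 0" unfolding p m by simp
    finally have B0: "B = 0" by simp
    then have 0: "h f1 n s + h n f1 s = 0" using r(2) by (auto simp: B_def)
    then show "h f1 n s = - h n f1 s" by (simp add: eq_neg_iff_add_eq_0)
    have "h n n s = (1 - r * r) *\<^sub>R h f1 f1 s"
      using p B0 by (simp add: scaleR_diff_left algebra_simps)
    then show "h n n s = Q n *\<^sub>R C s" by (simp add: r(1) C_def)
    have "r *\<^sub>R h f1 f2 s + h n f2 s = - (r *\<^sub>R h f2 f1 s) - h f2 n s"
      using plus by (simp add: h_lin)
    then show "h f2 n s = - h n f2 s" using b by (simp add: eq_neg_iff_add_eq_0 algebra_simps)
  qed
  have main: "h x x s = Q x *\<^sub>R C s" for x s
  proof -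
    define p q n where pq: "p = (x $ 1 + x $ 2) / 2" "q = (x $ 3 + x $ 4) / 2"
      "n = neg_part x"
    have x: "x = p *\<^sub>R f1 + q *\<^sub>R f2 + n"
      using pos_neg[of x] by (simp add: pq pos_part_def)
    have n: "n $ 1 + n $ 2 = 0" "n $ 3 + n $ 4 = 0"
      by (simp_all add: pq neg_part_def pos_part_def f1_def f2_def axis_def)
    have "gram_bilin f1 n = 0" "gram_bilin f2 n = 0"
      using n by (simp_all add: f1_def f2_def gram_bilin_expand axis_def)
    then have "Q x = 4 * (p * p) + 4 * (q * q) + Q n"
      by (simp add: x Q_add Q_scale gram_bilin_simps f_facts power2_eq_square)
    moreover have "h x x s = (p * p + q * q) *\<^sub>R h f1 f1 s + h n n s"
      using neg(1,2,4,5)[OF n, of s]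
      by (simp add: x h_lin scaleR_add_right scaleR_diff_right scaleR_add_left mult.commute)
    ultimately show ?thesis
      by (simp add: neg(3)[OF n] C_def scaleR_add_left add_divide_distrib)
  qed
  have C1: "Q x *\<^sub>R g (M x s) = Q x *\<^sub>R M x (C s)" for x s
  proof -
    have "Q x *\<^sub>R g (M x s) = M x (h x x s)" by (simp add: h_def MP)
    then show ?thesis by (simp add: main lin)
  qed
  have C2: "Q x *\<^sub>R P x (g s) = Q x *\<^sub>R C (P x s)" for x s
  proof -
    have "h x x (P x s) = Q x *\<^sub>R P x (g s)" by (simp add: h_def MP lg lin)
    then show ?thesis unfolding main by (rule sym)
  qed
  have gM: "g (M x s) = M x (C s)" and CP: "C (P x s) = P x (g s)" for x s
  proof -
    have lC: "C (s + t) = C s + C t" "C (r *\<^sub>R s) = r *\<^sub>R C s" for r s t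
      by (simp_all add: C_def h_def lin lg scaleR_add_right)
    have nz: "g (M z s) = M z (C s) \<and> C (P z s) = P z (g s)" if "Q z \<noteq> 0" for z s
      using C1[of z s] C2[of z s] that by simp
    \<comment> \<open>An isotropic x cannot be cancelled directly. For this t both x + t f_1 and t
      f_1 are anisotropic, and x is their difference.\<close>
    define t where "t = 1 + \<bar>Q x\<bar> + \<bar>gram_bilin x f1\<bar>"
    have t0: "t \<noteq> 0" unfolding t_def by linarith
    have "Q (x + t *\<^sub>R f1) > 0"
    proof -
      have "Q (x + t *\<^sub>R f1) = Q x + 2 * (t * gram_bilin x f1) + 4 * (t * t)"
        by (simp add: Q_add Q_scale gram_bilin_simps f_facts power2_eq_square)
      moreover have "t * gram_bilin x f1 \<ge> - (t * t)"
      proof -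
        have "t * (- gram_bilin x f1) \<le> t * t"
          by (intro mult_left_mono) (auto simp: t_def)
        then show ?thesis by simp
      qed
      moreover have "t * t \<ge> t" using mult_right_mono[of 1 t t] by (simp add: t_def)
      moreover have "t > - Q x" "t > 0" by (auto simp: t_def)
      ultimately show ?thesis by linarith
    qed
    then have "Q (x + t *\<^sub>R f1) \<noteq> 0" "Q (t *\<^sub>R f1) \<noteq> 0"
      by (auto simp: Q_scale f_facts t_def)
    from nz[OF this(1), of s] nz[OF this(2), of s]
    show "g (M x s) = M x (C s)" "C (P x s) = P x (g s)"
      by (simp_all add: lin lg lC t0)
  qed
  show ?thesis by (simp add: gM CP)
qed

text \<open>The exceptional sets are the proper loci of linear maps preserving the lattice. Outside
  them, a commuting map of this kind has all of \<open>D_plus\<close> as its locus, so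
  \<open>commutes_if_everywhere\<close> and \<open>commutant\<close> apply.\<close>

lemma general_commutant:
  "\<exists>\<Z>. countable \<Z> \<and> (\<forall>Z\<in>\<Z>. analytic_subset D_plus Z \<and> Z \<noteq> D_plus) \<and>
     (\<forall>x y g. normal_pair x y \<and> abs_proj7 (cvec_of x y) \<in> D_plus - \<Union>\<Z> \<and> linear g \<and>
        g ` zlat \<subseteq> zlat \<and> (\<forall>s. g (M x (P y s)) = M x (P y (g s))) \<longrightarrow> (\<exists>q. \<forall>s. g s = R q s))"
proof -
  let ?G = "{g :: 'a \<Rightarrow> 'a. linear g \<and> g ` zlat \<subseteq> zlat}"
  define \<Z> where "\<Z> = special_locus ` {g \<in> ?G. special_locus g \<noteq> D_plus}"
  have "countable {g \<in> ?G. special_locus g \<noteq> D_plus}"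
    by (rule countable_subset[OF _ countable_lattice_maps]) auto
  then have 1: "countable \<Z>" unfolding \<Z>_def by (rule countable_image)
  have 2: "analytic_subset D_plus Z \<and> Z \<noteq> D_plus" if "Z \<in> \<Z>" for Z
    using that analytic_special_locus by (auto simp: \<Z>_def)
  have 3: "\<exists>q. \<forall>s. g s = R q s"
    if xy: "normal_pair x y" and p: "abs_proj7 (cvec_of x y) \<in> D_plus - \<Union>\<Z>"
      and g: "linear g" "g ` zlat \<subseteq> zlat" "\<And>s. g (M x (P y s)) = M x (P y (g s))" for x y g
  proof -
    let ?p = "abs_proj7 (cvec_of x y)"
    have e: "eigen_cond g x y"
      using xy g by (intro commute_imp_eigen_cond) (auto simp: normal_pair_def)
    have "cvec_of x y \<in> period_cone"
      using xy by (simp add: normal_pair_def period_cone_iff Re_cvec_of Im_cvec_of)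
    then obtain c where c: "rep_proj7 ?p = c *s cvec_of x y"
      using rep_abs_proj7 period_cone_nonzero by metis
    have "?p \<in> special_locus g"
      using p eigen_cond_scale[OF g(1), of "cvec_of x y" c] e
      by (simp add: special_locus_def c Re_cvec_of Im_cvec_of)
    then have "special_locus g \<notin> \<Z>" using p by blast
    then have "special_locus g = D_plus" using g(1,2) by (auto simp: \<Z>_def)
    then show ?thesis
      by (intro commutant commutes_if_everywhere g(1))
  qed
  show ?thesis
  proof (intro exI[of _ \<Z>] conjI ballI allI impI)
    fix x y g
    assume "normal_pair x y \<and> abs_proj7 (cvec_of x y) \<in> D_plus - \<Union>\<Z> \<and> linear g \<and>
        g ` zlat \<subseteq> zlat \<and> (\<forall>s. g (M x (P y s)) = M x (P y (g s)))"
    then show "\<exists>q. \<forall>s. g s = R q s" by (intro 3[of x y g]) auto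
  qed (use 1 2 in blast)+
qed

end

section \<open>The simple factors\<close>

lemma exists_rational_functional:
  obtains th :: "real \<Rightarrow> real" where
    "\<And>a b. th (a + b) = th a + th b" "th 1 = 1" "\<And>a. th a \<in> \<rat>"
proof -
  interpret Q: vector_space "\<lambda>(q::rat) (x::real). of_rat q * x"
    by unfold_locales (simp_all add: algebra_simps of_rat_add of_rat_mult)
  have ind: "\<not> Q.dependent {1}" by (simp add: Q.dependent_single)
  \<comment> \<open>A Hamel basis of the reals over the rationals through 1; the functional is the
    coordinate of 1.\<close>
  define B where "B = Q.extend_basis {1}"
  have B: "\<not> Q.dependent B" "1 \<in> B" "Q.span B = UNIV"
    using Q.independent_extend_basis[OF ind] Q.extend_basis_superset[OF ind]
      Q.span_extend_basis[OF ind] by (auto simp: B_def)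
  show ?thesis
  proof (rule that[of "\<lambda>a. of_rat (Q.representation B a 1)"])
    show "real_of_rat (Q.representation B (a + b) 1) =
        of_rat (Q.representation B a 1) + of_rat (Q.representation B b 1)" for a b
      using Q.representation_add[OF B(1), of b a] B(3) by (simp add: of_rat_add)
    show "real_of_rat (Q.representation B 1 1) = 1"
      using Q.representation_basis[OF B(1,2)] by simp
  qed simp
qed

lemma additive_scale_int:
  assumes "\<And>a b. th (a + b) = th a + (th b :: real)" "n \<in> \<int>"
  shows "th (a * n) = th a * n"
proof -
  have th0: "th 0 = 0" using assms(1)[of 0 0] by simp
  have nat: "th (a * real k) = th a * real k" for k
    by (induction k) (simp_all add: th0 assms(1) distrib_left)
  have neg: "th (- b) = - th b" for b using assms(1)[of b "- b"] th0 by simp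
  obtain m where m: "n = of_int m" using assms(2) by (auto elim: Ints_cases)
  show ?thesis
  proof (cases "m \<ge> 0")
    case True
    then show ?thesis using nat[of "nat m"] by (simp add: m)
  next
    case False
    then show ?thesis using nat[of "nat (- m)"] neg[of "a * of_int m"] by (simp add: m)
  qed
qed

lemma zlat_scale_Ints: "r \<in> \<int> \<Longrightarrow> x \<in> zlat \<Longrightarrow> r *\<^sub>R x \<in> zlat"
  by (simp add: zlat_def)

lemma zlat_sum: "(\<And>i. i \<in> I \<Longrightarrow> f i \<in> zlat) \<Longrightarrow> sum f I \<in> zlat"
  by (induction I rule: infinite_finite_induct) (auto intro: zlat_0 zlat_add)

text \<open>Rational vectors, described by a denominator so that multiples in the lattice are at
  hand.\<close>

definition qlat :: "'a::euclidean_space set" where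
  "qlat = {x. \<exists>n::nat. n > 0 \<and> real n *\<^sub>R x \<in> zlat}"

lemma qlat_0: "0 \<in> qlat"
  by (auto simp: qlat_def zlat_0 intro: exI[of _ 1])

lemma qlat_add: "x \<in> qlat \<Longrightarrow> y \<in> qlat \<Longrightarrow> x + y \<in> qlat"
proof -
  assume "x \<in> qlat" "y \<in> qlat"
  then obtain m n :: nat where mn: "m > 0" "n > 0" "real m *\<^sub>R x \<in> zlat" "real n *\<^sub>R y \<in> zlat"
    by (auto simp: qlat_def)
  have "real n *\<^sub>R (real m *\<^sub>R x) + real m *\<^sub>R (real n *\<^sub>R y) \<in> zlat"
    by (intro zlat_add zlat_scale_Ints mn) auto
  then have "real (m * n) *\<^sub>R (x + y) \<in> zlat" by (simp add: scaleR_add_right mult.commute)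
  then show "x + y \<in> qlat" using mn(1,2) by (auto simp: qlat_def intro!: exI[of _ "m * n"])
qed

lemma qlat_sum: "(\<And>i. i \<in> I \<Longrightarrow> f i \<in> qlat) \<Longrightarrow> sum f I \<in> qlat"
  by (induction I rule: infinite_finite_induct) (auto intro: qlat_0 qlat_add)

lemma qlat_scale_Rats: "r \<in> \<rat> \<Longrightarrow> x \<in> zlat \<Longrightarrow> r *\<^sub>R x \<in> qlat"
proof -
  assume "r \<in> \<rat>" "x \<in> zlat"
  then obtain m n :: int where mn: "n > 0" "r = of_int m / of_int n"
    by (metis Rats_cases')
  have "real (nat n) *\<^sub>R (r *\<^sub>R x) = of_int m *\<^sub>R x" using mn by simp
  also have "\<dots> \<in> zlat" using \<open>x \<in> zlat\<close> by (intro zlat_scale_Ints) auto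
  finally show ?thesis using mn(1) by (auto simp: qlat_def intro!: exI[of _ "nat n"])
qed

lemma common_denominator:
  assumes "finite A" "\<And>x. x \<in> A \<Longrightarrow> f x \<in> qlat"
  shows "\<exists>n::nat. n > 0 \<and> (\<forall>x\<in>A. real n *\<^sub>R f x \<in> zlat)"
  using assms
proof (induction A)
  case (insert a A)
  then obtain n where n: "n > 0" "\<forall>x\<in>A. real n *\<^sub>R f x \<in> zlat" by auto
  obtain m where m: "m > 0" "real m *\<^sub>R f a \<in> zlat" using insert.prems[of a] by (auto simp: qlat_def)
  have "real (n * m) *\<^sub>R f x \<in> zlat" if "x \<in> insert a A" for x
  proof (cases "x = a")
    case True
    then show ?thesis using zlat_scale_Ints[OF _ m(2), of "real n"] by simp
  next
    case False
    then show ?thesis using that n(2) zlat_scale_Ints[of "real m" "real n *\<^sub>R f x"]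
      by (simp add: mult.commute)
  qed
  then show ?case using n(1) m(1) by (intro exI[of _ "n * m"]) simp
qed (auto intro: exI[of _ 1])

lemma qlat_iff: "x \<in> qlat \<longleftrightarrow> (\<forall>b\<in>Basis. x \<bullet> b \<in> \<rat>)"
proof
  assume "x \<in> qlat"
  then obtain n :: nat where n: "n > 0" "real n *\<^sub>R x \<in> zlat" by (auto simp: qlat_def)
  show "\<forall>b\<in>Basis. x \<bullet> b \<in> \<rat>"
  proof
    fix b :: 'a assume "b \<in> Basis"
    then have "real n * (x \<bullet> b) \<in> \<int>" using n(2) by (simp add: zlat_def)
    then have "real n * (x \<bullet> b) / real n \<in> \<rat>" using Ints_subset_Rats by (intro Rats_divide) auto
    then show "x \<bullet> b \<in> \<rat>" using n(1) by simp
  qed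
next
  assume "\<forall>b\<in>Basis. x \<bullet> b \<in> \<rat>"
  then have "(\<Sum>b\<in>Basis. (x \<bullet> b) *\<^sub>R b) \<in> qlat"
    using Basis_zlat by (intro qlat_sum qlat_scale_Rats) auto
  then show "x \<in> qlat" by (simp add: euclidean_representation)
qed

lemma full_lattice_zlat: "full_lattice UNIV zlat"
  unfolding full_lattice_def
proof (intro exI conjI)
  show "zlat = range (\<lambda>c :: 'a \<Rightarrow> int. \<Sum>b\<in>Basis. of_int (c b) *\<^sub>R b)"
  proof (intro equalityI subsetI)
    fix x :: 'a assume "x \<in> zlat"
    then have "(\<Sum>b\<in>Basis. of_int \<lfloor>x \<bullet> b\<rfloor> *\<^sub>R b) = (\<Sum>b\<in>Basis. (x \<bullet> b) *\<^sub>R b)"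
      by (intro sum.cong) (auto simp: zlat_def elim!: Ints_cases)
    then have "x = (\<Sum>b\<in>Basis. of_int \<lfloor>x \<bullet> b\<rfloor> *\<^sub>R b)" by (simp add: euclidean_representation)
    then show "x \<in> range (\<lambda>c :: 'a \<Rightarrow> int. \<Sum>b\<in>Basis. of_int (c b) *\<^sub>R b)"
      unfolding image_iff by (intro bexI[where x = "\<lambda>b. \<lfloor>x \<bullet> b\<rfloor>"] UNIV_I)
  next
    fix x :: 'a assume "x \<in> range (\<lambda>c :: 'a \<Rightarrow> int. \<Sum>b\<in>Basis. of_int (c b) *\<^sub>R b)"
    then show "x \<in> zlat" using Basis_zlat by (auto intro!: zlat_sum zlat_scale_Ints)
  qed
qed (simp_all add: independent_Basis)

lemma real_linear_on_UNIV: "real_linear_on UNIV UNIV f \<longleftrightarrow> linear f"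
  by (auto simp: real_linear_on_def linear_iff)

text \<open>Gram-Schmidt for an arbitrary positive form. It will be applied to E(x, J y), for which
  the complement of a J-stable subspace is again J-stable.\<close>

lemma orthogonal_projection_exists:
  assumes lin: "\<And>b. linear (\<lambda>a. S a b)" and sym: "\<And>a b. S a b = S b a"
    and pos: "\<And>a. a \<noteq> 0 \<Longrightarrow> S a a > (0::real)" and "finite B"
  shows "\<exists>y\<in>span B. \<forall>w\<in>span B. S (x - y) w = 0"
  using assms(4)
proof (induction B arbitrary: x)
  case empty
  have "S x 0 = 0" using linear_0[OF lin] sym by metis
  then show ?case by simp
next
  case (insert b B)
  note S_add = linear_add[OF lin] linear_diff[OF lin] linear_scale[OF lin]
  have lin2: "linear (S a)" for a
  proof -
    have "S a = (\<lambda>b. S b a)" by (auto simp: sym)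
    then show ?thesis using lin[of a] by simp
  qed
  note S_add2 = linear_add[OF lin2] linear_diff[OF lin2] linear_scale[OF lin2]
  obtain b' where b': "b' \<in> span B" "\<And>w. w \<in> span B \<Longrightarrow> S (b - b') w = 0"
    using insert.IH[of b] by blast
  obtain y where y: "y \<in> span B" "\<And>w. w \<in> span B \<Longrightarrow> S (x - y) w = 0"
    using insert.IH[of x] by blast
  \<comment> \<open>The part of \<open>b\<close> orthogonal to the earlier span; if it vanishes,
    \<open>b\<close> adds nothing to the span.\<close>
  define e where "e = b - b'"
  have dec: "\<exists>k u. u \<in> span B \<and> w = k *\<^sub>R e + u" if w: "w \<in> span (insert b B)" for w
  proof -
    obtain k where k: "w - k *\<^sub>R b \<in> span B" using w unfolding span_breakdown_eq by blast
    have "w = k *\<^sub>R e + (w - k *\<^sub>R b + k *\<^sub>R b')" by (simp add: e_def scaleR_diff_right)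
    then show ?thesis using k b'(1) by (metis span_add span_scale)
  qed
  have sub: "u \<in> span (insert b B)" if "u \<in> span B" for u
    using that span_mono[of B "insert b B"] by blast
  show ?case
  proof (cases "e = 0")
    case True
    have "\<forall>w\<in>span (insert b B). S (x - y) w = 0"
    proof
      fix w assume "w \<in> span (insert b B)"
      then obtain k u where "u \<in> span B" "w = k *\<^sub>R e + u" using dec by blast
      then show "S (x - y) w = 0" using y(2) True by simp
    qed
    then show ?thesis using sub[OF y(1)] by blast
  next
    case False
    define c where "c = S (x - y) e / S e e"
    have ee: "S e e \<noteq> 0" using pos[OF False] by simp
    have "e \<in> span (insert b B)"
      unfolding e_def using span_diff[OF span_base[of b "insert b B"] sub[OF b'(1)]] by simp
    then have "y + c *\<^sub>R e \<in> span (insert b B)"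
      using sub[OF y(1)] by (intro span_add span_scale)
    moreover have "S (x - (y + c *\<^sub>R e)) w = 0" if w: "w \<in> span (insert b B)" for w
    proof -
      obtain k u where u: "u \<in> span B" "w = k *\<^sub>R e + u" using dec[OF w] by blast
      have "S (x - (y + c *\<^sub>R e)) w = S ((x - y) - c *\<^sub>R e) w" by (simp add: algebra_simps)
      also have "\<dots> = S (x - y) w - c * S e w" by (simp only: S_add real_scaleR_def)
      also have "\<dots> = k * (S (x - y) e - c * S e e) + (S (x - y) u - c * S e u)"
        by (simp add: u(2) S_add2 algebra_simps)
      also have "\<dots> = 0" using y(2)[OF u(1)] b'(2)[OF u(1)] ee by (simp add: c_def e_def[symmetric])
      finally show ?thesis .
    qed
    ultimately show ?thesis by blast
  qed
qed

text \<open>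
  The projection onto \<open>W\<close> along its orthogonal complement. Its matrix has rational entries since a
  \<open>\<rat>\<close>-linear retraction \<open>\<real> \<rightarrow> \<rat>\<close> maps solutions of a rational linear system to solutions, and
  the solution is unique here.
\<close>

lemma rational_projection:
  fixes J :: "'a::euclidean_space \<Rightarrow> 'a" and E :: "'a \<Rightarrow> 'a \<Rightarrow> real"
  assumes J: "linear J" "\<And>s. J (J s) = - s"
    and E: "\<And>s. linear (E s)" "\<And>t. linear (\<lambda>s. E s t)" "\<And>s. E s s = 0"
      "\<And>s t. E (J s) (J t) = E s t" "\<And>s. s \<noteq> 0 \<Longrightarrow> E s (J s) > 0"
      "\<And>s t. s \<in> zlat \<Longrightarrow> t \<in> zlat \<Longrightarrow> E s t \<in> \<int>"
    and W: "subspace W" "full_lattice W (W \<inter> zlat)" "\<And>w. w \<in> W \<Longrightarrow> J w \<in> W"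
  obtains g and n :: nat where "n > 0" "linear g" "g ` zlat \<subseteq> zlat" "\<And>s. g (J s) = J (g s)"
    "\<And>s. g s \<in> W" "\<And>w. w \<in> W \<Longrightarrow> g w = real n *\<^sub>R w"
proof -
  note E_lin = linear_add[OF E(1)] linear_add[OF E(2)] linear_diff[OF E(1)] linear_diff[OF E(2)]
    linear_scale[OF E(1)] linear_scale[OF E(2)] linear_neg[OF E(1)] linear_neg[OF E(2)]
    linear_0[OF E(1)] linear_0[OF E(2)]
  have anti: "E s t = - E t s" for s t
    using E(3)[of "s + t"] E(3)[of s] E(3)[of t] unfolding E_lin by linarith
  have J_shift: "E (J s) t = - E s (J t)" for s t
    using E(4)[of s "J t"] by (simp add: J(2) E_lin) 
  obtain B where B: "finite B" "independent B" "span B = W"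
    "W \<inter> zlat = range (\<lambda>c :: 'a \<Rightarrow> int. \<Sum>b\<in>B. of_int (c b) *\<^sub>R b)"
    using W(2) by (auto simp: full_lattice_def)
  have B_zlat: "b \<in> zlat" if "b \<in> B" for b
  proof -
    have "(\<Sum>d\<in>B. of_int (if d = b then 1 else 0) *\<^sub>R d) = (\<Sum>d\<in>B. if d = b then b else 0)"
      by (rule sum.cong) auto
    also have "\<dots> = b" using B(1) that by simp
    finally have "b \<in> range (\<lambda>c :: 'a \<Rightarrow> int. \<Sum>b\<in>B. of_int (c b) *\<^sub>R b)"
      unfolding image_iff by (intro bexI[where x = "\<lambda>d. if d = b then 1 else 0"] UNIV_I) (rule sym)
    then show ?thesis using B(4) by blast
  qed
  have uniq: "d = 0" if "d \<in> W" "\<And>w. w \<in> W \<Longrightarrow> E d w = 0" for d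
    using that(2)[OF W(3)[OF that(1)]] E(5)[of d] by (cases "d = 0") auto
  have "\<exists>y\<in>span B. \<forall>w\<in>span B. E (x - y) (J w) = 0" for x
  proof (rule orthogonal_projection_exists)
    show "linear (\<lambda>a. E a (J b))" for b by (rule E(2))
    show "E a (J b) = E b (J a)" for a b using anti[of a "J b"] J_shift[of b a] by simp
  qed (use E(5) B(1) in auto)
  then have proj: "\<exists>y\<in>W. \<forall>w\<in>W. E (x - y) (J w) = 0" for x unfolding B(3) .
  have "\<exists>y. y \<in> W \<and> (\<forall>w\<in>W. E (x - y) w = 0)" for x
  proof -
    obtain y where y: "y \<in> W" "\<And>w. w \<in> W \<Longrightarrow> E (x - y) (J w) = 0" using proj by blast
    \<comment> \<open>\<open>W\<close> is stable under \<open>J\<close>, so every w in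
      \<open>W\<close> is J applied to the element - J w of \<open>W\<close>.\<close>
    have "E (x - y) w = 0" if "w \<in> W" for w
      using y(2)[OF subspace_neg[OF W(1) W(3)[OF that]]] by (simp add: linear_neg[OF J(1)] J(2))
    then show ?thesis using y(1) by blast
  qed
  then have "\<exists>p. \<forall>x. p x \<in> W \<and> (\<forall>w\<in>W. E (x - p x) w = 0)" by (rule choice[OF allI])
  then obtain p where p: "\<And>x. p x \<in> W" "\<And>x w. w \<in> W \<Longrightarrow> E (x - p x) w = 0"
    by blast
  have p_eq: "p x = y" if "y \<in> W" "\<And>w. w \<in> W \<Longrightarrow> E (x - y) w = 0" for x y
  proof -
    have "y - p x = 0"
    proof (rule uniq)
      show "y - p x \<in> W" using that(1) p(1) W(1) by (intro subspace_diff)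
      show "E (y - p x) w = 0" if "w \<in> W" for w
        using p(2)[OF that, of x] \<open>\<And>w. w \<in> W \<Longrightarrow> E (x - y) w = 0\<close>[OF that] by (simp add: E_lin)
    qed
    then show ?thesis by simp
  qed
  have lin_p: "linear p"
  proof (rule linearI)
    show "p (x + y) = p x + p y" for x y
    proof (rule p_eq)
      show "E (x + y - (p x + p y)) w = 0" if "w \<in> W" for w
        using p(2)[OF that, of x] p(2)[OF that, of y] by (simp add: E_lin)
    qed (intro subspace_add W(1) p(1))
    show "p (r *\<^sub>R x) = r *\<^sub>R p x" for r x
    proof (rule p_eq)
      show "E (r *\<^sub>R x - r *\<^sub>R p x) w = 0" if "w \<in> W" for w
        using p(2)[OF that, of x] by (simp add: E_lin)
    qed (intro subspace_scale W(1) p(1))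
  qed
  have p_J: "p (J x) = J (p x)" for x
  proof (rule p_eq)
    show "J (p x) \<in> W" by (intro W(3) p(1))
    show "E (J x - J (p x)) w = 0" if "w \<in> W" for w
      using p(2)[OF W(3)[OF that], of x] by (simp add: linear_diff[OF J(1), symmetric] J_shift)
  qed
  have p_W: "p w = w" if "w \<in> W" for w
    using that by (intro p_eq) (simp_all add: E_lin)
  obtain th :: "real \<Rightarrow> real" where th: "\<And>a b. th (a + b) = th a + th b" "th 1 = 1" "\<And>a. th a \<in> \<rat>"
    using exists_rational_functional by blast
  have th_int: "th n = n" if "n \<in> \<int>" for n
    using additive_scale_int[of th, OF th(1) that, of 1] th(2) by simp
  have th_sum: "th (\<Sum>i\<in>I. f i) = (\<Sum>i\<in>I. th (f i))" for I and f :: "'a \<Rightarrow> real"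
    using th(1) th_int[of 0] by (induction I rule: infinite_finite_induct) auto
  have rational: "p x \<in> qlat" if x: "x \<in> zlat" for x
  proof -
    obtain c where c: "p x = (\<Sum>b\<in>B. c b *\<^sub>R b)"
      using p(1)[of x] unfolding B(3)[symmetric] span_finite[OF B(1)] by blast
    \<comment> \<open>Retracting the coefficients preserves the equations for \<open>p x\<close>,
      because E(b, b') and E(x, b') are integers for b, b' in \<open>B\<close>.\<close>
    define y where "y = (\<Sum>b\<in>B. th (c b) *\<^sub>R b)"
    have "y - p x = 0"
    proof (rule uniq)
      have "y \<in> W" unfolding y_def B(3)[symmetric] by (intro span_sum span_scale span_base)
      then show yW: "y - p x \<in> W" using p(1) W(1) by (intro subspace_diff)
      have B0: "E (y - p x) b' = 0" if b': "b' \<in> B" for b'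
      proof -
        have "b' \<in> W" using span_base[OF b'] B(3) by simp
        then have "E (p x) b' = E x b'" using p(2)[of b' x] by (simp add: E_lin)
        then have "th (E (p x) b') = E (p x) b'"
          using th_int[OF E(6)[OF x B_zlat[OF b']]] by simp
        moreover have "th (E (p x) b') = (\<Sum>b\<in>B. th (c b * E b b'))"
          by (simp add: c linear_sum[OF E(2)] E_lin th_sum)
        moreover have "(\<Sum>b\<in>B. th (c b * E b b')) = (\<Sum>b\<in>B. th (c b) * E b b')"
          by (rule sum.cong[OF refl additive_scale_int[of th, OF th(1)]]) (intro E(6) B_zlat b')
        moreover have "E y b' = (\<Sum>b\<in>B. th (c b) * E b b')"
          by (simp add: y_def linear_sum[OF E(2)] E_lin)
        ultimately show ?thesis by (simp add: E_lin)
      qed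
      show "E (y - p x) w = 0" if "w \<in> W" for w
        using that[folded B(3)] B0
      proof (induction rule: span_induct_alt)
        case base
        show ?case by (rule linear_0[OF E(1)])
      next
        case (step c b z)
        then show ?case using B0 by (simp add: linear_add[OF E(1)] linear_scale[OF E(1)])
      qed
    qed
    then have "p x = (\<Sum>b\<in>B. th (c b) *\<^sub>R b)" by (simp add: y_def)
    then show ?thesis by (simp only:) (intro qlat_sum qlat_scale_Rats th(3) B_zlat)
  qed
  obtain n :: nat where n: "n > 0" "\<forall>b\<in>Basis. real n *\<^sub>R p b \<in> zlat"
    using common_denominator[OF finite_Basis, of p] rational Basis_zlat by blast
  define g where "g x = real n *\<^sub>R p x" for x
  show ?thesis
  proof (rule that[OF n(1)])
    show lin_g: "linear g"
      by (rule linearI) (simp_all add: g_def linear_add[OF lin_p] linear_scale[OF lin_p] scaleR_add_right)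
    show "g ` zlat \<subseteq> zlat"
    proof
      fix y assume "y \<in> g ` zlat"
      then obtain x where x: "x \<in> zlat" "y = g x" by blast
      have "g x = (\<Sum>b\<in>Basis. (x \<bullet> b) *\<^sub>R g b)"
        by (subst euclidean_representation[symmetric, of x])
          (simp only: linear_sum[OF lin_g] linear_scale[OF lin_g])
      also have "\<dots> \<in> zlat"
        using x(1) n(2) by (intro zlat_sum zlat_scale_Ints) (auto simp: zlat_def g_def)
      finally show "y \<in> zlat" using x(2) by simp
    qed
    show "g (J s) = J (g s)" for s by (simp add: g_def p_J linear_scale[OF J(1)])
    show "g s \<in> W" for s unfolding g_def by (intro subspace_scale W(1) p(1))
    show "g w = real n *\<^sub>R w" if "w \<in> W" for w by (simp add: g_def p_W that)
  qed
qed

section \<open>Rational quaternions inside the real ones\<close>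

definition qconj :: "real ^ 4 \<Rightarrow> real ^ 4" where
  "qconj q = quaternion (q $ 1) (- q $ 2) (- q $ 3) (- q $ 4)"

lemma qm_qconj: "qm q (qconj q) = (q \<bullet> q) *\<^sub>R axis 1 1"
  by (simp add: vec_eq_iff forall_4 qm_def qconj_def inner_vec_def sum_4 axis_def)

lemma qm_one: "qm (axis 1 1) q = q" "qm q (axis 1 1) = q"
  by (simp_all add: vec_eq_iff forall_4 qm_def axis_def)

text \<open>Conjugated, so that composing with the anti-multiplicative \<open>R\<close> gives a ring
  homomorphism.\<close>

fun quat_vec :: "rat_quat \<Rightarrow> real ^ 4" where
  "quat_vec (Quat a b c d) = quaternion (of_rat a) (- of_rat b) (- of_rat c) (- of_rat d)"

lemma quat_vec_mult: "quat_vec (quat_mult x y) = qm (quat_vec y) (quat_vec x)"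
  by (cases x; cases y)
    (simp add: vec_eq_iff forall_4 qm_def of_rat_add of_rat_mult of_rat_diff algebra_simps)

lemma quat_vec_add: "quat_vec (quat_add x y) = quat_vec x + quat_vec y"
  by (cases x; cases y) (simp add: vec_eq_iff forall_4 of_rat_add)

lemma quat_vec_inject: "quat_vec x = quat_vec y \<longleftrightarrow> x = y"
  by (cases x; cases y) (auto simp: vec_eq_iff forall_4)

lemma quat_vec_surj: "(\<And>i. q $ i \<in> \<rat>) \<Longrightarrow> \<exists>x. q = quat_vec x"
proof -
  assume "\<And>i. q $ i \<in> \<rat>"
  then have "\<forall>i. \<exists>r. q $ i = of_rat r" by (auto elim: Rats_cases)
  then obtain r where "\<forall>i. q $ i = of_rat (r i)" by metis
  then have "q = quat_vec (Quat (r 1) (- r 2) (- r 3) (- r 4))"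
    by (simp add: vec_eq_iff forall_4 of_rat_minus)
  then show ?thesis ..
qed

lemma quat_vec_nth_Rats: "quat_vec x $ i \<in> \<rat>"
  using exhaust_4[of i] by (cases x) auto

context spin_rep
begin

section \<open>The torus of a half-spin module\<close>

definition spin_torus :: "real ^ 8 \<Rightarrow> real ^ 8 \<Rightarrow> 'a torus" where
  "spin_torus x y = \<lparr>tspace = UNIV, tlattice = zlat, tcplx = (\<lambda>s. M x (P y s))\<rparr>"

lemma spin_J_square:
  assumes "normal_pair x y"
  shows "M x (P y (M x (P y s))) = - s"
proof -
  have "gram_bilin y x = 0" using assms by (simp add: normal_pair_def gram_bilin_commute)
  then have "P y (M x (P y s)) = - P x (M y (P y s))" by (rule PM_orth)
  then show ?thesis using assms by (simp add: normal_pair_def lin MP)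
qed

lemma spin_J_linear: "linear (\<lambda>s. M x (P y s))"
  by (rule linearI) (simp_all add: lin)

lemma spin_torus_complex: "normal_pair x y \<Longrightarrow> complex_torus (spin_torus x y)"
  by (simp add: complex_torus_def spin_torus_def full_lattice_zlat real_linear_on_UNIV
      spin_J_linear spin_J_square)

lemma spin_torus_abelian:
  assumes xy: "normal_pair x y"
  shows "abelian_variety (spin_torus x y)"
proof -
  have "riemann_form (spin_torus x y) EE"
    unfolding riemann_form_def
    using xy by (auto simp: spin_torus_def real_linear_on_UNIV EE_linear EE_alternating EE_integral
        EE_positive EE_invariant normal_pair_def)
  then show ?thesis using spin_torus_complex[OF xy] by (auto simp: abelian_variety_def)
qed

lemma spin_torus_dim: "torus_dim (spin_torus x y) = 8"
  by (simp add: torus_dim_def spin_torus_def dim16)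

lemma torus_hom_iff:
  "g \<in> torus_hom (spin_torus x y) (spin_torus x y) \<longleftrightarrow>
    linear g \<and> (\<forall>s. g (M x (P y s)) = M x (P y (g s))) \<and> g ` zlat \<subseteq> zlat"
  by (simp add: torus_hom_def complex_linear_def spin_torus_def real_linear_on_UNIV)

text \<open>A nonzero real quaternion is invertible, its inverse being a multiple of the
  conjugate.\<close>

lemma R_cancel:
  assumes "R q s = 0" "s \<noteq> 0"
  shows "q = 0"
proof -
  have "R (qconj q) (R q s) = (q \<bullet> q) *\<^sub>R s"
    by (simp add: R_mult qm_qconj lin R_one)
  then show ?thesis using assms by (simp add: lin)
qed

lemma R_int_coords:
  assumes "R q ` zlat \<subseteq> zlat"
  shows "q $ i \<in> \<int>"
proof -
  have "R q (v 1) \<in> zlat" using assms v_zlat by blast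
  then have "R q (v 1) \<bullet> d i \<in> \<int>" using d_Basis unfolding zlat_def by blast
  then show ?thesis by (simp add: R_coord)
qed

lemma spin_torus_simple:
  assumes xy: "normal_pair x y"
    and comm: "\<And>g. \<lbrakk>linear g; g ` zlat \<subseteq> zlat; \<And>s. g (M x (P y s)) = M x (P y (g s))\<rbrakk>
      \<Longrightarrow> \<exists>q. \<forall>s. g s = R q s"
  shows "simple_abelian_variety (spin_torus x y)"
  unfolding simple_abelian_variety_def
proof (intro conjI allI impI)
  show "abelian_variety (spin_torus x y)" using xy by (rule spin_torus_abelian)
  show "tspace (spin_torus x y) \<noteq> {0}"
    using v1_nonzero by (auto simp: spin_torus_def)
  fix W assume "complex_torus (spin_torus x y\<lparr>tspace := W, tlattice := W \<inter> tlattice (spin_torus x y)\<rparr>)"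
  then have W: "subspace W" "full_lattice W (W \<inter> zlat)" "\<And>w. w \<in> W \<Longrightarrow> M x (P y w) \<in> W"
    by (auto simp: complex_torus_def spin_torus_def real_linear_on_def)
  have Q1: "Q x = 1" "Q y = 1" using xy by (simp_all add: normal_pair_def)
  obtain g and n :: nat where g: "n > 0" "linear g" "g ` zlat \<subseteq> zlat"
    "\<And>s. g (M x (P y s)) = M x (P y (g s))" "\<And>s. g s \<in> W" "\<And>w. w \<in> W \<Longrightarrow> g w = real n *\<^sub>R w"
    using rational_projection[where J = "\<lambda>s. M x (P y s)" and E = EE and W = W, OF spin_J_linear spin_J_square[OF xy] EE_linear EE_alternating
        EE_invariant[OF Q1] EE_positive[OF xy] EE_integral W] by metis
  obtain q where q: "\<And>s. g s = R q s" using comm[OF g(2-4)] by blast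
  show "W = {0} \<or> W = tspace (spin_torus x y)"
  proof (cases "W = {0}")
    case False
    then obtain w where w: "w \<in> W" "w \<noteq> 0" using subspace_0[OF W(1)] by blast
    \<comment> \<open>On \<open>W\<close> the endomorphism is multiplication by n, so q - n kills a
      nonzero vector and must vanish.\<close>
    have "R (q - real n *\<^sub>R axis 1 1) w = 0"
      using g(6)[OF w(1)] by (simp add: q lin R_one)
    then have "q - real n *\<^sub>R axis 1 1 = 0" using w(2) by (rule R_cancel)
    then have "g s = real n *\<^sub>R s" for s by (simp add: q lin R_one)
    then have "s \<in> W" for s
      using subspace_scale[OF W(1) g(5)[of s], of "1 / real n"] g(1) by simp
    then show ?thesis by (auto simp: spin_torus_def)
  qed simp
qed

lemma R_rational_denominator:
  fixes q :: "real ^ 4"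
  assumes "\<And>i. q $ i \<in> \<rat>"
  obtains n :: nat where "n > 0" "\<And>i. (real n *\<^sub>R q) $ i \<in> \<int>"
proof -
  have "q \<in> qlat" using assms by (auto simp: qlat_iff Basis_vec_def inner_axis)
  then obtain n :: nat where n: "n > 0" "real n *\<^sub>R q \<in> zlat" by (auto simp: qlat_def)
  have "(real n *\<^sub>R q) $ i \<in> \<int>" for i
  proof -
    have "axis i 1 \<in> (Basis :: (real ^ 4) set)" by (simp add: axis_in_Basis_iff)
    then have "(real n *\<^sub>R q) \<bullet> axis i 1 \<in> \<int>" using n(2) unfolding zlat_def by blast
    then show ?thesis by (simp add: inner_axis)
  qed
  then show ?thesis using that n(1) by blast
qed

text \<open>The coordinates of q are read off from the lattice vector \<open>R q (v 1)\<close>, so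
  endomorphisms of the torus have integral q. Conversely every integral q preserves the lattice, and
  denominators give exactly the rational quaternions.\<close>

lemma End_Q_spin_torus:
  assumes comm: "\<And>g. \<lbrakk>linear g; g ` zlat \<subseteq> zlat; \<And>s. g (M x (P y s)) = M x (P y (g s))\<rbrakk>
      \<Longrightarrow> \<exists>q. \<forall>s. g s = R q s"
  shows "End_Q (spin_torus x y) \<simeq> quat_ring"
proof -
  let ?T = "spin_torus x y"
  have sp: "tspace ?T = UNIV" by (simp add: spin_torus_def)
  have carrier: "carrier (End_Q ?T) = range (\<lambda>q. R (quat_vec q))"
  proof (intro equalityI subsetI)
    fix f assume "f \<in> carrier (End_Q ?T)"
    then obtain g and n :: nat where g: "g \<in> torus_hom ?T ?T" "n > 0" "f = (\<lambda>s. (1 / real n) *\<^sub>R g s)"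
      by (auto simp: End_Q_def sp restrict_UNIV)
    obtain q where q: "\<And>s. g s = R q s" using comm g(1) unfolding torus_hom_iff by blast
    have "q $ i \<in> \<int>" for i
    proof (rule R_int_coords)
      have "g = R q" using q by blast
      then show "R q ` zlat \<subseteq> zlat" using g(1) by (simp add: torus_hom_iff)
    qed
    then have "q $ i \<in> \<rat>" for i using Ints_subset_Rats by blast
    then have "((1 / real n) *\<^sub>R q) $ i \<in> \<rat>" for i by simp
    then obtain z where "(1 / real n) *\<^sub>R q = quat_vec z" using quat_vec_surj by blast
    then have "R (quat_vec z) s = (1 / real n) *\<^sub>R R q s" for s by (metis linear_scale[OF linear_R'])
    then have "f = R (quat_vec z)" using q by (auto simp: g(3))
    then show "f \<in> range (\<lambda>q. R (quat_vec q))" by blast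
  next
    fix f assume "f \<in> range (\<lambda>q. R (quat_vec q))"
    then obtain z where f: "f = R (quat_vec z)" by blast
    obtain n :: nat where n: "n > 0" "\<And>i. (real n *\<^sub>R quat_vec z) $ i \<in> \<int>"
      using R_rational_denominator[OF quat_vec_nth_Rats] by blast
    let ?g = "R (real n *\<^sub>R quat_vec z)"
    have "?g \<in> torus_hom ?T ?T"
      unfolding torus_hom_iff using R_zlat[OF n(2)] by (auto simp: linear_R PR MR)
    moreover have "f = (\<lambda>s. (1 / real n) *\<^sub>R ?g s)" using n(1) by (simp add: f lin)
    ultimately show "f \<in> carrier (End_Q ?T)" using n(1) by (auto simp: End_Q_def sp restrict_UNIV)
  qed
  have "(\<lambda>q. R (quat_vec q)) \<in> ring_iso quat_ring (End_Q ?T)"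
    unfolding ring_iso_def
  proof (intro CollectI conjI ring_hom_memI)
    show "bij_betw (\<lambda>q. R (quat_vec q)) (carrier quat_ring) (carrier (End_Q ?T))"
      unfolding carrier
    proof (rule bij_betwI')
      fix p q
      show "R (quat_vec p) = R (quat_vec q) \<longleftrightarrow> p = q"
      proof
        assume "R (quat_vec p) = R (quat_vec q)"
        then have "R (quat_vec p) (v 1) \<bullet> d i = R (quat_vec q) (v 1) \<bullet> d i" for i by simp
        then have "quat_vec p = quat_vec q" unfolding R_coord by (simp add: vec_eq_iff)
        then show "p = q" by (simp add: quat_vec_inject)
      qed simp
    qed (auto simp: quat_ring_def)
    fix p q
    show "R (quat_vec (p \<otimes>\<^bsub>quat_ring\<^esub> q)) = R (quat_vec p) \<otimes>\<^bsub>End_Q ?T\<^esub> R (quat_vec q)"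
      by (auto simp: quat_ring_def End_Q_def sp compose_def quat_vec_mult R_mult fun_eq_iff)
    show "R (quat_vec (p \<oplus>\<^bsub>quat_ring\<^esub> q)) = R (quat_vec p) \<oplus>\<^bsub>End_Q ?T\<^esub> R (quat_vec q)"
      by (auto simp: quat_ring_def End_Q_def sp quat_vec_add lin fun_eq_iff)
    have "quat_vec (Quat 1 0 0 0) = axis 1 1"
      by (simp add: vec_eq_iff forall_4 axis_def)
    then show "R (quat_vec \<one>\<^bsub>quat_ring\<^esub>) = \<one>\<^bsub>End_Q ?T\<^esub>"
      by (auto simp: quat_ring_def End_Q_def sp R_one fun_eq_iff)
  qed (simp add: carrier)
  then have "quat_ring \<simeq> End_Q ?T" by (auto simp: is_ring_iso_def)
  then show ?thesis by (rule ring_iso_sym[OF ring_quat_ring])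
qed

end

section \<open>The isogeny\<close>

lemma finite_zlat_bounded: "finite {w \<in> (zlat :: 'a::euclidean_space set). norm w \<le> C}"
proof -
  let ?f = "\<lambda>w :: 'a. \<lambda>b\<in>Basis. w \<bullet> b"
  let ?S = "{w \<in> (zlat :: 'a set). norm w \<le> C}"
  have "finite (Basis \<rightarrow>\<^sub>E {k \<in> \<int>. \<bar>k\<bar> \<le> C} :: ('a \<Rightarrow> real) set)"
    by (intro finite_PiE finite_abs_int_segment) auto
  moreover have "?f ` ?S \<subseteq> Basis \<rightarrow>\<^sub>E {k \<in> \<int>. \<bar>k\<bar> \<le> C}"
  proof (intro subsetI, elim imageE)
    fix f w assume w: "f = ?f w" "w \<in> ?S"
    have "\<bar>w \<bullet> b\<bar> \<le> C" if "b \<in> Basis" for b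
      using Basis_le_norm[OF that, of w] w(2) by simp
    then show "f \<in> Basis \<rightarrow>\<^sub>E {k \<in> \<int>. \<bar>k\<bar> \<le> C}"
      using w by (auto simp: zlat_def)
  qed
  ultimately have "finite (?f ` ?S)" by (rule finite_subset[rotated])
  moreover have "inj_on ?f ?S"
    by (rule inj_onI) (metis euclidean_eqI restrict_apply')
  ultimately show ?thesis by (rule finite_imageD)
qed

lemma zlat_diff: "x \<in> zlat \<Longrightarrow> y \<in> zlat \<Longrightarrow> x - y \<in> zlat"
  by (simp add: zlat_def inner_diff_left)

lemma zlat_prod: "(x, y) \<in> zlat \<longleftrightarrow> x \<in> zlat \<and> y \<in> zlat"
  by (simp add: zlat_def Basis_prod_def ball_Un)

lemma zlat_vec: "(w :: 'a::euclidean_space ^ 'n) \<in> zlat \<longleftrightarrow> (\<forall>i. w $ i \<in> zlat)"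
  by (auto simp: zlat_def Basis_vec_def inner_axis)

lemma zlat_real: "r \<in> (zlat :: real set) \<longleftrightarrow> r \<in> \<int>"
  by (simp add: zlat_def)

lemma ceven_mult:
  fixes z :: "real cliff"
  assumes "z \<in> ceven"
  shows "cvec x * (cvec y * z) \<in> ceven"
  using mult_cmon_span[of "cvec y * z" False x] mult_cmon_span[of z True y] assms
  by (simp add: ceven_eq_span_cmon)

lemma gspan_subset_span: "x \<in> gspan K B \<Longrightarrow> x \<in> span B"
  by (induction rule: gspan.induct) (auto intro: span_zero span_add span_scale span_base)

context spin_rep
begin

lemma cliff_one_nonzero: "(1 :: real cliff) \<noteq> 0"
proof
  assume "(1 :: real cliff) = 0"
  then have "crep 1 (v 1, v 1) = 0" by (simp only: linear_0[OF linear_crep'])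
  then show False using v1_nonzero by (simp add: crep_1 zero_prod_def)
qed

text \<open>The standard basis is not orthogonal, so independence comes from counting: at most 128
  monomials span a space containing 128 independent elements.\<close>

lemma independent_mons_std: "independent (mons True std_gens)"
proof
  let ?X = "mons True std_gens" and ?Y = "mons True orth_gens"
  assume "dependent ?X"
  then obtain a where a: "a \<in> ?X" "a \<in> span (?X - {a})" by (auto simp: dependent_def)
  have "span ?X = ceven" "span ?Y = ceven"
    using ceven_eq_span_mons[OF span_orth_gens] ceven_eq_span_mons[OF span_std_gens] by simp_all
  then have "?Y \<subseteq> span (?X - {a})"
    using span_redundant[OF a(2)] a(1) span_superset[of ?Y] by (simp add: insert_absorb)
  then have "card ?Y \<le> card (?X - {a})"
    using independent_span_bound[OF _ independent_mons_orth] finite_mons by blast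
  also have "\<dots> < card ?X" using a(1) finite_mons by (intro card_Diff1_less)
  also have "\<dots> \<le> 128" using card_mons_le[of True std_gens] by (simp add: std_gens_def mons_card_8)
  finally show False using mons_orth_gens(1) by simp
qed

lemma kuga_satake_complex_torus:
  assumes xy: "normal_pair x y"
  shows "complex_torus (kuga_satake (abs_proj7 (cvec_of x y)))"
proof -
  note ks = ks_m_eq[OF cliff_one_nonzero]
  have xy': "Q x = 1" "Q y = 1" "gram_bilin x y = 0" using xy by (simp_all add: normal_pair_def)
  have "full_lattice ceven (cliff_base_change ` ceven)"
    unfolding full_lattice_def
    by (intro exI[of _ "mons True std_gens"] conjI finite_mons independent_mons_std
        ceven_eq_span_mons[OF span_std_gens, symmetric])
      (simp add: lattice_eq_gspan gspan_Ints finite_mons)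
  moreover have "real_linear_on ceven ceven ((*) (cvec x * cvec y))"
    by (auto simp: real_linear_on_def distrib_left cliff_mult_scaleR_right mult.assoc ceven_mult)
  moreover have "cvec x * cvec y * (cvec x * cvec y * z) = - z" for z
  proof -
    have "cvec x * cvec y * (cvec x * cvec y * z) = (cvec x * cvec y) * (cvec x * cvec y) * z"
      by (simp only: mult.assoc)
    then show ?thesis by (simp only: ks(2)[OF xy']) simp
  qed
  ultimately show ?thesis
    by (simp add: complex_torus_def kuga_satake_def subspace_ceven ks(1)[OF xy'])
qed

lemma Phi_zlat: "z \<in> cliff_base_change ` ceven \<Longrightarrow> Phi z \<in> zlat"
  unfolding lattice_eq_gspan
proof (induction rule: gspan.induct)
  case zero
  show ?case by (simp add: linear_0[OF linear_Phi] zlat_0)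
next
  case (step k b z)
  obtain w where w: "b = cmon w" using mons_std_cmon[OF step(2)] by blast
  have gam: "gam (axis i 1) z \<in> zlat" if "z \<in> zlat" for i z
    using that by (cases z) (simp add: gam_def zlat_prod P_zlat M_zlat)
  have "wact w (v k, v k) \<in> zlat" for w k
    by (induction w) (simp_all add: wact_Nil wact_Cons zlat_prod v_zlat gam)
  then have "Phi b \<in> zlat" by (simp add: Phi_def zlat_vec w crep_cmon)
  then show ?case using step
    by (simp add: linear_add[OF linear_Phi] linear_scale[OF linear_Phi] zlat_add zlat_scale_Ints)
qed

text \<open>Modulo the lattice, coefficients may be replaced by their fractional parts. This bounds
  \<open>Phi\<close> and keeps it integral, so only finitely many values remain, and
  \<open>Phi\<close> is injective.\<close>

lemma Phi_kernel_finite: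
  assumes S: "tspace S = ceven" "tlattice S = cliff_base_change ` ceven"
  shows "finite (torus_point S ` {z \<in> ceven. Phi z \<in> zlat})"
proof -
  define B where "B = mons True std_gens"
  have B: "finite B" "ceven = span B" "cliff_base_change ` ceven = gspan \<int> B"
    using ceven_eq_span_mons[OF span_std_gens] lattice_eq_gspan
    by (simp_all add: B_def finite_mons)
  let ?C = "\<Sum>b\<in>B. norm (Phi b)"
  let ?F = "{z \<in> ceven. Phi z \<in> zlat \<and> norm (Phi z) \<le> ?C}"
  have fin: "finite ?F"
  proof (rule finite_imageD)
    show "finite (Phi ` ?F)"
      by (rule finite_subset[OF _ finite_zlat_bounded[of ?C]]) auto
    show "inj_on Phi ?F" by (rule inj_on_subset[OF inj_on_Phi]) auto
  qed
  have points: "torus_point S z \<in> torus_point S ` ?F" if z: "z \<in> ceven" "Phi z \<in> zlat" for z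
  proof -
    obtain c where c: "z = (\<Sum>b\<in>B. c b *\<^sub>R b)"
      using z(1) B(1,2) span_finite[OF B(1)] by auto
    define z0 where "z0 = (\<Sum>b\<in>B. frac (c b) *\<^sub>R b)"
    define l where "l = (\<Sum>b\<in>B. of_int \<lfloor>c b\<rfloor> *\<^sub>R b)"
    have zl: "z = l + z0"
      by (simp add: c l_def z0_def frac_def flip: sum.distrib scaleR_add_left)
    have l: "l \<in> gspan \<int> B"
      unfolding gspan_Ints[OF B(1)] l_def by (rule range_eqI[of _ _ "\<lambda>b. \<lfloor>c b\<rfloor>"]) simp
    have z0: "z0 \<in> ceven"
      unfolding z0_def B(2) by (intro span_sum span_scale span_base)
    have "Phi z0 \<in> zlat"
    proof -
      have "Phi z0 = Phi z - Phi l" by (simp add: zl linear_add[OF linear_Phi])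
      then show ?thesis using zlat_diff[OF z(2) Phi_zlat[of l]] l B(3) by simp
    qed
    moreover have "norm (Phi z0) \<le> ?C"
    proof -
      have "Phi z0 = (\<Sum>b\<in>B. frac (c b) *\<^sub>R Phi b)"
        by (simp add: z0_def linear_sum[OF linear_Phi] linear_scale[OF linear_Phi])
      also have "norm \<dots> \<le> (\<Sum>b\<in>B. norm (frac (c b) *\<^sub>R Phi b))" by (rule norm_sum)
      also have "\<dots> \<le> ?C"
      proof (rule sum_mono)
        fix b
        have "\<bar>frac (c b)\<bar> \<le> 1" using frac_ge_0[of "c b"] frac_lt_1[of "c b"] by simp
        then show "norm (frac (c b) *\<^sub>R Phi b) \<le> norm (Phi b)"
          by (simp add: mult_left_le_one_le)
      qed
      finally show ?thesis .
    qed
    moreover have "torus_point S z = torus_point S z0"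
    proof -
      have "w - z \<in> gspan \<int> B \<longleftrightarrow> w - z0 \<in> gspan \<int> B" for w
      proof
        assume "w - z \<in> gspan \<int> B"
        from gspan_add[OF this l] show "w - z0 \<in> gspan \<int> B" by (simp add: zl)
      next
        assume w: "w - z0 \<in> gspan \<int> B"
        have "(- 1) *\<^sub>R l \<in> gspan \<int> B" by (rule gspan_scale[OF _ _ l]) auto
        from gspan_add[OF w this] show "w - z \<in> gspan \<int> B" by (simp add: zl algebra_simps)
      qed
      then show ?thesis by (simp add: torus_point_def S B(3))
    qed
    ultimately show ?thesis using z0 by blast
  qed
  have "torus_point S ` {z \<in> ceven. Phi z \<in> zlat} \<subseteq> torus_point S ` ?F"
    using points by blast
  then show ?thesis by (rule finite_subset[OF _ finite_imageI[OF fin]])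
qed

text \<open>Left multiplication by m_1 m_2 becomes the product of the two vector operators on each
  half-spin component, which is complex linearity. The restriction to \<open>ceven\<close> meets the
  convention that homomorphisms are extensional.\<close>

lemma isogeny_Phi:
  assumes xy: "normal_pair x y"
    and S: "S = kuga_satake (abs_proj7 (cvec_of x y))"
    and T: "tspace T = UNIV" "tlattice T = zlat"
      "tcplx T = (\<lambda>w. \<chi> k. (M x (P y (fst (w $ k))), P x (M y (snd (w $ k)))))"
  shows "isogeny S T (restrict Phi ceven)"
proof -
  have ks: "ks_m (abs_proj7 (cvec_of x y)) = cvec x * cvec y"
    using xy by (intro ks_m_eq cliff_one_nonzero) (auto simp: normal_pair_def)
  have S': "tspace S = ceven" "tlattice S = cliff_base_change ` ceven"
    "tcplx S = (\<lambda>z. cvec x * cvec y * z)"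
    by (simp_all add: S kuga_satake_def ks)
  have lat: "cliff_base_change ` ceven \<subseteq> ceven"
    unfolding lattice_eq_gspan ceven_eq_span_mons[OF span_std_gens]
    using gspan_subset_span by blast
  have Phi_J: "Phi (cvec x * (cvec y * z)) = tcplx T (Phi z)" for z
    by (simp add: Phi_def T crep_mult crep_cvec gam_def vec_eq_iff)
  have closed: "a + b \<in> ceven" "r *\<^sub>R a \<in> ceven" "cvec x * (cvec y * a) \<in> ceven"
    if "a \<in> ceven" "b \<in> ceven" for a b :: "real cliff" and r
    using that by (simp_all add: ceven_add subspace_scale[OF subspace_ceven] ceven_mult)
  have "real_linear_on ceven UNIV (restrict Phi ceven)"
    by (simp add: real_linear_on_def closed linear_add[OF linear_Phi] linear_scale[OF linear_Phi])
  moreover have "restrict Phi ceven ` (cliff_base_change ` ceven) \<subseteq> zlat"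
  proof (intro subsetI, elim imageE[of _ "restrict Phi ceven"])
    fix w z assume z: "w = restrict Phi ceven z" "z \<in> cliff_base_change ` ceven"
    then have "z \<in> ceven" using lat by blast
    then show "w \<in> zlat" using Phi_zlat[OF z(2)] z(1) by simp
  qed
  moreover have "restrict Phi ceven (cvec x * cvec y * z) = tcplx T (restrict Phi ceven z)"
    if "z \<in> ceven" for z
    using that closed(3)[OF that that] by (simp add: mult.assoc Phi_J)
  ultimately have "restrict Phi ceven \<in> torus_hom S T"
    by (simp add: torus_hom_def complex_linear_def S' T(1,2))
  moreover have "(\<lambda>z. torus_point T (restrict Phi ceven z)) ` tspace S = torus_point T ` tspace T"
  proof -
    have "(\<lambda>z. torus_point T (restrict Phi ceven z)) ` tspace S = torus_point T ` (Phi ` ceven)"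
      by (auto simp: S')
    then show ?thesis by (simp add: surj_Phi T)
  qed
  moreover have "finite (torus_point S `
      {z \<in> tspace S. torus_point T (restrict Phi ceven z) = torus_point T 0})"
  proof -
    have ker: "Phi z \<in> zlat" if "torus_point T (Phi z) = torus_point T 0" for z
    proof -
      have "Phi z \<in> torus_point T (Phi z)" by (simp add: torus_point_def T zlat_0)
      then show ?thesis unfolding that by (simp add: torus_point_def T)
    qed
    have "{z \<in> tspace S. torus_point T (restrict Phi ceven z) = torus_point T 0}
        \<subseteq> {z \<in> ceven. Phi z \<in> zlat}"
    proof (intro subsetI CollectI conjI)
      fix z assume "z \<in> {z \<in> tspace S. torus_point T (restrict Phi ceven z) = torus_point T 0}"
      then have z: "z \<in> ceven" "torus_point T (restrict Phi ceven z) = torus_point T 0"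
        unfolding S'(1) by blast+
      have "Phi z \<in> zlat" using ker z(2) unfolding restrict_apply'[OF z(1)] by blast
      then show "z \<in> ceven" "Phi z \<in> zlat" using z(1) by blast+
    qed
    then show ?thesis
      by (rule finite_subset[OF image_mono Phi_kernel_finite[OF S'(1,2)]])
  qed
  ultimately show ?thesis by (simp add: isogeny_def)
qed

end

section \<open>The spinor modules over the rational quaternions\<close>

lemma qm_assoc: "qm (qm p q) r = qm p (qm q r)"
  by (simp add: vec_eq_iff forall_4 qm_def algebra_simps)

lemma qm_linear: "linear (qm p)" "linear (\<lambda>p. qm p q)"
  by (rule linearI; simp add: vec_eq_iff forall_4 qm_def algebra_simps)+

lemma qconj_linear: "linear qconj"
  by (rule linearI) (simp_all add: vec_eq_iff forall_4 qconj_def)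

lemma qconj_qm: "qm (qconj q) q = (q \<bullet> q) *\<^sub>R axis 1 1"
  by (simp add: vec_eq_iff forall_4 qm_def qconj_def inner_vec_def sum_4 axis_def)

lemma qm_adjoint: "qm p q \<bullet> r = q \<bullet> qm (qconj p) r"
  by (simp add: qm_def qconj_def inner_vec_def sum_4 algebra_simps)

lemma qm_zlat: "p \<in> zlat \<Longrightarrow> q \<in> zlat \<Longrightarrow> qm p q \<in> zlat"
  by (simp add: zlat_vec zlat_real forall_4 qm_def)

lemma qconj_zlat: "p \<in> zlat \<Longrightarrow> qconj p \<in> zlat"
  by (simp add: zlat_vec zlat_real forall_4 qconj_def)

text \<open>
  On \<open>y = (x\<^sub>5, \<dots>, x\<^sub>8)\<close> the form is \<open>- 2 N(y)\<close>; the factor \<open>1 + i\<close> of norm \<open>2\<close> makes the action of \<open>y\<close>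
  skew-adjoint for the standard inner product.
\<close>

definition aniso :: "real ^ 8 \<Rightarrow> real ^ 4" where
  "aniso x = qm (quaternion (x $ 5) (x $ 6) (x $ 7) (x $ 8)) (quaternion 1 1 0 0)"

definition nn :: "real ^ 8 \<Rightarrow> real ^ 4 \<Rightarrow> real ^ 4" where
  "nn x s = qm (aniso x) s"

definition nt :: "real ^ 8 \<Rightarrow> real ^ 4 \<Rightarrow> real ^ 4" where
  "nt x s = qm (qconj (aniso x)) s"

lemma aniso_linear: "linear aniso"
  by (rule linearI) (simp_all add: aniso_def vec_eq_iff forall_4 qm_def algebra_simps)

lemma aniso_norm: "aniso x \<bullet> aniso x =
    2 * (x $ 5 * x $ 5 + x $ 6 * x $ 6 + x $ 7 * x $ 7 + x $ 8 * x $ 8)"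
  by (simp add: aniso_def inner_vec_def sum_4 qm_def algebra_simps)

lemma aniso_theta: "aniso (theta x) = - aniso x"
  by (simp add: aniso_def theta_def vec_eq_iff forall_4 qm_def)

lemma aniso_zlat: "aniso (axis i 1) \<in> zlat"
  unfolding aniso_def by (intro qm_zlat) (auto simp: zlat_vec zlat_real forall_4 axis_def)

lemma nn_nt: "nn x (nt x s) = (aniso x \<bullet> aniso x) *\<^sub>R s" "nt x (nn x s) = (aniso x \<bullet> aniso x) *\<^sub>R s"
  by (simp_all add: nn_def nt_def qm_qconj qconj_qm qm_one linear_scale[OF qm_linear(2)]
      flip: qm_assoc)

lemma nn_lin:
  "nn x (s + t) = nn x s + nn x t" "nn x (s - t) = nn x s - nn x t" "nn x (r *\<^sub>R s) = r *\<^sub>R nn x s"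
  "nn (x + y) s = nn x s + nn y s" "nn (r *\<^sub>R x) s = r *\<^sub>R nn x s" "nn (theta x) s = - nn x s"
  "nt x (s + t) = nt x s + nt x t" "nt x (s - t) = nt x s - nt x t" "nt x (r *\<^sub>R s) = r *\<^sub>R nt x s"
  "nt (x + y) s = nt x s + nt y s" "nt (r *\<^sub>R x) s = r *\<^sub>R nt x s" "nt (theta x) s = - nt x s"
  by (simp_all add: nn_def nt_def linear_add[OF qm_linear(1)] linear_diff[OF qm_linear(1)]
      linear_scale[OF qm_linear(1)] linear_add[OF qm_linear(2)] linear_scale[OF qm_linear(2)]
      linear_neg[OF qm_linear(2)] linear_add[OF aniso_linear] linear_scale[OF aniso_linear]
      linear_add[OF qconj_linear] linear_scale[OF qconj_linear] linear_neg[OF qconj_linear]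
      aniso_theta)

lemma nn_qm: "nn x (qm s q) = qm (nn x s) q" "nt x (qm s q) = qm (nt x s) q"
  by (simp_all add: nn_def nt_def qm_assoc)

lemma qconj_qconj: "qconj (qconj q) = q"
  by (simp add: vec_eq_iff forall_4 qconj_def)

lemma nn_adjoint: "nn x s \<bullet> t = s \<bullet> nt x t" "nt x s \<bullet> t = s \<bullet> nn x t"
  by (simp_all add: nn_def nt_def qm_adjoint qconj_qconj)

lemma nn_zlat: "s \<in> zlat \<Longrightarrow> nn (axis i 1) s \<in> zlat" "s \<in> zlat \<Longrightarrow> nt (axis i 1) s \<in> zlat"
  by (simp_all add: nn_def nt_def qm_zlat aniso_zlat qconj_zlat)

text \<open>The coordinates of \<open>real ^ 16\<close> are distributed over four quaternions.\<close>

definition blocks :: "16 \<Rightarrow> 4 \<times> 4" where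
  "blocks = (SOME h. bij h)"

lemma bij_blocks: "bij blocks"
proof -
  have "\<exists>h :: 16 \<Rightarrow> 4 \<times> 4. bij_betw h UNIV UNIV"
    by (rule finite_same_card_bij) (simp_all add: card_cartesian_product flip: UNIV_Times_UNIV)
  then show ?thesis unfolding blocks_def by (rule someI_ex)
qed

definition get :: "real ^ 16 \<Rightarrow> 4 \<Rightarrow> real ^ 4" where
  "get s a = (\<chi> b. s $ inv_into UNIV blocks (a, b))"

definition mk :: "(4 \<Rightarrow> real ^ 4) \<Rightarrow> real ^ 16" where
  "mk f = (\<chi> i. f (fst (blocks i)) $ snd (blocks i))"

lemma get_mk: "get (mk f) a = f a"
  by (simp add: get_def mk_def vec_eq_iff surj_f_inv_f[OF bij_is_surj[OF bij_blocks]])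

lemma get_nth: "get s (fst (blocks i)) $ snd (blocks i) = s $ i"
  by (simp add: get_def inv_f_f[OF bij_is_inj[OF bij_blocks]])

lemma get_ext: "(\<And>a. get s a = get t a) \<Longrightarrow> s = t"
  by (metis get_nth vec_eq_iff)

lemma get_linear: "linear (\<lambda>s. get s a)"
  by (rule linearI) (simp_all add: get_def vec_eq_iff)

lemma get_inner: "s \<bullet> t = (\<Sum>a\<in>UNIV. get s a \<bullet> get t a)"
proof -
  have "(\<Sum>i\<in>UNIV. s $ i * t $ i) =
      (\<Sum>i\<in>UNIV. (\<lambda>(a, b). get s a $ b * get t a $ b) (blocks i))"
    by (simp add: split_def get_nth)
  also have "\<dots> = (\<Sum>(a, b)\<in>UNIV. get s a $ b * get t a $ b)"
    by (rule sum.reindex_bij_betw[OF bij_blocks])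
  also have "\<dots> = (\<Sum>a\<in>UNIV. \<Sum>b\<in>UNIV. get s a $ b * get t a $ b)"
    by (simp add: sum.cartesian_product flip: UNIV_Times_UNIV)
  finally show ?thesis by (simp add: inner_vec_def)
qed

lemma get_zlat: "s \<in> zlat \<longleftrightarrow> (\<forall>a. get s a \<in> zlat)"
proof
  assume "s \<in> zlat"
  then show "\<forall>a. get s a \<in> zlat" by (simp add: zlat_vec get_def)
next
  assume "\<forall>a. get s a \<in> zlat"
  then have "get s (fst (blocks i)) $ snd (blocks i) \<in> zlat" for i by (simp add: zlat_vec)
  then show "s \<in> zlat" by (simp add: zlat_vec get_nth)
qed

text \<open>The four slots form an exterior algebra on two generators with quaternion coefficients:
  \<epsilon>_2 and \<epsilon>_4 create, \<epsilon>_1 and \<epsilon>_3 contract, with factors 2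
  because (2 x_1)(2 x_2) = 4 x_1 x_2. Conjugation of the anisotropic part alternates with the
  degree, and its sign is reversed in \<open>spM\<close>, so that the cross terms in the products of
  \<open>spP\<close> and \<open>spM\<close> cancel.\<close>

definition spP :: "real ^ 8 \<Rightarrow> real ^ 16 \<Rightarrow> real ^ 16" where
  "spP x s = mk (\<lambda>a.
     if a = 1 then (2 * x $ 1) *\<^sub>R get s 2 + (2 * x $ 3) *\<^sub>R get s 3 - nt x (get s 1)
     else if a = 2 then (2 * x $ 2) *\<^sub>R get s 1 + (2 * x $ 3) *\<^sub>R get s 4 - nn x (get s 2)
     else if a = 3 then (2 * x $ 4) *\<^sub>R get s 1 - (2 * x $ 1) *\<^sub>R get s 4 - nn x (get s 3)
     else (2 * x $ 4) *\<^sub>R get s 2 - (2 * x $ 2) *\<^sub>R get s 3 - nt x (get s 4))"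

definition spM :: "real ^ 8 \<Rightarrow> real ^ 16 \<Rightarrow> real ^ 16" where
  "spM x s = mk (\<lambda>a.
     if a = 1 then (2 * x $ 1) *\<^sub>R get s 2 + (2 * x $ 3) *\<^sub>R get s 3 + nn x (get s 1)
     else if a = 2 then (2 * x $ 2) *\<^sub>R get s 1 + (2 * x $ 3) *\<^sub>R get s 4 + nt x (get s 2)
     else if a = 3 then (2 * x $ 4) *\<^sub>R get s 1 - (2 * x $ 1) *\<^sub>R get s 4 + nt x (get s 3)
     else (2 * x $ 4) *\<^sub>R get s 2 - (2 * x $ 2) *\<^sub>R get s 3 + nn x (get s 4))"

definition spR :: "real ^ 4 \<Rightarrow> real ^ 16 \<Rightarrow> real ^ 16" where
  "spR q s = mk (\<lambda>a. qm (get s a) q)"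

definition spv :: "4 \<Rightarrow> real ^ 16" where
  "spv k = mk (\<lambda>a. if a = k then axis 1 1 else 0)"

definition spd :: "4 \<Rightarrow> real ^ 16" where
  "spd k = mk (\<lambda>a. if a = 1 then axis k 1 else 0)"

lemma get_simps [simp]:
  "get (s + t) a = get s a + get t a" "get (s - t) a = get s a - get t a"
  "get (- s) a = - get s a" "get (r *\<^sub>R s) a = r *\<^sub>R get s a"
  by (simp_all add: linear_add[OF get_linear] linear_diff[OF get_linear] linear_neg[OF get_linear]
      linear_scale[OF get_linear])

lemma four_ext: "get s 1 = get t 1 \<Longrightarrow> get s 2 = get t 2 \<Longrightarrow> get s 3 = get t 3 \<Longrightarrow> get s 4 = get t 4 \<Longrightarrow> s = t"
  using exhaust_4 by (intro get_ext) metis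

lemma bilinear_spP: "bilinear spP" and bilinear_spM: "bilinear spM" and bilinear_spR: "bilinear spR"
  unfolding bilinear_def
  by (intro conjI allI linearI four_ext;
      simp add: spP_def spM_def spR_def get_mk nn_lin algebra_simps linear_add[OF qm_linear(1)]
        linear_add[OF qm_linear(2)] linear_scale[OF qm_linear(1)] linear_scale[OF qm_linear(2)])+

lemma spM_spP: "spM x (spP x s) = Q x *\<^sub>R s" and spP_spM: "spP x (spM x s) = Q x *\<^sub>R s"
  by (rule four_ext; simp add: spP_def spM_def get_mk nn_lin nn_nt aniso_norm Q_expand algebra_simps)+

lemma theta_nth: "theta x $ 1 = x $ 2" "theta x $ 2 = x $ 1" "theta x $ 3 = x $ 4" "theta x $ 4 = x $ 3"
  by (simp_all add: theta_def)

lemma spP_adjoint: "spP x s \<bullet> t = s \<bullet> spM (theta x) t" and spM_adjoint: "spM x s \<bullet> t = s \<bullet> spP (theta x) t"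
  unfolding get_inner sum_4 spP_def spM_def get_mk
  by (simp_all add: nn_lin inner_add_left inner_add_right inner_diff_left inner_diff_right
      nn_adjoint theta_nth)

lemma spinor_zlat:
  assumes "s \<in> zlat"
  shows "spP (axis i 1) s \<in> zlat" "spM (axis i 1) s \<in> zlat"
proof -
  have "get s a \<in> zlat" for a using assms by (simp add: get_zlat)
  moreover have "2 * axis i 1 $ j \<in> \<int>" for j :: 8 by (simp add: axis_def)
  ultimately show "spP (axis i 1) s \<in> zlat" "spM (axis i 1) s \<in> zlat"
    unfolding get_zlat spP_def spM_def get_mk
    by (auto intro!: zlat_add zlat_diff zlat_scale_Ints nn_zlat)
qed

lemma spR_spP: "spP x (spR q s) = spR q (spP x s)" and spR_spM: "spM x (spR q s) = spR q (spM x s)"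
  by (rule four_ext; simp add: spP_def spM_def spR_def get_mk nn_qm linear_add[OF qm_linear(2)]
      linear_diff[OF qm_linear(2)] linear_scale[OF qm_linear(2)])+

lemma spR_mult: "spR p (spR q s) = spR (qm q p) s"
  by (rule get_ext) (simp add: spR_def get_mk qm_assoc)

lemma spR_one: "spR (axis 1 1) s = s"
  by (rule get_ext) (simp add: spR_def get_mk qm_one)

lemma spR_zlat: "(\<And>i. q $ i \<in> \<int>) \<Longrightarrow> s \<in> zlat \<Longrightarrow> spR q s \<in> zlat"
  unfolding get_zlat spR_def get_mk by (simp add: qm_zlat zlat_vec[of q] zlat_real)

lemma spv_zlat: "spv k \<in> zlat"
  by (simp add: get_zlat spv_def get_mk zlat_vec zlat_real axis_def)

lemma spd_Basis: "spd k \<in> Basis"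
proof -
  have "spd k = axis (inv_into UNIV blocks (1, k)) 1"
  proof (rule get_ext)
    fix a
    have "inv_into UNIV blocks (a, b) = inv_into UNIV blocks (1, k) \<longleftrightarrow> a = 1 \<and> b = k" for b
      using bij_blocks by (metis bij_inv_eq_iff prod.inject)
    moreover have "get (spd k) a = (if a = 1 then axis k 1 else 0)" by (simp add: spd_def get_mk)
    ultimately show "get (spd k) a = get (axis (inv_into UNIV blocks (1, k)) 1) a"
      by (auto simp: get_def vec_eq_iff axis_def)
  qed
  then show ?thesis by (simp add: axis_in_Basis_iff)
qed

lemma spR_coord: "spR q (spv 1) \<bullet> spd k = q $ k"
  by (simp add: get_inner sum_4 spR_def spv_def spd_def get_mk qm_one inner_axis)

lemma spR_generated: "\<exists>q. s = (\<Sum>k\<in>UNIV. spR (q k) (spv k))"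
proof
  show "s = (\<Sum>k\<in>UNIV. spR (get s k) (spv k))"
  proof (rule get_ext)
    fix a
    have "get (\<Sum>k\<in>UNIV. spR (get s k) (spv k)) a = (\<Sum>k\<in>UNIV. if k = a then get s a else 0)"
      unfolding linear_sum[OF get_linear] spR_def spv_def get_mk
      by (rule sum.cong) (auto simp: qm_one linear_0[OF qm_linear(2)])
    then show "get s a = get (\<Sum>k\<in>UNIV. spR (get s k) (spv k)) a" by simp
  qed
qed

section \<open>The two half-spin modules\<close>

interpretation plus: spin_rep spP spM spR spv spd
  by unfold_locales
    (simp_all add: bilinear_spP bilinear_spM bilinear_spR spM_spP spP_spM spP_adjoint spinor_zlat
      spR_spP spR_spM spR_mult spR_one spR_zlat spv_zlat spd_Basis spR_coord spR_generated)

text \<open>Exchanging the operators puts the odd half-spin module first; the quaternion action, the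
  generators and the lattice stay the same.\<close>

interpretation minus: spin_rep spM spP spR spv spd
  by unfold_locales
    (simp_all add: bilinear_spP bilinear_spM bilinear_spR spM_spP spP_spM spM_adjoint spinor_zlat
      spR_spP spR_spM spR_mult spR_one spR_zlat spv_zlat spd_Basis spR_coord spR_generated)

theorem theorem7:
  shows "for_general D_plus (\<lambda>\<eta>.
    \<exists>A1 A2 :: (real ^ 16) torus.
      simple_abelian_variety A1 \<and> torus_dim A1 = 8 \<and> End_Q A1 \<simeq> quat_ring \<and>
      simple_abelian_variety A2 \<and> torus_dim A2 = 8 \<and> End_Q A2 \<simeq> quat_ring \<and>
      isogenous (kuga_satake \<eta>)
        (torus_power (torus_prod A1 A2) :: (((real ^ 16) \<times> (real ^ 16)) ^ 4) torus))"
proof -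
  obtain \<Z>1 where Z1: "countable \<Z>1" "\<forall>Z\<in>\<Z>1. analytic_subset D_plus Z \<and> Z \<noteq> D_plus"
    and comm1: "\<forall>x y g. normal_pair x y \<and> abs_proj7 (cvec_of x y) \<in> D_plus - \<Union>\<Z>1 \<and> linear g \<and>
      g ` zlat \<subseteq> zlat \<and> (\<forall>s. g (spM x (spP y s)) = spM x (spP y (g s))) \<longrightarrow> (\<exists>q. \<forall>s. g s = spR q s)"
    using plus.general_commutant by (elim exE conjE)
  obtain \<Z>2 where Z2: "countable \<Z>2" "\<forall>Z\<in>\<Z>2. analytic_subset D_plus Z \<and> Z \<noteq> D_plus"
    and comm2: "\<forall>x y g. normal_pair x y \<and> abs_proj7 (cvec_of x y) \<in> D_plus - \<Union>\<Z>2 \<and> linear g \<and>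
      g ` zlat \<subseteq> zlat \<and> (\<forall>s. g (spP x (spM y s)) = spP x (spM y (g s))) \<longrightarrow> (\<exists>q. \<forall>s. g s = spR q s)"
    using minus.general_commutant by (elim exE conjE)
  show ?thesis
    unfolding for_general_def
  \<comment> \<open>The point has to be general for both half-spin modules, so the two exceptional
    families are united.\<close>
  proof (intro exI[of _ "\<Z>1 \<union> \<Z>2"] conjI ballI)
    show "countable (\<Z>1 \<union> \<Z>2)" using Z1(1) Z2(1) by simp
    show "analytic_subset D_plus Z" "Z \<noteq> D_plus" if "Z \<in> \<Z>1 \<union> \<Z>2" for Z
      using that Z1(2) Z2(2) by blast+
    fix p assume p: "p \<in> D_plus - \<Union>(\<Z>1 \<union> \<Z>2)"
    then obtain x y where xy: "normal_pair x y" "p = abs_proj7 (cvec_of x y)"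
      using D_plus_normal_pair by blast
    have p1: "abs_proj7 (cvec_of x y) \<in> D_plus - \<Union>\<Z>1" and p2: "abs_proj7 (cvec_of x y) \<in> D_plus - \<Union>\<Z>2"
      using p xy(2) by auto
    have c1: "\<exists>q. \<forall>s. g s = spR q s"
      if "linear g" "g ` zlat \<subseteq> zlat" "\<And>s. g (spM x (spP y s)) = spM x (spP y (g s))" for g
      using comm1[rule_format, of x y g] xy(1) p1 that by simp
    have c2: "\<exists>q. \<forall>s. g s = spR q s"
      if "linear g" "g ` zlat \<subseteq> zlat" "\<And>s. g (spP x (spM y s)) = spP x (spM y (g s))" for g
      using comm2[rule_format, of x y g] xy(1) p2 that by simp
    let ?A1 = "plus.spin_torus x y" and ?A2 = "minus.spin_torus x y"
    have A1: "simple_abelian_variety ?A1" "End_Q ?A1 \<simeq> quat_ring"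
      by (rule plus.spin_torus_simple[OF xy(1)] plus.End_Q_spin_torus, rule c1; simp)+
    have A2: "simple_abelian_variety ?A2" "End_Q ?A2 \<simeq> quat_ring"
      by (rule minus.spin_torus_simple[OF xy(1)] minus.End_Q_spin_torus, rule c2; simp)+
    let ?T = "torus_power (torus_prod ?A1 ?A2) :: (((real ^ 16) \<times> (real ^ 16)) ^ 4) torus"
    have zz: "zlat \<times> zlat = (zlat :: ((real ^ 16) \<times> (real ^ 16)) set)" by (auto simp: zlat_prod)
    have T: "tspace ?T = UNIV" "tlattice ?T = zlat"
      "tcplx ?T = (\<lambda>w. \<chi> k. (spM x (spP y (fst (w $ k))), spP x (spM y (snd (w $ k)))))"
      by (auto simp: torus_power_def torus_prod_def plus.spin_torus_def minus.spin_torus_def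
          zlat_vec zz map_prod_def split_def)
    have "linear (tcplx ?T)"
      unfolding T by (rule linearI) (simp_all add: vec_eq_iff plus.lin)
    then have "complex_torus ?T"
      by (simp add: complex_torus_def T(1,2) full_lattice_zlat real_linear_on_UNIV)
        (simp add: T(3) vec_eq_iff prod_eq_iff plus.spin_J_square[OF xy(1)] minus.spin_J_square[OF xy(1)])
    moreover have "complex_torus (kuga_satake p)"
      unfolding xy(2) by (rule plus.kuga_satake_complex_torus[OF xy(1)])
    \<comment> \<open>One interpretation suffices here, since \<open>Phi\<close> already has
      components in both half-spin modules.\<close>
    moreover have "isogeny (kuga_satake p) ?T (restrict plus.Phi ceven)"
      by (rule plus.isogeny_Phi[OF xy(1) _ T]) (simp add: xy(2))
    ultimately have "isogenous (kuga_satake p) ?T" unfolding isogenous_def by blast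
    then show "\<exists>A1 A2 :: (real ^ 16) torus.
      simple_abelian_variety A1 \<and> torus_dim A1 = 8 \<and> End_Q A1 \<simeq> quat_ring \<and>
      simple_abelian_variety A2 \<and> torus_dim A2 = 8 \<and> End_Q A2 \<simeq> quat_ring \<and>
      isogenous (kuga_satake p)
        (torus_power (torus_prod A1 A2) :: (((real ^ 16) \<times> (real ^ 16)) ^ 4) torus)"
      using A1 A2 plus.spin_torus_dim minus.spin_torus_dim
      by (intro exI[of _ ?A1] exI[of _ ?A2] conjI) assumption+
  qed
qed

end
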